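(* Let $p\in\mathbb{R}$ with $p>1$, let $n\in\mathbb{N}$ (so $n\ge 1$), and let $G$ be an infinite group of type $FP_n$ which is FCC, i.e. every conjugacy class of $G$ has only finitely many elements. Then $\overline{H^{(p)}_i(G)}=0$ and $\overline{H_{(p)}^i(G)}=0$ for all $i\le n$.
   Context: $\mathbb{Z}[G]$ is the integral group ring and $\mathbb{Z}$ is the trivial $\mathbb{Z}[G]$-module. $\mathbb{N}$ denotes the positive integers. A group $G$ is of type $FP_n$ if there is an exact sequence $F_n\to\dots\to F_0\to\mathbb{Z}\to 0$ of $\mathbb{Z}[G]$-modules with $F_0,\dots,F_n$ projective and finitely generated. For real $p\ge 1$, $l^p(G)$ is the Banach space of formal sums $f=\sum_{g\in G}f_g g$ with $f_g\in\mathbb{C}$, only countably many $f_g\ne 0$, and $\sum_{g}|f_g|^p=(|f|_p)^p<\infty$; it is a $\mathbb{Z}[G]$-module via translation by $G$. For a projective resolution $\cdots\to F_2\xrightarrow{\partial_2}F_1\xrightarrow{\partial_1}F_0\xrightarrow{\varepsilon}\mathbb{Z}\to 0$ over $\mathbb{Z}[G]$, consider the chain complex $F_i\otimes_{\mathbb{Z}[G]}l^p(G)$, $i\ge0$, with boundary maps $\partial_i\otimes 1$ (left modules being turned into right modules via $xg=g^{-1}x$ when forming tensor products), and the cochain complex $\operatorname{Hom}_{\mathbb{Z}[G]}(F_i,l^p(G))$, $i\ge 0$, with $\widetilde\partial_i(\varphi)=\varphi\circ\partial_i$ (maps with index $0$ are zero). The reduced $l^p$-homology and $l^p$-cohomology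 are $\overline{H^{(p)}_i(G)}=\ker(\partial_i\otimes1)/\overline{\operatorname{im}(\partial_{i+1}\otimes 1)}$ and $\overline{H_{(p)}^i(G)}=\ker(\widetilde\partial_{i+1})/\overline{\operatorname{im}(\widetilde\partial_i)}$. For $G$ of type $FP_n$ the resolution is taken with $F_0,\dots,F_n$ finitely generated; then for $i\le n$ the spaces $F_i\otimes_{\mathbb{Z}[G]}l^p(G)$ and $\operatorname{Hom}_{\mathbb{Z}[G]}(F_i,l^p(G))$ carry natural Banach space topologies (both are $l^p(G)^{m_i}$ if $F_i$ is free of rank $m_i$), in which the closures are taken. *)

theory Defs
  imports "HOL-Analysis.Analysis" "HOL-Algebra.AbelCoset" "HOL-Algebra.Module" "HOL-Algebra.Free_Abelian_Groups"
begin

section \<open>The integral group ring\<close>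

definition FCC_group :: "('g, 'x) monoid_scheme \<Rightarrow> bool" where
  "FCC_group G \<longleftrightarrow>
     (\<forall>x \<in> carrier G. finite {g \<otimes>\<^bsub>G\<^esub> x \<otimes>\<^bsub>G\<^esub> inv\<^bsub>G\<^esub> g | g. g \<in> carrier G})"

text \<open>The additive group is the free abelian group on the elements of \<open>G\<close>;
  \<^const>\<open>frag_extend\<close> is the linear extension of a map given on basis elements.\<close>

definition group_ring :: "('g, 'x) monoid_scheme \<Rightarrow> ('g \<Rightarrow>\<^sub>0 int) ring" where
  "group_ring G =
     \<lparr>carrier = {a. Poly_Mapping.keys a \<subseteq> carrier G},
      mult = (\<lambda>a b. frag_extend (\<lambda>g. frag_extend (\<lambda>h. frag_of (g \<otimes>\<^bsub>G\<^esub> h)) b) a),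
      one = frag_of \<one>\<^bsub>G\<^esub>,
      ring.zero = 0,
      ring.add = (+)\<rparr>"

text \<open>The anti-automorphism of the group ring that inverts group elements. A left module
  becomes a right module via \<open>x \<cdot> a = involution a \<odot> x\<close>.\<close>

definition group_ring_involution :: "('g, 'x) monoid_scheme \<Rightarrow> ('g \<Rightarrow>\<^sub>0 int) \<Rightarrow> ('g \<Rightarrow>\<^sub>0 int)" where
  "group_ring_involution G = frag_extend (\<lambda>g. frag_of (inv\<^bsub>G\<^esub> g))"


section \<open>Left modules over a not necessarily commutative ring\<close>

text \<open>This is the locale \<^locale>\<open>module\<close> without commutativity of the ring. As there, the
  multiplicative fields of the module record are ignored.\<close>

locale left_module = R?: ring R + M?: abelian_group M
  for R :: "('r, 'y) ring_scheme" (structure) and M :: "('r, 'm) module" (structure) +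
  assumes smult_closed:
      "\<lbrakk>a \<in> carrier R; x \<in> carrier M\<rbrakk> \<Longrightarrow> a \<odot>\<^bsub>M\<^esub> x \<in> carrier M"
    and smult_l_distr:
      "\<lbrakk>a \<in> carrier R; b \<in> carrier R; x \<in> carrier M\<rbrakk> \<Longrightarrow>
        (a \<oplus> b) \<odot>\<^bsub>M\<^esub> x = a \<odot>\<^bsub>M\<^esub> x \<oplus>\<^bsub>M\<^esub> b \<odot>\<^bsub>M\<^esub> x"
    and smult_r_distr:
      "\<lbrakk>a \<in> carrier R; x \<in> carrier M; y \<in> carrier M\<rbrakk> \<Longrightarrow>
        a \<odot>\<^bsub>M\<^esub> (x \<oplus>\<^bsub>M\<^esub> y) = a \<odot>\<^bsub>M\<^esub> x \<oplus>\<^bsub>M\<^esub> a \<odot>\<^bsub>M\<^esub> y"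
    and smult_assoc1:
      "\<lbrakk>a \<in> carrier R; b \<in> carrier R; x \<in> carrier M\<rbrakk> \<Longrightarrow>
        (a \<otimes> b) \<odot>\<^bsub>M\<^esub> x = a \<odot>\<^bsub>M\<^esub> (b \<odot>\<^bsub>M\<^esub> x)"
    and smult_one:
      "x \<in> carrier M \<Longrightarrow> \<one> \<odot>\<^bsub>M\<^esub> x = x"

definition lmodule_hom ::
    "('r, 'y) ring_scheme \<Rightarrow> ('r, 'm) module \<Rightarrow> ('r, 'n) module \<Rightarrow> ('m \<Rightarrow> 'n) set" where
  "lmodule_hom R M N =
     {h \<in> carrier M \<rightarrow> carrier N.
        (\<forall>x \<in> carrier M. \<forall>y \<in> carrier M. h (x \<oplus>\<^bsub>M\<^esub> y) = h x \<oplus>\<^bsub>N\<^esub> h y) \<and>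
        (\<forall>a \<in> carrier R. \<forall>x \<in> carrier M. h (a \<odot>\<^bsub>M\<^esub> x) = a \<odot>\<^bsub>N\<^esub> h x)}"

definition finitely_generated_module :: "('r, 'y) ring_scheme \<Rightarrow> ('r, 'm) module \<Rightarrow> bool" where
  "finitely_generated_module R M \<longleftrightarrow>
     (\<exists>X. finite X \<and> X \<subseteq> carrier M \<and>
        (\<forall>H. submodule H R M \<and> X \<subseteq> H \<longrightarrow> H = carrier M))"

definition free_module :: "('r, 'y) ring_scheme \<Rightarrow> 'b set \<Rightarrow> ('r, 'b \<Rightarrow> 'r) module" where
  "free_module R X =
     \<lparr>carrier = {v. (\<forall>b \<in> X. v b \<in> carrier R) \<and> (\<forall>b. b \<notin> X \<longrightarrow> v b = \<zero>\<^bsub>R\<^esub>) \<and>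
                    finite {b \<in> X. v b \<noteq> \<zero>\<^bsub>R\<^esub>}},
      mult = undefined, one = undefined,
      ring.zero = (\<lambda>b. \<zero>\<^bsub>R\<^esub>),
      ring.add = (\<lambda>v w b. if b \<in> X then v b \<oplus>\<^bsub>R\<^esub> w b else \<zero>\<^bsub>R\<^esub>),
      smult = (\<lambda>a v b. if b \<in> X then a \<otimes>\<^bsub>R\<^esub> v b else \<zero>\<^bsub>R\<^esub>)\<rparr>"

text \<open>Projective means isomorphic to a direct summand of a free module. It is no restriction
  to take the basis \<open>X\<close> from the type of elements of \<open>M\<close>: if \<open>M\<close> is a direct summand of any
  free module, then the canonical surjection from the free module on \<open>carrier M\<close> splits.\<close>

definition projective_module :: "('r, 'y) ring_scheme \<Rightarrow> ('r, 'm) module \<Rightarrow> bool" where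
  "projective_module R M \<longleftrightarrow> left_module R M \<and>
     (\<exists>(X :: 'm set) P Q h.
        submodule P R (free_module R X) \<and> submodule Q R (free_module R X) \<and>
        P \<inter> Q = {\<zero>\<^bsub>free_module R X\<^esub>} \<and>
        set_add (free_module R X) P Q = carrier (free_module R X) \<and>
        h \<in> lmodule_hom R M (free_module R X) \<and> bij_betw h (carrier M) P)"

text \<open>The group of module homomorphisms; they are taken to be \<^const>\<open>extensional\<close>, so that
  equality in this group is equality on \<open>carrier M\<close>.\<close>

definition hom_group ::
    "('r, 'y) ring_scheme \<Rightarrow> ('r, 'm) module \<Rightarrow> ('r, 'n) module \<Rightarrow> ('m \<Rightarrow> 'n) monoid" where
  "hom_group R M N =
     \<lparr>carrier = lmodule_hom R M N \<inter> extensional (carrier M),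
      mult = (\<lambda>\<phi> \<psi>. \<lambda>x \<in> carrier M. \<phi> x \<oplus>\<^bsub>N\<^esub> \<psi> x),
      one = (\<lambda>x \<in> carrier M. \<zero>\<^bsub>N\<^esub>)\<rparr>"


section \<open>Projective resolutions and finiteness properties\<close>

text \<open>The trivial module: group elements act as the identity, so a ring element acts through its
  augmentation. The parameter \<open>G\<close> only determines the type.\<close>

definition trivial_module :: "('g, 'x) monoid_scheme \<Rightarrow> ('g \<Rightarrow>\<^sub>0 int, int) module" where
  "trivial_module G =
     \<lparr>carrier = UNIV, mult = undefined, one = undefined, ring.zero = 0, ring.add = (+),
      smult = (\<lambda>a k. (\<Sum>g \<in> Poly_Mapping.keys a. Poly_Mapping.lookup a g) * k)\<rparr>"

text \<open>Exactness of \<open>F\<^sub>n \<rightarrow> \<dots> \<rightarrow> F\<^sub>0 \<rightarrow> \<int> \<rightarrow> 0\<close>, with \<open>F\<^sub>0, \<dots>, F\<^sub>n\<close> projective and boundary maps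
  \<open>d i : F\<^sub>i \<rightarrow> F\<^sub>i\<^sub>-\<^sub>1\<close> for \<open>1 \<le> i \<le> n\<close>; nothing is required of the kernel of \<open>d n\<close>.\<close>

definition partial_projective_resolution ::
    "('g, 'x) monoid_scheme \<Rightarrow> nat \<Rightarrow> (nat \<Rightarrow> ('g \<Rightarrow>\<^sub>0 int, 'm) module) \<Rightarrow>
     (nat \<Rightarrow> 'm \<Rightarrow> 'm) \<Rightarrow> ('m \<Rightarrow> int) \<Rightarrow> bool" where
  "partial_projective_resolution G n F d \<epsilon> \<longleftrightarrow>
     (\<forall>i \<le> n. projective_module (group_ring G) (F i)) \<and>
     (\<forall>i < n. d (Suc i) \<in> lmodule_hom (group_ring G) (F (Suc i)) (F i)) \<and>
     \<epsilon> \<in> lmodule_hom (group_ring G) (F 0) (trivial_module G) \<and>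
     \<epsilon> ` carrier (F 0) = carrier (trivial_module G) \<and>
     (0 < n \<longrightarrow> d 1 ` carrier (F 1) = a_kernel (F 0) (trivial_module G) \<epsilon>) \<and>
     (\<forall>i. Suc i < n \<longrightarrow>
        d (Suc (Suc i)) ` carrier (F (Suc (Suc i))) = a_kernel (F (Suc i)) (F i) (d (Suc i)))"

definition projective_resolution ::
    "('g, 'x) monoid_scheme \<Rightarrow> (nat \<Rightarrow> ('g \<Rightarrow>\<^sub>0 int, 'm) module) \<Rightarrow>
     (nat \<Rightarrow> 'm \<Rightarrow> 'm) \<Rightarrow> ('m \<Rightarrow> int) \<Rightarrow> bool" where
  "projective_resolution G F d \<epsilon> \<longleftrightarrow> (\<forall>n. partial_projective_resolution G n F d \<epsilon>)"

text \<open>The element type \<open>nat \<Rightarrow> 'g \<Rightarrow>\<^sub>0 int\<close> is no restriction: a finitely generated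
  projective module is isomorphic to a submodule of some \<open>\<int>[G]\<^sup>m\<close>.\<close>

definition type_FP :: "nat \<Rightarrow> ('g, 'x) monoid_scheme \<Rightarrow> bool" where
  "type_FP n G \<longleftrightarrow>
     (\<exists>(F :: nat \<Rightarrow> ('g \<Rightarrow>\<^sub>0 int, nat \<Rightarrow> 'g \<Rightarrow>\<^sub>0 int) module) d \<epsilon>.
        partial_projective_resolution G n F d \<epsilon> \<and>
        (\<forall>i \<le> n. finitely_generated_module (group_ring G) (F i)))"


section \<open>The module \<open>l\<^sup>p(G)\<close>\<close>

definition lp_norm :: "real \<Rightarrow> ('g, 'x) monoid_scheme \<Rightarrow> ('g \<Rightarrow> complex) \<Rightarrow> real" where
  "lp_norm p G f = (\<Sum>\<^sub>\<infinity>g \<in> carrier G. cmod (f g) powr p) powr (1 / p)"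

text \<open>A formal sum is represented by its coefficient function, set to zero outside the carrier.
  Summability forces the support to be countable.\<close>

definition lp_module :: "real \<Rightarrow> ('g, 'x) monoid_scheme \<Rightarrow> ('g \<Rightarrow>\<^sub>0 int, 'g \<Rightarrow> complex) module" where
  "lp_module p G =
     \<lparr>carrier = {f. (\<forall>g. g \<notin> carrier G \<longrightarrow> f g = 0) \<and>
                    (\<lambda>g. cmod (f g) powr p) summable_on carrier G},
      mult = undefined, one = undefined,
      ring.zero = (\<lambda>g. 0),
      ring.add = (\<lambda>f1 f2 g. f1 g + f2 g),
      smult = (\<lambda>a f h. if h \<in> carrier G
         then \<Sum>g \<in> Poly_Mapping.keys a. of_int (Poly_Mapping.lookup a g) * f (inv\<^bsub>G\<^esub> g \<otimes>\<^bsub>G\<^esub> h)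
         else 0)\<rparr>"

definition lp_topology :: "real \<Rightarrow> ('g, 'x) monoid_scheme \<Rightarrow> ('g \<Rightarrow> complex) topology" where
  "lp_topology p G =
     Metric_space.mtopology (carrier (lp_module p G)) (\<lambda>f1 f2. lp_norm p G (\<lambda>g. f1 g - f2 g))"


section \<open>Tensor products over the group ring\<close>

text \<open>Both \<open>M\<close> and \<open>N\<close> are left modules; \<open>M\<close> is turned into a right module as above. The tensor
  product is the free abelian group on pairs modulo the subgroup generated by the usual
  relations. Being a quotient group, it is written multiplicatively.\<close>

definition tensor_relations ::
    "('g, 'x) monoid_scheme \<Rightarrow> ('g \<Rightarrow>\<^sub>0 int, 'm) module \<Rightarrow> ('g \<Rightarrow>\<^sub>0 int, 'n) module \<Rightarrow>
     ('m \<times> 'n \<Rightarrow>\<^sub>0 int) set" where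
  "tensor_relations G M N =
     generate (free_Abelian_group (carrier M \<times> carrier N))
       ({frag_of (x \<oplus>\<^bsub>M\<^esub> x', y) - frag_of (x, y) - frag_of (x', y) | x x' y.
           x \<in> carrier M \<and> x' \<in> carrier M \<and> y \<in> carrier N} \<union>
        {frag_of (x, y \<oplus>\<^bsub>N\<^esub> y') - frag_of (x, y) - frag_of (x, y') | x y y'.
           x \<in> carrier M \<and> y \<in> carrier N \<and> y' \<in> carrier N} \<union>
        {frag_of (group_ring_involution G a \<odot>\<^bsub>M\<^esub> x, y) - frag_of (x, a \<odot>\<^bsub>N\<^esub> y) | a x y.
           a \<in> carrier (group_ring G) \<and> x \<in> carrier M \<and> y \<in> carrier N})"

definition tensor_product ::
    "('g, 'x) monoid_scheme \<Rightarrow> ('g \<Rightarrow>\<^sub>0 int, 'm) module \<Rightarrow> ('g \<Rightarrow>\<^sub>0 int, 'n) module \<Rightarrow>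
     ('m \<times> 'n \<Rightarrow>\<^sub>0 int) set monoid" where
  "tensor_product G M N =
     free_Abelian_group (carrier M \<times> carrier N) Mod tensor_relations G M N"

definition pure_tensor ::
    "('g, 'x) monoid_scheme \<Rightarrow> ('g \<Rightarrow>\<^sub>0 int, 'm) module \<Rightarrow> ('g \<Rightarrow>\<^sub>0 int, 'n) module \<Rightarrow>
     'm \<Rightarrow> 'n \<Rightarrow> ('m \<times> 'n \<Rightarrow>\<^sub>0 int) set" where
  "pure_tensor G M N x y =
     tensor_relations G M N #>\<^bsub>free_Abelian_group (carrier M \<times> carrier N)\<^esub> frag_of (x, y)"

text \<open>The map \<open>h \<otimes> 1 : M \<otimes> N \<rightarrow> M' \<otimes> N\<close> for a homomorphism \<open>h : M \<rightarrow> M'\<close>: the coset of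
  \<open>\<Sum> k\<^sub>j (x\<^sub>j, y\<^sub>j)\<close> goes to the coset of \<open>\<Sum> k\<^sub>j (h x\<^sub>j, y\<^sub>j)\<close>. All representatives \<open>c\<close> give
  the same coset, so the union is that coset.\<close>

definition tensor_map ::
    "('g, 'x) monoid_scheme \<Rightarrow> ('g \<Rightarrow>\<^sub>0 int, 'm) module \<Rightarrow> ('g \<Rightarrow>\<^sub>0 int, 'n) module \<Rightarrow>
     ('m' \<Rightarrow> 'm) \<Rightarrow> ('m' \<times> 'n \<Rightarrow>\<^sub>0 int) set \<Rightarrow> ('m \<times> 'n \<Rightarrow>\<^sub>0 int) set" where
  "tensor_map G M' N h C =
     (\<Union>c \<in> C. tensor_relations G M' N #>\<^bsub>free_Abelian_group (carrier M' \<times> carrier N)\<^esub>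
                 frag_extend (\<lambda>(x, y). frag_of (h x, y)) c)"


section \<open>Reduced \<open>l\<^sup>p\<close>-homology and \<open>l\<^sup>p\<close>-cohomology\<close>

text \<open>The topology on \<open>M \<otimes> l\<^sup>p(G)\<close>: the finest one for which the maps
  \<open>l\<^sup>p(G)\<^sup>m \<rightarrow> M \<otimes> l\<^sup>p(G)\<close>, \<open>(l\<^sub>j)\<^sub>j \<mapsto> \<Sum> x\<^sub>j \<otimes> l\<^sub>j\<close>, are continuous, for all \<open>m\<close> and all
  \<open>x\<^sub>0, \<dots>, x\<^sub>m\<^sub>-\<^sub>1 \<in> M\<close>.
  If \<open>x\<close> generates \<open>M\<close>, then the map belonging to any other tuple factors as a continuous map
  \<open>l\<^sup>p(G)\<^sup>k \<rightarrow> l\<^sup>p(G)\<^sup>m\<close> (a matrix over the group ring) followed by the map belonging to \<open>x\<close>, so this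
  is the quotient topology of \<open>l\<^sup>p(G)\<^sup>m\<close> for any single finite generating family \<open>x\<close>. In particular,
  if \<open>x\<close> is a basis of a free module of rank \<open>m\<close>, it is the topology of \<open>l\<^sup>p(G)\<^sup>m\<close>, and for \<open>M\<close> a
  direct summand of such a module it is the topology of the corresponding summand of
  \<open>l\<^sup>p(G)\<^sup>m\<close>.\<close>

definition tensor_lp_topology ::
    "real \<Rightarrow> ('g, 'x) monoid_scheme \<Rightarrow> ('g \<Rightarrow>\<^sub>0 int, 'm) module \<Rightarrow>
     ('m \<times> ('g \<Rightarrow> complex) \<Rightarrow>\<^sub>0 int) set topology" where
  "tensor_lp_topology p G M =
     topology (\<lambda>U. U \<subseteq> carrier (tensor_product G M (lp_module p G)) \<and>
       (\<forall>m :: nat. \<forall>x \<in> {..<m} \<rightarrow> carrier M.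
          openin (product_topology (\<lambda>_. lp_topology p G) {..<m})
            {l \<in> topspace (product_topology (\<lambda>_. lp_topology p G) {..<m}).
               finprod (tensor_product G M (lp_module p G))
                 (\<lambda>j. pure_tensor G M (lp_module p G) (x j) (l j)) {..<m} \<in> U}))"

lemma istopology_final:
  "istopology (\<lambda>U. U \<subseteq> A \<and>
     (\<forall>m. \<forall>x \<in> S m. openin (T m) {l \<in> topspace (T m). \<Phi> m x l \<in> U}))"
proof -
  have "openin (T m) {l \<in> topspace (T m). \<Phi> m x l \<in> U \<inter> V}"
    if "openin (T m) {l \<in> topspace (T m). \<Phi> m x l \<in> U}"
      and "openin (T m) {l \<in> topspace (T m). \<Phi> m x l \<in> V}" for U V m x
  proof -
    have "{l \<in> topspace (T m). \<Phi> m x l \<in> U \<inter> V} =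
        {l \<in> topspace (T m). \<Phi> m x l \<in> U} \<inter> {l \<in> topspace (T m). \<Phi> m x l \<in> V}"
      by auto
    then show ?thesis
      using that by (simp only: openin_Int)
  qed
  moreover have "openin (T m) {l \<in> topspace (T m). \<Phi> m x l \<in> \<Union>\<K>}"
    if "\<forall>K \<in> \<K>. openin (T m) {l \<in> topspace (T m). \<Phi> m x l \<in> K}" for \<K> m x
  proof -
    have "{l \<in> topspace (T m). \<Phi> m x l \<in> \<Union>\<K>} =
        (\<Union>K \<in> \<K>. {l \<in> topspace (T m). \<Phi> m x l \<in> K})"
      by auto
    then show ?thesis
      using that by (auto intro!: openin_Union)
  qed
  ultimately show ?thesis
    unfolding istopology_def by (simp add: Sup_le_iff le_infI1)
qed

lemma openin_tensor_lp_topology: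
  "openin (tensor_lp_topology p G M) U \<longleftrightarrow>
     U \<subseteq> carrier (tensor_product G M (lp_module p G)) \<and>
       (\<forall>m :: nat. \<forall>x \<in> {..<m} \<rightarrow> carrier M.
          openin (product_topology (\<lambda>_. lp_topology p G) {..<m})
            {l \<in> topspace (product_topology (\<lambda>_. lp_topology p G) {..<m}).
               finprod (tensor_product G M (lp_module p G))
                 (\<lambda>j. pure_tensor G M (lp_module p G) (x j) (l j)) {..<m} \<in> U})"
  unfolding tensor_lp_topology_def by (subst topology_inverse'[OF istopology_final]) (rule refl)

text \<open>The topology on \<open>Hom(M, l\<^sup>p(G))\<close> is that of pointwise convergence. If \<open>x\<^sub>1, \<dots>, x\<^sub>m\<close> generate
  \<open>M\<close>, it is the subspace topology for the embedding \<open>\<phi> \<mapsto> (\<phi> x\<^sub>1, \<dots>, \<phi> x\<^sub>m)\<close> into \<open>l\<^sup>p(G)\<^sup>m\<close>, which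
  is surjective if \<open>M\<close> is free with basis \<open>x\<^sub>1, \<dots>, x\<^sub>m\<close>.\<close>

definition hom_lp_topology ::
    "real \<Rightarrow> ('g, 'x) monoid_scheme \<Rightarrow> ('g \<Rightarrow>\<^sub>0 int, 'm) module \<Rightarrow>
     ('m \<Rightarrow> 'g \<Rightarrow> complex) topology" where
  "hom_lp_topology p G M =
     subtopology (product_topology (\<lambda>_. lp_topology p G) (carrier M))
       (carrier (hom_group (group_ring G) M (lp_module p G)))"

definition lp_cycles ::
    "real \<Rightarrow> ('g, 'x) monoid_scheme \<Rightarrow> (nat \<Rightarrow> ('g \<Rightarrow>\<^sub>0 int, 'm) module) \<Rightarrow> (nat \<Rightarrow> 'm \<Rightarrow> 'm) \<Rightarrow>
     nat \<Rightarrow> ('m \<times> ('g \<Rightarrow> complex) \<Rightarrow>\<^sub>0 int) set set" where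
  "lp_cycles p G F d i =
     (if i = 0 then carrier (tensor_product G (F 0) (lp_module p G))
      else kernel (tensor_product G (F i) (lp_module p G))
                  (tensor_product G (F (i - 1)) (lp_module p G))
                  (tensor_map G (F (i - 1)) (lp_module p G) (d i)))"

definition lp_boundaries ::
    "real \<Rightarrow> ('g, 'x) monoid_scheme \<Rightarrow> (nat \<Rightarrow> ('g \<Rightarrow>\<^sub>0 int, 'm) module) \<Rightarrow> (nat \<Rightarrow> 'm \<Rightarrow> 'm) \<Rightarrow>
     nat \<Rightarrow> ('m \<times> ('g \<Rightarrow> complex) \<Rightarrow>\<^sub>0 int) set set" where
  "lp_boundaries p G F d i =
     tensor_map G (F i) (lp_module p G) (d (Suc i)) `
       carrier (tensor_product G (F (Suc i)) (lp_module p G))"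

definition reduced_lp_homology ::
    "real \<Rightarrow> ('g, 'x) monoid_scheme \<Rightarrow> (nat \<Rightarrow> ('g \<Rightarrow>\<^sub>0 int, 'm) module) \<Rightarrow> (nat \<Rightarrow> 'm \<Rightarrow> 'm) \<Rightarrow>
     nat \<Rightarrow> ('m \<times> ('g \<Rightarrow> complex) \<Rightarrow>\<^sub>0 int) set set monoid" where
  "reduced_lp_homology p G F d i =
     (tensor_product G (F i) (lp_module p G)) \<lparr>carrier := lp_cycles p G F d i\<rparr> Mod
       (tensor_lp_topology p G (F i) closure_of lp_boundaries p G F d i)"

text \<open>\<open>lp_coboundary G F d i\<close> maps \<open>Hom(F\<^sub>i\<^sub>-\<^sub>1, l\<^sup>p(G))\<close> to \<open>Hom(F\<^sub>i, l\<^sup>p(G))\<close>, for \<open>i \<ge> 1\<close>.\<close>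

definition lp_coboundary ::
    "(nat \<Rightarrow> ('g \<Rightarrow>\<^sub>0 int, 'm) module) \<Rightarrow> (nat \<Rightarrow> 'm \<Rightarrow> 'm) \<Rightarrow>
     nat \<Rightarrow> ('m \<Rightarrow> 'g \<Rightarrow> complex) \<Rightarrow> ('m \<Rightarrow> 'g \<Rightarrow> complex)" where
  "lp_coboundary F d i \<phi> = restrict (\<phi> \<circ> d i) (carrier (F i))"

definition lp_cocycles ::
    "real \<Rightarrow> ('g, 'x) monoid_scheme \<Rightarrow> (nat \<Rightarrow> ('g \<Rightarrow>\<^sub>0 int, 'm) module) \<Rightarrow> (nat \<Rightarrow> 'm \<Rightarrow> 'm) \<Rightarrow>
     nat \<Rightarrow> ('m \<Rightarrow> 'g \<Rightarrow> complex) set" where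
  "lp_cocycles p G F d i =
     kernel (hom_group (group_ring G) (F i) (lp_module p G))
            (hom_group (group_ring G) (F (Suc i)) (lp_module p G))
            (lp_coboundary F d (Suc i))"

definition lp_coboundaries ::
    "real \<Rightarrow> ('g, 'x) monoid_scheme \<Rightarrow> (nat \<Rightarrow> ('g \<Rightarrow>\<^sub>0 int, 'm) module) \<Rightarrow> (nat \<Rightarrow> 'm \<Rightarrow> 'm) \<Rightarrow>
     nat \<Rightarrow> ('m \<Rightarrow> 'g \<Rightarrow> complex) set" where
  "lp_coboundaries p G F d i =
     (if i = 0 then {\<one>\<^bsub>hom_group (group_ring G) (F 0) (lp_module p G)\<^esub>}
      else lp_coboundary F d i ` carrier (hom_group (group_ring G) (F (i - 1)) (lp_module p G)))"

definition reduced_lp_cohomology ::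
    "real \<Rightarrow> ('g, 'x) monoid_scheme \<Rightarrow> (nat \<Rightarrow> ('g \<Rightarrow>\<^sub>0 int, 'm) module) \<Rightarrow> (nat \<Rightarrow> 'm \<Rightarrow> 'm) \<Rightarrow>
     nat \<Rightarrow> ('m \<Rightarrow> 'g \<Rightarrow> complex) set monoid" where
  "reduced_lp_cohomology p G F d i =
     (hom_group (group_ring G) (F i) (lp_module p G)) \<lparr>carrier := lp_cocycles p G F d i\<rparr> Mod
       (hom_lp_topology p G (F i) closure_of lp_coboundaries p G F d i)"

end

theory Submission
  imports Defs
begin

text \<open>Over the group ring, multiplication by a central element \<open>z\<close> is a chain map of the resolution
  that lifts the identity of \<open>\<int>\<close>, hence it is chain homotopic to the identity. So a cycle
  \<open>\<Sum> x\<^sub>j \<otimes> l\<^sub>j\<close> differs by a boundary from its translate \<open>\<Sum> x\<^sub>j \<otimes> z\<^sup>-\<^sup>1 l\<^sub>j\<close>, and therefore also from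
  \<open>\<Sum> x\<^sub>j \<otimes> A\<^sub>N l\<^sub>j\<close>, where \<open>A\<^sub>N\<close> averages over the translations by \<open>N\<close> distinct central elements.
  For \<open>p > 1\<close> the averages \<open>A\<^sub>N l\<close> tend to 0 in \<open>l\<^sup>p(G)\<close>, so the cycle is a limit of boundaries. The
  same argument applies to cocycles. Infinitely many central elements exist because \<open>G\<close> is an
  infinite, finitely generated FCC group.\<close>

section \<open>Averages over translations in \<open>l\<^sup>p(G)\<close>\<close>

text \<open>The quotients are trivial only if the closure of the boundaries equals the group of
  cycles, so besides the approximation the proof has to show that cycles and cocycles are closed.
  The main obstacle is the tensor product: it is a quotient of a free abelian group by a generated
  subgroup, and the modules of the resolution are only projective, so there are no bases in which to
  compare coefficients. The remedy is to test formal sums by module homomorphisms into the group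
  ring. By \<open>tensor_relations_iff\<close> these detect exactly the relations, so
  well-definedness of the boundary maps, the averaging identity and closedness all become statements
  about complex numbers. The averages tend to 0 for a simple reason: averaging a finitely supported
  function over \<open>N\<close> distinct translates spreads a bounded total mass over at most a
  constant times \<open>N\<close> points, with values of order \<open>1/N\<close>. The p-th power of
  the norm is then of order \<open>N powr (1 - p)\<close>. General functions follow because
  averaging does not increase the norm.\<close>

lemma lp_module_carrier_iff:
  "f \<in> carrier (lp_module p G) \<longleftrightarrow>
     (\<forall>g. g \<notin> carrier G \<longrightarrow> f g = 0) \<and> (\<lambda>g. cmod (f g) powr p) summable_on carrier G"
  by (simp add: lp_module_def)

lemma lp_module_outside: "f \<in> carrier (lp_module p G) \<Longrightarrow> g \<notin> carrier G \<Longrightarrow> f g = 0"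
  by (simp add: lp_module_carrier_iff)

lemma lp_module_simps [simp]:
  "\<zero>\<^bsub>lp_module p G\<^esub> = (\<lambda>g. 0)"
  "f1 \<oplus>\<^bsub>lp_module p G\<^esub> f2 = (\<lambda>g. f1 g + f2 g)"
  by (simp_all add: lp_module_def)

text \<open>Convexity is invoked for positive \<open>u\<close> and \<open>v\<close> only. If one of
  them is 0, the claim comes down to \<open>r powr p \<le> r\<close> for \<open>r\<close> between 0
  and 1.\<close>

lemma powr_convex_nonneg:
  fixes u v s t p :: real
  assumes "p \<ge> 1" "u \<ge> 0" "v \<ge> 0" "s \<ge> 0" "t \<ge> 0" "s + t = 1"
  shows "(s * u + t * v) powr p \<le> s * u powr p + t * v powr p"
proof -
  have le: "(r * w) powr p \<le> r * w powr p" if "0 \<le> r" "r \<le> 1" "w \<ge> 0" for r w :: real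
  proof (cases "r = 0")
    case False
    with that assms have "r powr p \<le> r powr 1"
      by (intro powr_mono') auto
    with that show ?thesis
      by (simp add: powr_mult mult_right_mono)
  qed simp
  consider "u = 0" | "v = 0" | "u > 0" "v > 0"
    using assms by fastforce
  then show ?thesis
  proof cases
    case 3
    have s: "s = 1 - t" using assms by simp
    show ?thesis
      using convex_onD[OF powr_convex[OF assms(1)], of t u v] 3 assms(4,5) by (simp add: s)
  qed (use le[of s u] le[of t v] assms in auto)
qed

lemma lp_norm_nonneg [simp]: "lp_norm p G f \<ge> 0"
  by (simp add: lp_norm_def)

lemma lp_norm_powr:
  assumes "p \<ge> 1"
  shows "lp_norm p G f powr p = (\<Sum>\<^sub>\<infinity>g \<in> carrier G. cmod (f g) powr p)"
  using assms by (simp add: lp_norm_def powr_powr infsum_nonneg)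

lemma lp_norm_leI:
  assumes "p \<ge> 1" "r \<ge> 0" "(\<Sum>\<^sub>\<infinity>g \<in> carrier G. cmod (f g) powr p) \<le> r powr p"
  shows "lp_norm p G f \<le> r"
proof -
  have "lp_norm p G f powr p \<le> r powr p"
    using assms by (simp add: lp_norm_powr)
  then show ?thesis
    using assms powr_less_mono2[of p r "lp_norm p G f"] by linarith
qed

text \<open>Minkowski's inequality by convexity. With weights \<open>s = a / (a + b)\<close> and
  \<open>t = b / (a + b)\<close>, the modulus of the sum divided by \<open>a + b\<close> is at most
  a convex combination of the moduli divided by \<open>a\<close> and \<open>b\<close>; taking p-th
  powers and summing gives the bound \<open>(a + b) powr p\<close>. Strict upper bounds in place of
  the norms themselves keep the denominators positive when a norm is 0.\<close>

lemma lp_add_aux: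
  fixes f1 f2 :: "'g \<Rightarrow> complex"
  assumes "p \<ge> 1" "f1 \<in> carrier (lp_module p G)" "f2 \<in> carrier (lp_module p G)"
    and ab: "a > lp_norm p G f1" "b > lp_norm p G f2"
  shows "(\<lambda>g. cmod (f1 g + f2 g) powr p) summable_on carrier G"
    and "lp_norm p G (\<lambda>g. f1 g + f2 g) \<le> a + b"
proof -
  define s where "s = a / (a + b)"
  define t where "t = b / (a + b)"
  have pos: "a > 0" "b > 0"
    using ab lp_norm_nonneg[of p G f1] lp_norm_nonneg[of p G f2] by linarith+
  then have st: "s \<ge> 0" "t \<ge> 0" "s + t = 1"
    by (simp_all add: s_def t_def add_divide_distrib[symmetric])
  define A where "A = (a + b) powr p * s / a powr p"
  define B where "B = (a + b) powr p * t / b powr p"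
  have AB: "A \<ge> 0" "B \<ge> 0" using st by (simp_all add: A_def B_def)
  have pw: "cmod (f1 g + f2 g) powr p \<le> A * cmod (f1 g) powr p + B * cmod (f2 g) powr p" for g
  proof -
    define u where "u = cmod (f1 g) / a"
    define v where "v = cmod (f2 g) / b"
    have "cmod (f1 g + f2 g) \<le> (a + b) * (s * u + t * v)"
    proof -
      have "(a + b) * s = a" "(a + b) * t = b"
        using pos by (simp_all add: s_def t_def)
      then have "(a + b) * (s * u + t * v) = a * u + b * v"
        by (simp add: distrib_left mult.assoc[symmetric])
      then show ?thesis using pos norm_triangle_ineq[of "f1 g" "f2 g"] by (simp add: u_def v_def)
    qed
    then have "cmod (f1 g + f2 g) powr p \<le> ((a + b) * (s * u + t * v)) powr p"
      using assms(1) by (intro powr_mono2) auto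
    also have "\<dots> = (a + b) powr p * (s * u + t * v) powr p"
      using pos st by (simp add: powr_mult u_def v_def)
    also have "\<dots> \<le> (a + b) powr p * (s * u powr p + t * v powr p)"
      using powr_convex_nonneg[of p u v s t] assms(1) pos st
      by (intro mult_left_mono) (auto simp: u_def v_def)
    also have "\<dots> = A * cmod (f1 g) powr p + B * cmod (f2 g) powr p"
      using pos by (simp add: u_def v_def A_def B_def powr_divide distrib_left mult.assoc)
    finally show ?thesis .
  qed
  have s12: "(\<lambda>g. cmod (f1 g) powr p) summable_on carrier G" "(\<lambda>g. cmod (f2 g) powr p) summable_on carrier G"
    using assms by (auto simp: lp_module_carrier_iff)
  have sAB: "(\<lambda>g. A * cmod (f1 g) powr p + B * cmod (f2 g) powr p) summable_on carrier G"
    by (intro summable_on_add summable_on_cmult_right s12)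
  show sum: "(\<lambda>g. cmod (f1 g + f2 g) powr p) summable_on carrier G"
    by (rule summable_on_comparison_test[OF sAB]) (use pw in auto)
  have "(\<Sum>\<^sub>\<infinity>g \<in> carrier G. cmod (f1 g + f2 g) powr p)
      \<le> (\<Sum>\<^sub>\<infinity>g \<in> carrier G. A * cmod (f1 g) powr p + B * cmod (f2 g) powr p)"
    by (intro infsum_mono sum sAB pw)
  also have "\<dots> = A * lp_norm p G f1 powr p + B * lp_norm p G f2 powr p"
    using s12 by (simp add: infsum_add summable_on_cmult_right infsum_cmult_right' lp_norm_powr[OF assms(1)])
  also have "\<dots> \<le> A * a powr p + B * b powr p"
    using AB ab assms(1) by (intro add_mono mult_left_mono powr_mono2) auto
  also have "\<dots> = (a + b) powr p"
    using pos st by (simp add: A_def B_def distrib_left[symmetric])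
  finally show "lp_norm p G (\<lambda>g. f1 g + f2 g) \<le> a + b"
    using assms(1) pos by (intro lp_norm_leI) auto
qed

lemma lp_module_add_closed:
  assumes "p \<ge> 1" "f1 \<in> carrier (lp_module p G)" "f2 \<in> carrier (lp_module p G)"
  shows "(\<lambda>g. f1 g + f2 g) \<in> carrier (lp_module p G)"
  using lp_add_aux(1)[OF assms, of "lp_norm p G f1 + 1" "lp_norm p G f2 + 1"] assms
  by (auto simp: lp_module_carrier_iff)

theorem lp_norm_triangle:
  assumes "p \<ge> 1" "f1 \<in> carrier (lp_module p G)" "f2 \<in> carrier (lp_module p G)"
  shows "lp_norm p G (\<lambda>g. f1 g + f2 g) \<le> lp_norm p G f1 + lp_norm p G f2"
proof (rule field_le_epsilon)
  fix e :: real assume "e > 0"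
  then show "lp_norm p G (\<lambda>g. f1 g + f2 g) \<le> lp_norm p G f1 + lp_norm p G f2 + e"
    using lp_add_aux(2)[OF assms, of "lp_norm p G f1 + e / 2" "lp_norm p G f2 + e / 2"]
    by simp
qed

lemma lp_module_scale_closed:
  assumes "f \<in> carrier (lp_module p G)"
  shows "(\<lambda>g. c * f g) \<in> carrier (lp_module p G)"
  using assms by (auto simp: lp_module_carrier_iff norm_mult powr_mult summable_on_cmult_right)

lemma lp_norm_scale:
  assumes "p \<ge> 1"
  shows "lp_norm p G (\<lambda>g. c * f g) = cmod c * lp_norm p G f"
  using assms
  by (simp add: lp_norm_def norm_mult powr_mult infsum_cmult_right' powr_powr infsum_nonneg)

lemma lp_module_zero_closed [simp]: "(\<lambda>g. 0) \<in> carrier (lp_module p G)"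
  by (simp add: lp_module_carrier_iff)

lemma lp_module_uminus_closed:
  "f \<in> carrier (lp_module p G) \<Longrightarrow> (\<lambda>g. - f g) \<in> carrier (lp_module p G)"
  using lp_module_scale_closed[of f p G "-1"] by simp

lemma lp_module_diff_closed:
  assumes "p \<ge> 1" "f1 \<in> carrier (lp_module p G)" "f2 \<in> carrier (lp_module p G)"
  shows "(\<lambda>g. f1 g - f2 g) \<in> carrier (lp_module p G)"
  using lp_module_add_closed[OF assms(1,2) lp_module_uminus_closed[OF assms(3)]] by simp

lemma lp_module_sum_closed:
  assumes "p \<ge> 1" "\<And>k. k \<in> K \<Longrightarrow> f k \<in> carrier (lp_module p G)"
  shows "(\<lambda>g. \<Sum>k\<in>K. f k g) \<in> carrier (lp_module p G)"
  using assms(2)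
  by (induction K rule: infinite_finite_induct) (auto intro!: lp_module_add_closed assms(1))

lemma lp_norm_zero [simp]: "lp_norm p G (\<lambda>g. 0) = 0"
  by (simp add: lp_norm_def)

lemma lp_norm_sum_le:
  assumes "p \<ge> 1" "\<And>k. k \<in> K \<Longrightarrow> f k \<in> carrier (lp_module p G)"
  shows "lp_norm p G (\<lambda>g. \<Sum>k\<in>K. f k g) \<le> (\<Sum>k\<in>K. lp_norm p G (f k))"
  using assms(2)
proof (induction K rule: infinite_finite_induct)
  case (insert k K)
  then have "lp_norm p G (\<lambda>g. f k g + (\<Sum>k\<in>K. f k g))
      \<le> lp_norm p G (f k) + lp_norm p G (\<lambda>g. \<Sum>k\<in>K. f k g)"
    by (intro lp_norm_triangle lp_module_sum_closed assms(1)) auto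
  with insert show ?case by force
qed simp_all

lemma cmod_le_lp_norm:
  assumes "p \<ge> 1" "f \<in> carrier (lp_module p G)" "g \<in> carrier G"
  shows "cmod (f g) \<le> lp_norm p G f"
proof -
  have "cmod (f g) powr p \<le> (\<Sum>\<^sub>\<infinity>g \<in> carrier G. cmod (f g) powr p)"
    using finite_sum_le_infsum[of "\<lambda>g. cmod (f g) powr p" "carrier G" "{g}"] assms
    by (simp add: lp_module_carrier_iff)
  then have "cmod (f g) powr p \<le> lp_norm p G f powr p"
    using assms(1) by (simp add: lp_norm_powr)
  then show ?thesis
    using assms(1) powr_less_mono2[of p "lp_norm p G f" "cmod (f g)"] lp_norm_nonneg[of p G f]
    by linarith
qed

lemma Metric_space_lp:
  assumes "p \<ge> 1"
  shows "Metric_space (carrier (lp_module p G)) (\<lambda>f1 f2. lp_norm p G (\<lambda>g. f1 g - f2 g))"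
proof
  fix f1 f2 f3 assume lp: "f1 \<in> carrier (lp_module p G)" "f2 \<in> carrier (lp_module p G)"
  show "lp_norm p G (\<lambda>g. f1 g - f2 g) = 0 \<longleftrightarrow> f1 = f2"
  proof
    assume *: "lp_norm p G (\<lambda>g. f1 g - f2 g) = 0"
    have "f1 g = f2 g" for g
    proof (cases "g \<in> carrier G")
      case True
      then show ?thesis
        using cmod_le_lp_norm[OF assms lp_module_diff_closed[OF assms lp] True] * by simp
    qed (use lp in \<open>simp add: lp_module_outside\<close>)
    then show "f1 = f2" ..
  qed simp
  assume lp3: "f3 \<in> carrier (lp_module p G)"
  show "lp_norm p G (\<lambda>g. f1 g - f3 g) \<le> lp_norm p G (\<lambda>g. f1 g - f2 g) + lp_norm p G (\<lambda>g. f2 g - f3 g)"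
    using lp_norm_triangle[OF assms lp_module_diff_closed[OF assms lp] lp_module_diff_closed[OF assms lp(2) lp3]]
    by simp
next
  fix f1 f2 :: "'a \<Rightarrow> complex"
  show "lp_norm p G (\<lambda>g. f1 g - f2 g) = lp_norm p G (\<lambda>g. f2 g - f1 g)"
    unfolding lp_norm_def by (subst norm_minus_commute) (rule refl)
qed simp

lemma topspace_lp_topology [simp]:
  "p \<ge> 1 \<Longrightarrow> topspace (lp_topology p G) = carrier (lp_module p G)"
  unfolding lp_topology_def by (rule Metric_space.topspace_mtopology[OF Metric_space_lp])

text \<open>A coordinate is bounded by the norm. Every closedness argument below rests on this:
  cycles and cocycles are cut out by equations in finitely many coordinates at a time.\<close>

lemma continuous_map_lp_eval:
  assumes "p \<ge> 1"
  shows "continuous_map (lp_topology p G) euclidean (\<lambda>f. f g)"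
proof -
  interpret Metric_space "carrier (lp_module p G)" "\<lambda>f1 f2. lp_norm p G (\<lambda>g. f1 g - f2 g)"
    by (rule Metric_space_lp[OF assms])
  have "\<exists>\<delta>>0. \<forall>f'. f' \<in> carrier (lp_module p G) \<and> lp_norm p G (\<lambda>g. f g - f' g) < \<delta> \<longrightarrow> dist (f g) (f' g) < \<epsilon>"
    if "f \<in> carrier (lp_module p G)" "\<epsilon> > 0" for f and \<epsilon> :: real
  proof (intro exI[of _ \<epsilon>] conjI allI impI that)
    fix f' assume f': "f' \<in> carrier (lp_module p G) \<and> lp_norm p G (\<lambda>g. f g - f' g) < \<epsilon>"
    show "dist (f g) (f' g) < \<epsilon>"
    proof (cases "g \<in> carrier G")
      case True
      with f' that show ?thesis
        using cmod_le_lp_norm[OF assms lp_module_diff_closed[OF assms, of f G f'] True]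
        by (simp add: dist_norm)
    qed (use that f' lp_module_outside[of f p G g] lp_module_outside[of f' p G g] in auto)
  qed
  then have "continuous_map mtopology Met_TC.mtopology (\<lambda>f. f g)"
    using metric_continuous_map[OF Met_TC.Metric_space_axioms, of "\<lambda>f. f g"] by simp
  then show ?thesis
    by (simp add: lp_topology_def)
qed

lemma limitin_lp_topology_null:
  assumes "p \<ge> 1" "l \<in> carrier (lp_module p G)" "\<And>N. a N \<in> carrier (lp_module p G)"
    and "(\<lambda>N. lp_norm p G (a N)) \<longlonglongrightarrow> 0"
  shows "limitin (lp_topology p G) (\<lambda>N g. l g - a N g) l sequentially"
proof -
  interpret Metric_space "carrier (lp_module p G)" "\<lambda>f1 f2. lp_norm p G (\<lambda>g. f1 g - f2 g)"
    by (rule Metric_space_lp[OF assms(1)])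
  have eq: "lp_norm p G (\<lambda>g. l g - a N g - l g) = lp_norm p G (a N)" for N
    by (simp add: lp_norm_def)
  have eq': "lp_norm p G (\<lambda>g. - a N g) = lp_norm p G (a N)" for N
    by (simp add: lp_norm_def)
  show ?thesis
    unfolding lp_topology_def limitin_metric
    using assms order_tendstoD(2)[OF assms(4)] lp_module_diff_closed[OF assms(1,2,3)]
    by (auto simp: eq eq')
qed

text \<open>For \<open>z\<close> in the group this is the module action of the inverse of
  \<open>z\<close>. With this orientation, evaluating a formal sum \<open>a\<close> against the
  translate is the same as evaluating \<open>z\<close> times \<open>a\<close> against
  \<open>f\<close>.\<close>

definition lp_translate :: "('g, 'x) monoid_scheme \<Rightarrow> 'g \<Rightarrow> ('g \<Rightarrow> complex) \<Rightarrow> 'g \<Rightarrow> complex" where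
  "lp_translate G z f g = (if g \<in> carrier G then f (z \<otimes>\<^bsub>G\<^esub> g) else 0)"

lemma (in group) bij_betw_translate:
  "z \<in> carrier G \<Longrightarrow> bij_betw (\<lambda>g. z \<otimes> g) (carrier G) (carrier G)"
  by (rule bij_betwI[where g = "\<lambda>g. inv z \<otimes> g"]) (auto simp: m_assoc[symmetric])

lemma (in group) lp_translate_closed:
  assumes "z \<in> carrier G" "f \<in> carrier (lp_module p G)"
  shows "lp_translate G z f \<in> carrier (lp_module p G)"
  using assms summable_on_reindex_bij_betw[OF bij_betw_translate[OF assms(1)], of "\<lambda>g. cmod (f g) powr p"]
  by (auto simp: lp_module_carrier_iff lp_translate_def cong: summable_on_cong)

lemma (in group) lp_norm_translate:
  assumes "z \<in> carrier G"
  shows "lp_norm p G (lp_translate G z f) = lp_norm p G f"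
  using infsum_reindex_bij_betw[OF bij_betw_translate[OF assms(1)], of "\<lambda>g. cmod (f g) powr p"]
  by (auto simp: lp_norm_def lp_translate_def cong: infsum_cong)

definition lp_average :: "('g, 'x) monoid_scheme \<Rightarrow> (nat \<Rightarrow> 'g) \<Rightarrow> nat \<Rightarrow> ('g \<Rightarrow> complex) \<Rightarrow> 'g \<Rightarrow> complex" where
  "lp_average G z N f g = of_real (1 / real N) * (\<Sum>k<N. lp_translate G (z k) f g)"

context group
begin

lemma lp_average_closed:
  assumes "p \<ge> 1" "\<And>k. z k \<in> carrier G" "f \<in> carrier (lp_module p G)"
  shows "lp_average G z N f \<in> carrier (lp_module p G)"
proof -
  have "(\<lambda>g. of_real (1 / real N) * (\<Sum>k<N. lp_translate G (z k) f g)) \<in> carrier (lp_module p G)"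
    by (intro lp_module_scale_closed lp_module_sum_closed lp_translate_closed assms)
  then show ?thesis
    by (simp add: lp_average_def[abs_def])
qed

text \<open>Translations are isometries, so averages are contractions. This uniform bound allows the
  limit to be checked on finitely supported functions only.\<close>

lemma lp_norm_average_le:
  assumes "p \<ge> 1" "\<And>k. z k \<in> carrier G" "f \<in> carrier (lp_module p G)"
  shows "lp_norm p G (lp_average G z N f) \<le> lp_norm p G f"
proof -
  have "lp_norm p G (\<lambda>g. \<Sum>k<N. lp_translate G (z k) f g) \<le> (\<Sum>k<N. lp_norm p G (lp_translate G (z k) f))"
    by (intro lp_norm_sum_le lp_translate_closed assms)
  also have "\<dots> = real N * lp_norm p G f"
    using assms by (simp add: lp_norm_translate)
  finally have "(1 / real N) * lp_norm p G (\<lambda>g. \<Sum>k<N. lp_translate G (z k) f g) \<le> (1 / real N) * (real N * lp_norm p G f)"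
    by (intro mult_left_mono) auto
  also have "\<dots> \<le> lp_norm p G f" by simp
  finally show ?thesis
    using assms(1) by (simp add: lp_average_def[abs_def] lp_norm_scale norm_divide del: of_real_divide)
qed

text \<open>The average is supported on the at most \<open>N * card S\<close> points of
  \<open>B\<close> and is bounded by \<open>C / N\<close>, so the p-th power of its norm is at most
  \<open>card S * C powr p * N powr (1 - p)\<close>.\<close>

lemma lp_average_finite_support:
  assumes "p > 1" and z: "\<And>k. z k \<in> carrier G" "inj z"
    and S: "finite S" "S \<subseteq> carrier G" "\<And>g. g \<notin> S \<Longrightarrow> u g = 0"
  shows "(\<lambda>N. lp_norm p G (lp_average G z N u)) \<longlonglongrightarrow> 0"
proof -
  define C where "C = (\<Sum>s\<in>S. cmod (u s))"
  have C: "C \<ge> 0" by (simp add: C_def sum_nonneg)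
  have bound: "lp_norm p G (lp_average G z N u)
      \<le> (real (card S) * C powr p * real N powr (1 - p)) powr (1 / p)" if N: "N > 0" for N
  proof -
    define B where "B = (\<lambda>(k, s). inv (z k) \<otimes> s) ` ({..<N} \<times> S)"
    have "finite B" and cB: "card B \<le> N * card S"
      using S card_image_le[of "{..<N} \<times> S" "\<lambda>(k, s). inv (z k) \<otimes> s"] by (auto simp: B_def)
    have BG: "B \<subseteq> carrier G" using S z by (auto simp: B_def)
    have out: "lp_average G z N u g = 0" if "g \<in> carrier G" "g \<notin> B" for g
    proof -
      have "u (z k \<otimes> g) = 0" if "k < N" for k
      proof (rule S(3), rule notI)
        assume "z k \<otimes> g \<in> S"
        then have "inv (z k) \<otimes> (z k \<otimes> g) \<in> B"
          using \<open>k < N\<close> by (auto simp: B_def intro!: image_eqI[of _ _ "(k, z k \<otimes> g)"])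
        then show False
          using \<open>g \<notin> B\<close> \<open>g \<in> carrier G\<close> z by (simp add: m_assoc[symmetric])
      qed
      then have "(\<Sum>k<N. u (z k \<otimes> g)) = 0"
        by (intro sum.neutral) auto
      then show ?thesis
        using that by (simp add: lp_average_def lp_translate_def)
    qed
    \<comment> \<open>Since the \<open>z k\<close> are distinct, the points
      \<open>z k \<otimes> g\<close> are distinct too, so each element of \<open>S\<close> is met at
      most once and the sum does not grow with \<open>N\<close>.\<close>
    have val: "cmod (lp_average G z N u g) \<le> C / N" if "g \<in> carrier G" for g
    proof -
      have inj: "inj_on (\<lambda>k. z k \<otimes> g) {..<N}"
        using z that by (auto simp: inj_on_def dest: injD)
      have "cmod (\<Sum>k<N. u (z k \<otimes> g)) \<le> (\<Sum>k<N. cmod (u (z k \<otimes> g)))"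
        by (rule norm_sum)
      also have "\<dots> = (\<Sum>h\<in>(\<lambda>k. z k \<otimes> g) ` {..<N}. cmod (u h))"
        using inj by (simp add: sum.reindex)
      also have "\<dots> = (\<Sum>h\<in>(\<lambda>k. z k \<otimes> g) ` {..<N} \<inter> S. cmod (u h))"
        by (rule sum.mono_neutral_right) (use S in auto)
      also have "\<dots> \<le> C"
        unfolding C_def by (rule sum_mono2) (use S in auto)
      finally show ?thesis
        using that N by (simp add: lp_average_def lp_translate_def norm_mult norm_divide divide_right_mono)
    qed
    have "(\<Sum>\<^sub>\<infinity>g \<in> carrier G. cmod (lp_average G z N u g) powr p)
        = (\<Sum>\<^sub>\<infinity>g \<in> B. cmod (lp_average G z N u g) powr p)"
      by (rule infsum_cong_neutral) (use out BG in auto)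
    also have "\<dots> = (\<Sum>g \<in> B. cmod (lp_average G z N u g) powr p)"
      using \<open>finite B\<close> by simp
    also have "\<dots> \<le> (\<Sum>g \<in> B. (C / N) powr p)"
      using val BG assms(1) by (intro sum_mono powr_mono2) auto
    also have "\<dots> = real (card B) * (C / N) powr p" by simp
    also have "\<dots> \<le> real (N * card S) * (C / N) powr p"
      using cB by (intro mult_right_mono) (auto simp flip: of_nat_mult)
    also have "\<dots> = real (card S) * C powr p * real N powr (1 - p)"
      using N C by (simp add: powr_divide powr_diff)
    finally show ?thesis
      unfolding lp_norm_def using assms(1) by (intro powr_mono2) (auto simp: infsum_nonneg)
  qed
  have "(\<lambda>N. (real (card S) * C powr p * real N powr (1 - p)) powr (1 / p)) \<longlonglongrightarrow> (real (card S) * C powr p * 0) powr (1 / p)"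
    using assms(1)
    by (intro tendsto_powr' tendsto_mult tendsto_const tendsto_neg_powr filterlim_real_sequentially) (auto intro!: always_eventually)
  then have lim: "(\<lambda>N. (real (card S) * C powr p * real N powr (1 - p)) powr (1 / p)) \<longlonglongrightarrow> 0"
    by simp
  show ?thesis
    by (rule tendsto_sandwich[OF _ _ tendsto_const lim])
      (auto intro: always_eventually eventually_mono[OF eventually_gt_at_top[of 0]] bound)
qed

text \<open>This is where \<open>p > 1\<close> is needed: for instance, the average of a point mass over \<open>N\<close> distinct
  translates has norm \<open>N powr (1/p - 1)\<close>.\<close>

theorem lp_average_tendsto_0:
  assumes "p > 1" and z: "\<And>k. z k \<in> carrier G" "inj z"
    and f: "f \<in> carrier (lp_module p G)"
  shows "(\<lambda>N. lp_norm p G (lp_average G z N f)) \<longlonglongrightarrow> 0"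
proof (rule tendstoI)
  fix \<epsilon> :: real assume "\<epsilon> > 0"
  have p1: "p \<ge> 1" using assms by simp
  have sm: "(\<lambda>g. cmod (f g) powr p) summable_on carrier G"
    using f by (simp add: lp_module_carrier_iff)
  \<comment> \<open>The function is cut into a finitely supported part \<open>u\<close> and a tail
    \<open>v\<close> of norm at most \<open>\<epsilon> / 2\<close>. The threshold is a p-th power
    because finite approximation is available for the sum of p-th powers.\<close>
  define \<eta> where "\<eta> = (\<epsilon> / 2) powr p"
  have "\<eta> > 0" using \<open>\<epsilon> > 0\<close> by (simp add: \<eta>_def)
  then obtain S where S: "finite S" "S \<subseteq> carrier G"
    "dist (sum (\<lambda>g. cmod (f g) powr p) S) (\<Sum>\<^sub>\<infinity>g\<in>carrier G. cmod (f g) powr p) < \<eta>"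
    using infsum_finite_approximation[OF sm, of "\<eta> / 2"] by force
  define u where "u = (\<lambda>g. if g \<in> S then f g else 0)"
  define v where "v = (\<lambda>g. if g \<in> S then 0 else f g)"
  have v: "v \<in> carrier (lp_module p G)"
    using f by (auto simp: lp_module_carrier_iff v_def intro: summable_on_comparison_test[OF sm])
  have uv: "f g = u g + v g" for g by (simp add: u_def v_def)
  have u: "u \<in> carrier (lp_module p G)"
    using lp_module_diff_closed[OF p1 f v] by (simp add: uv)
  have "lp_norm p G v \<le> \<epsilon> / 2"
  proof (rule lp_norm_leI[OF p1])
    have "(\<Sum>\<^sub>\<infinity>g\<in>carrier G. cmod (v g) powr p) = (\<Sum>\<^sub>\<infinity>g\<in>carrier G - S. cmod (f g) powr p)"
      by (rule infsum_cong_neutral) (auto simp: v_def)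
    also have "\<dots> = (\<Sum>\<^sub>\<infinity>g\<in>carrier G. cmod (f g) powr p) - (\<Sum>g\<in>S. cmod (f g) powr p)"
      using S sm by (subst infsum_Diff) auto
    also have "\<dots> \<le> \<eta>" using S(3) by (simp add: dist_real_def)
    finally show "(\<Sum>\<^sub>\<infinity>g\<in>carrier G. cmod (v g) powr p) \<le> (\<epsilon> / 2) powr p"
      by (simp add: \<eta>_def)
  qed (use \<open>\<epsilon> > 0\<close> in auto)
  have "eventually (\<lambda>N. lp_norm p G (lp_average G z N u) < \<epsilon> / 2) sequentially"
    using lp_average_finite_support[OF assms(1) z S(1,2), of u] \<open>\<epsilon> > 0\<close>
    by (intro order_tendstoD(2)) (auto simp: u_def)
  then show "eventually (\<lambda>N. dist (lp_norm p G (lp_average G z N f)) 0 < \<epsilon>) sequentially"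
  proof eventually_elim
    case (elim N)
    have "lp_translate G w f g = lp_translate G w u g + lp_translate G w v g" for w g
      unfolding lp_translate_def using uv[of "w \<otimes> g"] by simp
    then have "lp_average G z N f = (\<lambda>g. lp_average G z N u g + lp_average G z N v g)"
      by (simp add: lp_average_def fun_eq_iff sum.distrib distrib_left add_divide_distrib)
    then have "lp_norm p G (lp_average G z N f) \<le> lp_norm p G (lp_average G z N u) + lp_norm p G (lp_average G z N v)"
      using lp_norm_triangle[OF p1 lp_average_closed lp_average_closed] p1 z(1) u v by simp
    also have "lp_norm p G (lp_average G z N v) \<le> \<epsilon> / 2"
      using lp_norm_average_le[where z = z and N = N, OF p1 z(1) v] \<open>lp_norm p G v \<le> \<epsilon> / 2\<close> by simp
    finally show ?case using elim by simp
  qed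
qed

end

section \<open>Dual bases and lifting for projective modules\<close>

lemma lmodule_homI:
  assumes "\<And>x. x \<in> carrier M \<Longrightarrow> h x \<in> carrier N"
    and "\<And>x y. x \<in> carrier M \<Longrightarrow> y \<in> carrier M \<Longrightarrow> h (x \<oplus>\<^bsub>M\<^esub> y) = h x \<oplus>\<^bsub>N\<^esub> h y"
    and "\<And>a x. a \<in> carrier R \<Longrightarrow> x \<in> carrier M \<Longrightarrow> h (a \<odot>\<^bsub>M\<^esub> x) = a \<odot>\<^bsub>N\<^esub> h x"
  shows "h \<in> lmodule_hom R M N"
  using assms by (auto simp: lmodule_hom_def)

lemma lmodule_homD:
  assumes "h \<in> lmodule_hom R M N"
  shows "x \<in> carrier M \<Longrightarrow> h x \<in> carrier N"
    and "x \<in> carrier M \<Longrightarrow> y \<in> carrier M \<Longrightarrow> h (x \<oplus>\<^bsub>M\<^esub> y) = h x \<oplus>\<^bsub>N\<^esub> h y"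
    and "a \<in> carrier R \<Longrightarrow> x \<in> carrier M \<Longrightarrow> h (a \<odot>\<^bsub>M\<^esub> x) = a \<odot>\<^bsub>N\<^esub> h x"
  using assms by (auto simp: lmodule_hom_def)

lemma lmodule_hom_compose:
  assumes "h \<in> lmodule_hom R M N" "k \<in> lmodule_hom R N P"
  shows "(\<lambda>x. k (h x)) \<in> lmodule_hom R M P"
  using assms by (auto simp: lmodule_hom_def Pi_iff)

lemma lmodule_hom_imp_abelian_group_hom:
  assumes "abelian_group M" "abelian_group N" "h \<in> lmodule_hom R M N"
  shows "abelian_group_hom M N h"
  using assms abelian_group.a_group[OF assms(1)] abelian_group.a_group[OF assms(2)]
  by (intro abelian_group_homI) (auto simp: lmodule_hom_def hom_def group_hom_def group_hom_axioms_def)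

lemma (in abelian_group_hom) hom_minus:
  assumes "x \<in> carrier G" "y \<in> carrier G"
  shows "h (x \<ominus> y) = h x \<ominus>\<^bsub>H\<^esub> h y"
  using assms by (simp add: a_minus_def)

lemma (in abelian_group_hom) hom_finsum:
  assumes "f \<in> A \<rightarrow> carrier G"
  shows "h (finsum G f A) = (\<Oplus>\<^bsub>H\<^esub>x\<in>A. h (f x))"
  using assms
proof (induction A rule: infinite_finite_induct)
  case (insert x A)
  then show ?case by (simp add: Pi_iff)
qed simp_all

context left_module
begin

declare smult_closed [simp, intro]

lemma smult_zero_left [simp]:
  assumes "x \<in> carrier M"
  shows "\<zero>\<^bsub>R\<^esub> \<odot>\<^bsub>M\<^esub> x = \<zero>\<^bsub>M\<^esub>"
proof -
  have "\<zero>\<^bsub>R\<^esub> \<odot>\<^bsub>M\<^esub> x \<oplus>\<^bsub>M\<^esub> \<zero>\<^bsub>R\<^esub> \<odot>\<^bsub>M\<^esub> x = \<zero>\<^bsub>R\<^esub> \<odot>\<^bsub>M\<^esub> x"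
    using assms smult_l_distr[of "\<zero>\<^bsub>R\<^esub>" "\<zero>\<^bsub>R\<^esub>" x] by simp
  then show ?thesis
    using assms by (simp add: M.add.l_cancel_one)
qed

lemma smult_zero_right [simp]:
  assumes "a \<in> carrier R"
  shows "a \<odot>\<^bsub>M\<^esub> \<zero>\<^bsub>M\<^esub> = \<zero>\<^bsub>M\<^esub>"
proof -
  have "a \<odot>\<^bsub>M\<^esub> \<zero>\<^bsub>M\<^esub> \<oplus>\<^bsub>M\<^esub> a \<odot>\<^bsub>M\<^esub> \<zero>\<^bsub>M\<^esub> = a \<odot>\<^bsub>M\<^esub> \<zero>\<^bsub>M\<^esub>"
    using assms smult_r_distr[of a "\<zero>\<^bsub>M\<^esub>" "\<zero>\<^bsub>M\<^esub>"] by simp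
  then show ?thesis
    using assms by (simp add: M.add.l_cancel_one)
qed

lemma smult_a_inv:
  assumes "a \<in> carrier R" "x \<in> carrier M"
  shows "a \<odot>\<^bsub>M\<^esub> (\<ominus>\<^bsub>M\<^esub> x) = \<ominus>\<^bsub>M\<^esub> (a \<odot>\<^bsub>M\<^esub> x)"
  using assms smult_r_distr[of a "\<ominus>\<^bsub>M\<^esub> x" x]
  by (intro M.minus_equality[symmetric]) (auto simp: M.l_neg)

lemma finsum_smult:
  assumes "a \<in> carrier R" "f \<in> A \<rightarrow> carrier M"
  shows "a \<odot>\<^bsub>M\<^esub> finsum M f A = (\<Oplus>\<^bsub>M\<^esub>i\<in>A. a \<odot>\<^bsub>M\<^esub> f i)"
  using assms(2)
proof (induction A rule: infinite_finite_induct)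
  case (insert x F)
  then show ?case
    using assms(1) by (simp add: Pi_def smult_r_distr)
qed (use assms(1) in simp_all)

end

definition regular_module :: "('r, 'y) ring_scheme \<Rightarrow> ('r, 'r) module" where
  "regular_module R = \<lparr>carrier = carrier R, mult = undefined, one = undefined,
     ring.zero = \<zero>\<^bsub>R\<^esub>, ring.add = (\<oplus>\<^bsub>R\<^esub>), smult = (\<otimes>\<^bsub>R\<^esub>)\<rparr>"

lemma regular_module_simps [simp]:
  "carrier (regular_module R) = carrier R"
  "\<zero>\<^bsub>regular_module R\<^esub> = \<zero>\<^bsub>R\<^esub>"
  "x \<oplus>\<^bsub>regular_module R\<^esub> y = x \<oplus>\<^bsub>R\<^esub> y"
  "a \<odot>\<^bsub>regular_module R\<^esub> x = a \<otimes>\<^bsub>R\<^esub> x"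
  by (simp_all add: regular_module_def)

lemma (in ring) left_module_regular: "left_module R (regular_module R)"
proof -
  interpret M: abelian_group "regular_module R"
    by (rule abelian_groupI) (auto simp: a_assoc intro: l_neg a_comm)
  show ?thesis
    by unfold_locales (auto simp: l_distr r_distr m_assoc)
qed

lemma free_module_simps:
  "\<zero>\<^bsub>free_module R X\<^esub> = (\<lambda>b. \<zero>\<^bsub>R\<^esub>)"
  "v \<oplus>\<^bsub>free_module R X\<^esub> w = (\<lambda>b. if b \<in> X then v b \<oplus>\<^bsub>R\<^esub> w b else \<zero>\<^bsub>R\<^esub>)"
  "a \<odot>\<^bsub>free_module R X\<^esub> v = (\<lambda>b. if b \<in> X then a \<otimes>\<^bsub>R\<^esub> v b else \<zero>\<^bsub>R\<^esub>)"
  by (simp_all add: free_module_def)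

lemma free_module_carrier_iff:
  "v \<in> carrier (free_module R X) \<longleftrightarrow> (\<forall>b \<in> X. v b \<in> carrier R) \<and>
     (\<forall>b. b \<notin> X \<longrightarrow> v b = \<zero>\<^bsub>R\<^esub>) \<and> finite {b \<in> X. v b \<noteq> \<zero>\<^bsub>R\<^esub>}"
  by (simp add: free_module_def)

definition free_basis :: "('r, 'y) ring_scheme \<Rightarrow> 'b \<Rightarrow> 'b \<Rightarrow> 'r" where
  "free_basis R b = (\<lambda>c. if c = b then \<one>\<^bsub>R\<^esub> else \<zero>\<^bsub>R\<^esub>)"

context ring
begin

lemma abelian_group_free_module: "abelian_group (free_module R X)"
proof (rule abelian_groupI)
  fix v w assume v: "v \<in> carrier (free_module R X)" and w: "w \<in> carrier (free_module R X)"
  then have "finite ({b \<in> X. v b \<noteq> \<zero>} \<union> {b \<in> X. w b \<noteq> \<zero>})"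
    by (simp add: free_module_carrier_iff)
  moreover have "{b \<in> X. v b \<oplus> w b \<noteq> \<zero>} \<subseteq> {b \<in> X. v b \<noteq> \<zero>} \<union> {b \<in> X. w b \<noteq> \<zero>}"
    by auto
  ultimately have "finite {b \<in> X. v b \<oplus> w b \<noteq> \<zero>}"
    by (rule rev_finite_subset)
  then show "v \<oplus>\<^bsub>free_module R X\<^esub> w \<in> carrier (free_module R X)"
    using v w by (auto simp: free_module_simps free_module_carrier_iff cong: conj_cong)
next
  fix v assume v: "v \<in> carrier (free_module R X)"
  define w where "w = (\<lambda>b. if b \<in> X then \<ominus> v b else \<zero>)"
  have "{b \<in> X. w b \<noteq> \<zero>} \<subseteq> {b \<in> X. v b \<noteq> \<zero>}"
    by (auto simp: w_def)
  then have "finite {b \<in> X. w b \<noteq> \<zero>}"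
    using v by (auto simp: free_module_simps free_module_carrier_iff intro: finite_subset)
  then show "\<exists>w\<in>carrier (free_module R X). w \<oplus>\<^bsub>free_module R X\<^esub> v = \<zero>\<^bsub>free_module R X\<^esub>"
    using v by (intro bexI[of _ w]) (auto simp: free_module_simps free_module_carrier_iff w_def l_neg fun_eq_iff)
qed (auto simp: free_module_simps free_module_carrier_iff fun_eq_iff a_assoc intro: a_comm)

lemma left_module_free_module: "left_module R (free_module R X)"
proof -
  interpret abelian_group "free_module R X"
    by (rule abelian_group_free_module)
  show ?thesis
  proof
    fix a v assume a: "a \<in> carrier R" and v: "v \<in> carrier (free_module R X)"
    have "{b \<in> X. a \<otimes> v b \<noteq> \<zero>} \<subseteq> {b \<in> X. v b \<noteq> \<zero>}"
      using a by auto
    then have "finite {b \<in> X. a \<otimes> v b \<noteq> \<zero>}"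
      using v by (auto simp: free_module_simps free_module_carrier_iff intro: finite_subset)
    then show "a \<odot>\<^bsub>free_module R X\<^esub> v \<in> carrier (free_module R X)"
      using a v by (auto simp: free_module_simps free_module_carrier_iff cong: conj_cong)
  qed (auto simp: free_module_simps free_module_carrier_iff fun_eq_iff l_distr r_distr m_assoc)
qed

lemma free_basis_closed: "b \<in> X \<Longrightarrow> free_basis R b \<in> carrier (free_module R X)"
  by (auto simp: free_module_simps free_module_carrier_iff free_basis_def)

lemma free_module_expansion:
  assumes v: "v \<in> carrier (free_module R X)"
  shows "v = (\<Oplus>\<^bsub>free_module R X\<^esub>b\<in>{b \<in> X. v b \<noteq> \<zero>}. v b \<odot>\<^bsub>free_module R X\<^esub> free_basis R b)"
proof -
  interpret F: left_module R "free_module R X"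
    by (rule left_module_free_module)
  \<comment> \<open>Stated for every finite \<open>B\<close> in \<open>X\<close> so that the
    induction can add one index at a time with \<open>v\<close> fixed; the support of
    \<open>v\<close> is then one instance.\<close>
  have *: "(\<Oplus>\<^bsub>free_module R X\<^esub>b\<in>B. v b \<odot>\<^bsub>free_module R X\<^esub> free_basis R b) = (\<lambda>b. if b \<in> B then v b else \<zero>)"
    if "finite B" "B \<subseteq> X" for B
    using that
  proof (induction B)
    case (insert b B)
    have "(\<Oplus>\<^bsub>free_module R X\<^esub>b\<in>insert b B. v b \<odot>\<^bsub>free_module R X\<^esub> free_basis R b)
        = v b \<odot>\<^bsub>free_module R X\<^esub> free_basis R b \<oplus>\<^bsub>free_module R X\<^esub>
           (\<Oplus>\<^bsub>free_module R X\<^esub>b\<in>B. v b \<odot>\<^bsub>free_module R X\<^esub> free_basis R b)"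
    proof (rule F.M.finsum_insert)
      have "v c \<odot>\<^bsub>free_module R X\<^esub> free_basis R c \<in> carrier (free_module R X)" if "c \<in> insert b B" for c
        using insert v that by (intro F.smult_closed free_basis_closed) (auto simp: free_module_simps free_module_carrier_iff)
      then show "(\<lambda>b. v b \<odot>\<^bsub>free_module R X\<^esub> free_basis R b) \<in> B \<rightarrow> carrier (free_module R X)"
        "v b \<odot>\<^bsub>free_module R X\<^esub> free_basis R b \<in> carrier (free_module R X)"
        by blast+
    qed (use insert in auto)
    also have "\<dots> = (\<lambda>c. if c \<in> insert b B then v c else \<zero>)"
      using insert v by (auto simp: free_module_simps free_module_carrier_iff free_basis_def fun_eq_iff)
    finally show ?case .
  qed (simp add: free_module_simps)
  show ?thesis
    using v by (subst *) (auto simp: free_module_simps free_module_carrier_iff fun_eq_iff)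
qed

end

section \<open>Projective modules: retracts, dual bases and lifting\<close>

lemma projective_module_imp_left_module: "projective_module R M \<Longrightarrow> left_module R M"
  by (simp add: projective_module_def)

text \<open>The retraction is the projection onto \<open>P\<close> along the complement
  \<open>Q\<close>, followed by the inverse of the bijection \<open>h\<close>.\<close>

theorem projective_module_retract:
  fixes M :: "('r, 'm) module"
  assumes "projective_module R M"
  obtains X :: "'m set" and h r
    where "h \<in> lmodule_hom R M (free_module R X)" "r \<in> lmodule_hom R (free_module R X) M"
      "\<And>x. x \<in> carrier M \<Longrightarrow> r (h x) = x"
proof -
  from assms obtain X :: "'m set" and P Q h where
    P: "submodule P R (free_module R X)" and Q: "submodule Q R (free_module R X)" and
    PQ: "P \<inter> Q = {\<zero>\<^bsub>free_module R X\<^esub>}" and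
    sum: "set_add (free_module R X) P Q = carrier (free_module R X)" and
    h: "h \<in> lmodule_hom R M (free_module R X)" and bij: "bij_betw h (carrier M) P"
    unfolding projective_module_def by blast
  interpret M: left_module R M by (rule projective_module_imp_left_module[OF assms])
  interpret F: left_module R "free_module R X" by (rule M.left_module_free_module)
  interpret P: submodule P R "free_module R X" by (rule P)
  interpret Q: submodule Q R "free_module R X" by (rule Q)
  let ?F = "free_module R X"
  have Psub: "P \<subseteq> carrier ?F" and Qsub: "Q \<subseteq> carrier ?F"
    using P.subset Q.subset by simp_all
  have Pc: "x \<oplus>\<^bsub>?F\<^esub> y \<in> P" if "x \<in> P" "y \<in> P" for x y
    using P.m_closed[OF that] by simp
  have Qc: "x \<oplus>\<^bsub>?F\<^esub> y \<in> Q" if "x \<in> Q" "y \<in> Q" for x y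
    using Q.m_closed[OF that] by simp
  have Pi: "\<ominus>\<^bsub>?F\<^esub> x \<in> P" if "x \<in> P" for x
    using P.m_inv_closed[OF that] by (simp add: a_inv_def)
  have Qi: "\<ominus>\<^bsub>?F\<^esub> x \<in> Q" if "x \<in> Q" for x
    using Q.m_inv_closed[OF that] by (simp add: a_inv_def)
  have uniq: "x = x'" if "x \<in> P" "x' \<in> P" "y \<in> Q" "y' \<in> Q" "x \<oplus>\<^bsub>?F\<^esub> y = x' \<oplus>\<^bsub>?F\<^esub> y'" for x x' y y'
  proof -
    have c: "x \<in> carrier ?F" "x' \<in> carrier ?F" "y \<in> carrier ?F" "y' \<in> carrier ?F"
      using that Psub Qsub by auto
    have "x \<oplus>\<^bsub>?F\<^esub> \<ominus>\<^bsub>?F\<^esub> x' = (x \<oplus>\<^bsub>?F\<^esub> y) \<oplus>\<^bsub>?F\<^esub> (\<ominus>\<^bsub>?F\<^esub> y \<oplus>\<^bsub>?F\<^esub> \<ominus>\<^bsub>?F\<^esub> x')"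
      using c by (simp add: F.M.a_assoc F.M.r_neg2)
    also have "\<dots> = (y' \<oplus>\<^bsub>?F\<^esub> \<ominus>\<^bsub>?F\<^esub> y) \<oplus>\<^bsub>?F\<^esub> (x' \<oplus>\<^bsub>?F\<^esub> \<ominus>\<^bsub>?F\<^esub> x')"
      unfolding that(5) using c by (simp add: F.M.a_ac)
    also have "\<dots> = y' \<oplus>\<^bsub>?F\<^esub> \<ominus>\<^bsub>?F\<^esub> y"
      using c by (simp add: F.M.r_neg F.M.r_zero)
    finally have "x \<oplus>\<^bsub>?F\<^esub> \<ominus>\<^bsub>?F\<^esub> x' = y' \<oplus>\<^bsub>?F\<^esub> \<ominus>\<^bsub>?F\<^esub> y" .
    moreover have "x \<oplus>\<^bsub>?F\<^esub> \<ominus>\<^bsub>?F\<^esub> x' \<in> P" "y' \<oplus>\<^bsub>?F\<^esub> \<ominus>\<^bsub>?F\<^esub> y \<in> Q"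
      using that by (auto intro: Pc Qc Pi Qi)
    ultimately have "x \<oplus>\<^bsub>?F\<^esub> \<ominus>\<^bsub>?F\<^esub> x' = \<zero>\<^bsub>?F\<^esub>"
      using PQ by (metis Int_iff singletonD)
    then show ?thesis
      using c by (metis F.M.minus_equality F.M.minus_minus F.M.a_inv_closed)
  qed
  have ex: "\<exists>x\<in>carrier M. \<exists>y\<in>Q. v = h x \<oplus>\<^bsub>?F\<^esub> y" if "v \<in> carrier ?F" for v
  proof -
    have "v \<in> set_add ?F P Q"
      using that sum by simp
    then obtain u y where "u \<in> P" "y \<in> Q" "v = u \<oplus>\<^bsub>?F\<^esub> y"
      by (auto simp: set_add_def set_mult_def)
    then show ?thesis
      using bij by (auto simp: bij_betw_def)
  qed
  then obtain r s where r: "\<And>v. v \<in> carrier ?F \<Longrightarrow> r v \<in> carrier M"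
    and s: "\<And>v. v \<in> carrier ?F \<Longrightarrow> s v \<in> Q"
    and rs: "\<And>v. v \<in> carrier ?F \<Longrightarrow> v = h (r v) \<oplus>\<^bsub>?F\<^esub> s v"
    by metis
  have hP: "h x \<in> P" if "x \<in> carrier M" for x
    using that bij by (auto simp: bij_betw_def)
  \<comment> \<open>Any decomposition of \<open>v\<close> determines \<open>r v\<close>, so
    linearity of \<open>r\<close> follows by adding or scaling decompositions.\<close>
  have r_eq: "r v = x" if "x \<in> carrier M" "y \<in> Q" "v = h x \<oplus>\<^bsub>?F\<^esub> y" "v \<in> carrier ?F" for v x y
  proof -
    have "h (r v) = h x"
      using uniq[of "h (r v)" "h x" "s v" y] that rs[OF that(4)] r s hP by metis
    then show ?thesis
      using bij that r by (auto simp: bij_betw_def dest: inj_onD)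
  qed
  have zQ: "\<zero>\<^bsub>?F\<^esub> \<in> Q" using PQ by blast
  have "r \<in> lmodule_hom R ?F M"
  proof (rule lmodule_homI)
    fix v w assume v: "v \<in> carrier ?F" and w: "w \<in> carrier ?F"
    have c: "h (r v) \<in> carrier ?F" "h (r w) \<in> carrier ?F" "s v \<in> carrier ?F" "s w \<in> carrier ?F"
      using v w r s hP Psub Qsub by auto
    have "v \<oplus>\<^bsub>?F\<^esub> w = (h (r v) \<oplus>\<^bsub>?F\<^esub> s v) \<oplus>\<^bsub>?F\<^esub> (h (r w) \<oplus>\<^bsub>?F\<^esub> s w)"
      using rs[OF v] rs[OF w] by simp
    also have "\<dots> = (h (r v) \<oplus>\<^bsub>?F\<^esub> h (r w)) \<oplus>\<^bsub>?F\<^esub> (s v \<oplus>\<^bsub>?F\<^esub> s w)"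
      using c by (simp add: F.M.a_ac)
    also have "h (r v) \<oplus>\<^bsub>?F\<^esub> h (r w) = h (r v \<oplus>\<^bsub>M\<^esub> r w)"
      using lmodule_homD(2)[OF h, of "r v" "r w"] r v w by simp
    finally have "v \<oplus>\<^bsub>?F\<^esub> w = h (r v \<oplus>\<^bsub>M\<^esub> r w) \<oplus>\<^bsub>?F\<^esub> (s v \<oplus>\<^bsub>?F\<^esub> s w)" .
    then show "r (v \<oplus>\<^bsub>?F\<^esub> w) = r v \<oplus>\<^bsub>M\<^esub> r w"
      using v w r s Qc
      by (intro r_eq[of _ "s v \<oplus>\<^bsub>?F\<^esub> s w"] F.M.add.m_closed M.M.add.m_closed) blast+
  next
    fix a v assume a: "a \<in> carrier R" and v: "v \<in> carrier ?F"
    have c: "h (r v) \<in> carrier ?F" "s v \<in> carrier ?F"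
      using v r s hP Psub Qsub by auto
    have "a \<odot>\<^bsub>?F\<^esub> v = a \<odot>\<^bsub>?F\<^esub> (h (r v) \<oplus>\<^bsub>?F\<^esub> s v)"
      using rs[OF v] by simp
    also have "\<dots> = a \<odot>\<^bsub>?F\<^esub> h (r v) \<oplus>\<^bsub>?F\<^esub> a \<odot>\<^bsub>?F\<^esub> s v"
      using a c by (rule F.smult_r_distr)
    also have "a \<odot>\<^bsub>?F\<^esub> h (r v) = h (a \<odot>\<^bsub>M\<^esub> r v)"
      using lmodule_homD(3)[OF h, of a "r v"] r v a by simp
    finally have "a \<odot>\<^bsub>?F\<^esub> v = h (a \<odot>\<^bsub>M\<^esub> r v) \<oplus>\<^bsub>?F\<^esub> a \<odot>\<^bsub>?F\<^esub> s v" .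
    then show "r (a \<odot>\<^bsub>?F\<^esub> v) = a \<odot>\<^bsub>M\<^esub> r v"
      using a v r s Q.smult_closed
      by (intro r_eq[of _ "a \<odot>\<^bsub>?F\<^esub> s v"] F.smult_closed M.smult_closed) blast+
  qed (rule r)
  moreover have "r (h x) = x" if "x \<in> carrier M" for x
  proof (rule r_eq[OF that zQ])
    have "h x \<in> carrier ?F" using hP[OF that] Psub by blast
    then show "h x = h x \<oplus>\<^bsub>?F\<^esub> \<zero>\<^bsub>?F\<^esub>" "h x \<in> carrier ?F"
      using F.M.r_zero[of "h x"] by simp_all
  qed
  ultimately show ?thesis
    using that h by blast
qed

text \<open>The data of the classical dual basis lemma, which replace a basis for modules that are
  only projective. The vectors \<open>e b\<close> may satisfy relations and \<open>X\<close> may be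
  infinite, but each element has only finitely many nonzero coordinates.\<close>

definition dual_basis :: "('r, 'y) ring_scheme \<Rightarrow> ('r, 'm) module \<Rightarrow> 'b set \<Rightarrow> ('b \<Rightarrow> 'm \<Rightarrow> 'r) \<Rightarrow> ('b \<Rightarrow> 'm) \<Rightarrow> bool" where
  "dual_basis R M X \<phi> e \<longleftrightarrow>
     (\<forall>b\<in>X. \<phi> b \<in> lmodule_hom R M (regular_module R) \<and> e b \<in> carrier M) \<and>
     (\<forall>x\<in>carrier M. finite {b \<in> X. \<phi> b x \<noteq> \<zero>\<^bsub>R\<^esub>} \<and>
        x = (\<Oplus>\<^bsub>M\<^esub>b\<in>{b \<in> X. \<phi> b x \<noteq> \<zero>\<^bsub>R\<^esub>}. \<phi> b x \<odot>\<^bsub>M\<^esub> e b))"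

text \<open>Coordinates on the free module are pulled back along \<open>h\<close>, and its basis
  vectors are pushed forward along \<open>r\<close>; applying \<open>r\<close> to the expansion of
  \<open>h x\<close> gives the expansion of \<open>x\<close>.\<close>

theorem projective_module_dual_basis:
  fixes M :: "('r, 'm) module"
  assumes "projective_module R M"
  obtains X :: "'m set" and \<phi> e where "dual_basis R M X \<phi> e"
proof (rule projective_module_retract[OF assms])
  fix X :: "'m set" and h r
  assume h: "h \<in> lmodule_hom R M (free_module R X)"
    and r: "r \<in> lmodule_hom R (free_module R X) M"
    and rh: "\<And>x. x \<in> carrier M \<Longrightarrow> r (h x) = x"
  interpret M: left_module R M by (rule projective_module_imp_left_module[OF assms])
  let ?F = "free_module R X"
  interpret F: left_module R ?F by (rule M.left_module_free_module)
  interpret r: abelian_group_hom ?F M r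
    by (rule lmodule_hom_imp_abelian_group_hom[OF F.abelian_group_axioms M.M.abelian_group_axioms r])
  define \<phi> where "\<phi> b x = h x b" for b x
  define e where "e b = r (free_basis R b)" for b
  have hx: "h x \<in> carrier ?F" if "x \<in> carrier M" for x
    using lmodule_homD(1)[OF h that] .
  have "\<phi> b \<in> lmodule_hom R M (regular_module R)" if "b \<in> X" for b
    using that hx lmodule_homD(2,3)[OF h]
    by (intro lmodule_homI) (auto simp: \<phi>_def free_module_simps free_module_carrier_iff)
  moreover have "e b \<in> carrier M" if "b \<in> X" for b
    using M.free_basis_closed[OF that] by (simp add: e_def)
  moreover have "x = (\<Oplus>\<^bsub>M\<^esub>b\<in>{b \<in> X. \<phi> b x \<noteq> \<zero>\<^bsub>R\<^esub>}. \<phi> b x \<odot>\<^bsub>M\<^esub> e b)" if x: "x \<in> carrier M" for x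
  proof -
    have cl: "\<phi> b x \<in> carrier R" "free_basis R b \<in> carrier ?F" if "b \<in> X" for b
      using that hx[OF x] M.free_basis_closed[OF that] by (simp_all add: \<phi>_def free_module_carrier_iff[of "h x"])
    have "x = r (h x)" using rh x by simp
    also have "h x = (\<Oplus>\<^bsub>?F\<^esub>b\<in>{b \<in> X. \<phi> b x \<noteq> \<zero>\<^bsub>R\<^esub>}. \<phi> b x \<odot>\<^bsub>?F\<^esub> free_basis R b)"
      unfolding \<phi>_def by (rule M.free_module_expansion[OF hx[OF x]])
    also have "r \<dots> = (\<Oplus>\<^bsub>M\<^esub>b\<in>{b \<in> X. \<phi> b x \<noteq> \<zero>\<^bsub>R\<^esub>}. r (\<phi> b x \<odot>\<^bsub>?F\<^esub> free_basis R b))"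
      using cl by (intro r.hom_finsum Pi_I F.smult_closed) auto
    also have "\<dots> = (\<Oplus>\<^bsub>M\<^esub>b\<in>{b \<in> X. \<phi> b x \<noteq> \<zero>\<^bsub>R\<^esub>}. \<phi> b x \<odot>\<^bsub>M\<^esub> e b)"
      using cl lmodule_homD(1,3)[OF r] by (intro M.M.finsum_cong) (auto simp: e_def)
    finally show ?thesis .
  qed
  moreover have "finite {b \<in> X. \<phi> b x \<noteq> \<zero>\<^bsub>R\<^esub>}" if "x \<in> carrier M" for x
    using hx[OF that] by (simp add: \<phi>_def free_module_carrier_iff)
  ultimately have "dual_basis R M X \<phi> e"
    unfolding dual_basis_def by blast
  then show ?thesis by (rule that)
qed

context
  fixes R :: "('r, 'y) ring_scheme" and M :: "('r, 'm) module" and X :: "'b set" and \<phi> e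
  assumes R: "ring R" and db: "dual_basis R M X \<phi> e"
begin

interpretation R: ring R by (rule R)

lemma dual_basis_functional: "b \<in> X \<Longrightarrow> \<phi> b \<in> lmodule_hom R M (regular_module R)"
  and dual_basis_vector: "b \<in> X \<Longrightarrow> e b \<in> carrier M"
  and dual_basis_finite: "x \<in> carrier M \<Longrightarrow> finite {b \<in> X. \<phi> b x \<noteq> \<zero>\<^bsub>R\<^esub>}"
  using db by (auto simp: dual_basis_def)

text \<open>Two elements and their sum have different sets of nonzero coordinates. Enlarging all of
  them to one finite index set makes the expansions comparable.\<close>

lemma dual_basis_finsum_cong:
  assumes A: "left_module R A" and a: "\<And>b. b \<in> X \<Longrightarrow> a b \<in> carrier A"
    and x: "x \<in> carrier M" and B: "finite B" "B \<subseteq> X" "{b \<in> X. \<phi> b x \<noteq> \<zero>\<^bsub>R\<^esub>} \<subseteq> B"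
  shows "(\<Oplus>\<^bsub>A\<^esub>b\<in>{b \<in> X. \<phi> b x \<noteq> \<zero>\<^bsub>R\<^esub>}. \<phi> b x \<odot>\<^bsub>A\<^esub> a b) = (\<Oplus>\<^bsub>A\<^esub>b\<in>B. \<phi> b x \<odot>\<^bsub>A\<^esub> a b)"
proof -
  interpret A: left_module R A by (rule A)
  have "\<phi> b x \<in> carrier R" if "b \<in> X" for b
    using lmodule_homD(1)[OF dual_basis_functional[OF that] x] by simp
  then show ?thesis
    using B a by (intro A.M.add.finprod_mono_neutral_cong_left) auto
qed

lemma dual_basis_expansion:
  assumes M: "left_module R M"
    and x: "x \<in> carrier M" and B: "finite B" "B \<subseteq> X" "{b \<in> X. \<phi> b x \<noteq> \<zero>\<^bsub>R\<^esub>} \<subseteq> B"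
  shows "x = (\<Oplus>\<^bsub>M\<^esub>b\<in>B. \<phi> b x \<odot>\<^bsub>M\<^esub> e b)"
proof -
  have "x = (\<Oplus>\<^bsub>M\<^esub>b\<in>{b \<in> X. \<phi> b x \<noteq> \<zero>\<^bsub>R\<^esub>}. \<phi> b x \<odot>\<^bsub>M\<^esub> e b)"
    using db x unfolding dual_basis_def by blast
  also have "\<dots> = (\<Oplus>\<^bsub>M\<^esub>b\<in>B. \<phi> b x \<odot>\<^bsub>M\<^esub> e b)"
    by (rule dual_basis_finsum_cong[where a = e, OF M dual_basis_vector x B])
  finally show ?thesis .
qed

text \<open>The values \<open>a b\<close> can be chosen freely even when the \<open>e b\<close>
  satisfy relations, because the map is built from the coordinates \<open>\<phi> b x\<close>, that
  is, it passes through a free module. In return it may fail to send \<open>e b\<close> to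
  \<open>a b\<close>.\<close>

lemma dual_basis_extend:
  assumes A: "left_module R A" and M: "left_module R M" and a: "\<And>b. b \<in> X \<Longrightarrow> a b \<in> carrier A"
  shows "(\<lambda>x. \<Oplus>\<^bsub>A\<^esub>b\<in>{b \<in> X. \<phi> b x \<noteq> \<zero>\<^bsub>R\<^esub>}. \<phi> b x \<odot>\<^bsub>A\<^esub> a b) \<in> lmodule_hom R M A"
    (is "?h \<in> _")
proof (rule lmodule_homI)
  interpret A: left_module R A by (rule A)
  interpret M: left_module R M by (rule M)
  have \<phi>: "\<phi> b x \<in> carrier R" if "b \<in> X" "x \<in> carrier M" for b x
    using lmodule_homD(1)[OF dual_basis_functional[OF that(1)] that(2)] by simp
  show "?h x \<in> carrier A" if "x \<in> carrier M" for x
    using that \<phi> a by (intro A.M.finsum_closed) auto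
  show "?h (x \<oplus>\<^bsub>M\<^esub> y) = ?h x \<oplus>\<^bsub>A\<^esub> ?h y" if x: "x \<in> carrier M" and y: "y \<in> carrier M" for x y
  proof -
    define B where "B = {b \<in> X. \<phi> b x \<noteq> \<zero>\<^bsub>R\<^esub>} \<union> {b \<in> X. \<phi> b y \<noteq> \<zero>\<^bsub>R\<^esub>}"
    have add: "\<phi> b (x \<oplus>\<^bsub>M\<^esub> y) = \<phi> b x \<oplus>\<^bsub>R\<^esub> \<phi> b y" if "b \<in> X" for b
      using lmodule_homD(2)[OF dual_basis_functional[OF that] x y] by simp
    have B: "finite B" "B \<subseteq> X" "{b \<in> X. \<phi> b x \<noteq> \<zero>\<^bsub>R\<^esub>} \<subseteq> B" "{b \<in> X. \<phi> b y \<noteq> \<zero>\<^bsub>R\<^esub>} \<subseteq> B"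
      using dual_basis_finite[OF x] dual_basis_finite[OF y] unfolding B_def by blast+
    have "\<phi> b (x \<oplus>\<^bsub>M\<^esub> y) = \<zero>\<^bsub>R\<^esub>" if "b \<in> X" "b \<notin> B" for b
      using that by (simp add: B_def add)
    then have B5: "{b \<in> X. \<phi> b (x \<oplus>\<^bsub>M\<^esub> y) \<noteq> \<zero>\<^bsub>R\<^esub>} \<subseteq> B"
      by blast
    have cl: "\<phi> b x \<in> carrier R" "\<phi> b y \<in> carrier R" "a b \<in> carrier A" if "b \<in> B" for b
      using that B(2) \<phi> x y a by blast+
    have "?h (x \<oplus>\<^bsub>M\<^esub> y) = (\<Oplus>\<^bsub>A\<^esub>b\<in>B. \<phi> b (x \<oplus>\<^bsub>M\<^esub> y) \<odot>\<^bsub>A\<^esub> a b)"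
      by (rule dual_basis_finsum_cong[where a = a, OF A a _ B(1,2) B5]) (use x y in auto)
    also have "\<dots> = (\<Oplus>\<^bsub>A\<^esub>b\<in>B. \<phi> b x \<odot>\<^bsub>A\<^esub> a b \<oplus>\<^bsub>A\<^esub> \<phi> b y \<odot>\<^bsub>A\<^esub> a b)"
    proof (rule A.M.finsum_cong')
      fix b assume "b \<in> B"
      then have "b \<in> X" using B by blast
      then show "\<phi> b (x \<oplus>\<^bsub>M\<^esub> y) \<odot>\<^bsub>A\<^esub> a b = \<phi> b x \<odot>\<^bsub>A\<^esub> a b \<oplus>\<^bsub>A\<^esub> \<phi> b y \<odot>\<^bsub>A\<^esub> a b"
        using \<phi> x y a by (simp add: add A.smult_l_distr)
    qed (use cl in auto)
    also have "\<dots> = (\<Oplus>\<^bsub>A\<^esub>b\<in>B. \<phi> b x \<odot>\<^bsub>A\<^esub> a b) \<oplus>\<^bsub>A\<^esub> (\<Oplus>\<^bsub>A\<^esub>b\<in>B. \<phi> b y \<odot>\<^bsub>A\<^esub> a b)"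
      using cl by (intro A.M.finsum_addf) auto
    also have "\<dots> = ?h x \<oplus>\<^bsub>A\<^esub> ?h y"
      using dual_basis_finsum_cong[where a = a, OF A a x B(1-3)] dual_basis_finsum_cong[where a = a, OF A a y B(1,2,4)] by simp
    finally show ?thesis .
  qed
  show "?h (c \<odot>\<^bsub>M\<^esub> x) = c \<odot>\<^bsub>A\<^esub> ?h x" if c: "c \<in> carrier R" and x: "x \<in> carrier M" for c x
  proof -
    define B where "B = {b \<in> X. \<phi> b x \<noteq> \<zero>\<^bsub>R\<^esub>}"
    have smult: "\<phi> b (c \<odot>\<^bsub>M\<^esub> x) = c \<otimes>\<^bsub>R\<^esub> \<phi> b x" if "b \<in> X" for b
      using lmodule_homD(3)[OF dual_basis_functional[OF that] c x] by simp
    have B: "finite B" "B \<subseteq> X" "{b \<in> X. \<phi> b (c \<odot>\<^bsub>M\<^esub> x) \<noteq> \<zero>\<^bsub>R\<^esub>} \<subseteq> B"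
      using dual_basis_finite[OF x] c by (auto simp: B_def smult)
    have cl: "\<phi> b x \<in> carrier R" "a b \<in> carrier A" if "b \<in> B" for b
      using that B(2) \<phi> x a by blast+
    have "?h (c \<odot>\<^bsub>M\<^esub> x) = (\<Oplus>\<^bsub>A\<^esub>b\<in>B. \<phi> b (c \<odot>\<^bsub>M\<^esub> x) \<odot>\<^bsub>A\<^esub> a b)"
      by (rule dual_basis_finsum_cong[where a = a, OF A a _ B]) (use x c in auto)
    also have "\<dots> = (\<Oplus>\<^bsub>A\<^esub>b\<in>B. c \<odot>\<^bsub>A\<^esub> (\<phi> b x \<odot>\<^bsub>A\<^esub> a b))"
    proof (rule A.M.finsum_cong')
      fix b assume "b \<in> B"
      then have "b \<in> X" using B by blast
      then show "\<phi> b (c \<odot>\<^bsub>M\<^esub> x) \<odot>\<^bsub>A\<^esub> a b = c \<odot>\<^bsub>A\<^esub> (\<phi> b x \<odot>\<^bsub>A\<^esub> a b)"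
        using \<phi> x c a by (simp add: smult A.smult_assoc1)
    qed (use cl c in auto)
    also have "\<dots> = c \<odot>\<^bsub>A\<^esub> ?h x"
      unfolding B_def[symmetric] using cl c by (intro A.finsum_smult[symmetric]) auto
    finally show ?thesis .
  qed
qed

end

text \<open>Preimages \<open>a b\<close> of the elements \<open>f (e b)\<close> are extended by
  coordinates. Although \<open>h (e b)\<close> may differ from \<open>a b\<close>, the maps
  \<open>g \<circ> h\<close> and \<open>f\<close> agree, since both are the same combination of the
  \<open>f (e b)\<close>. The condition is on images, because a boundary map of a resolution covers
  only a kernel.\<close>

theorem projective_module_lift:
  assumes proj: "projective_module R M" and A: "left_module R A" and N: "abelian_group N"
    and f: "f \<in> lmodule_hom R M N" and g: "g \<in> lmodule_hom R A N"
    and im: "f ` carrier M \<subseteq> g ` carrier A"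
  shows "\<exists>h\<in>lmodule_hom R M A. \<forall>x\<in>carrier M. g (h x) = f x"
proof -
  interpret M: left_module R M by (rule projective_module_imp_left_module[OF proj])
  interpret A: left_module R A by (rule A)
  interpret f: abelian_group_hom M N f
    by (rule lmodule_hom_imp_abelian_group_hom[OF M.M.abelian_group_axioms N f])
  interpret g: abelian_group_hom A N g
    by (rule lmodule_hom_imp_abelian_group_hom[OF A.M.abelian_group_axioms N g])
  have R: "ring R" ..
  obtain X \<phi> and e :: "'c \<Rightarrow> 'c" where db: "dual_basis R M X \<phi> e"
    using projective_module_dual_basis[OF proj] by blast
  have "\<exists>a\<in>carrier A. g a = f (e b)" if "b \<in> X" for b
    using im dual_basis_vector[OF R db that] by (auto simp: image_iff subset_iff) (metis imageE)
  then obtain a where a: "\<And>b. b \<in> X \<Longrightarrow> a b \<in> carrier A" and ga: "\<And>b. b \<in> X \<Longrightarrow> g (a b) = f (e b)"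
    by metis
  define h where "h x = (\<Oplus>\<^bsub>A\<^esub>b\<in>{b \<in> X. \<phi> b x \<noteq> \<zero>\<^bsub>R\<^esub>}. \<phi> b x \<odot>\<^bsub>A\<^esub> a b)" for x
  have "h \<in> lmodule_hom R M A"
    unfolding h_def by (rule dual_basis_extend[OF R db A M.left_module_axioms a])
  moreover have "g (h x) = f x" if x: "x \<in> carrier M" for x
  proof -
    have \<phi>: "\<phi> b x \<in> carrier R" if "b \<in> X" for b
      using lmodule_homD(1)[OF dual_basis_functional[OF R db that] x] by simp
    have e: "e b \<in> carrier M" if "b \<in> X" for b
      by (rule dual_basis_vector[OF R db that])
    have "g (h x) = (\<Oplus>\<^bsub>N\<^esub>b\<in>{b \<in> X. \<phi> b x \<noteq> \<zero>\<^bsub>R\<^esub>}. g (\<phi> b x \<odot>\<^bsub>A\<^esub> a b))"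
      unfolding h_def using \<phi> a by (intro g.hom_finsum) auto
    also have "\<dots> = (\<Oplus>\<^bsub>N\<^esub>b\<in>{b \<in> X. \<phi> b x \<noteq> \<zero>\<^bsub>R\<^esub>}. f (\<phi> b x \<odot>\<^bsub>M\<^esub> e b))"
    proof (rule f.H.finsum_cong')
      fix b assume "b \<in> {b \<in> X. \<phi> b x \<noteq> \<zero>\<^bsub>R\<^esub>}"
      then have "b \<in> X" by simp
      then show "g (\<phi> b x \<odot>\<^bsub>A\<^esub> a b) = f (\<phi> b x \<odot>\<^bsub>M\<^esub> e b)"
        using lmodule_homD(3)[OF f \<phi> e] lmodule_homD(3)[OF g \<phi> a] ga by simp
    qed (use \<phi> e in auto)
    also have "\<dots> = f (\<Oplus>\<^bsub>M\<^esub>b\<in>{b \<in> X. \<phi> b x \<noteq> \<zero>\<^bsub>R\<^esub>}. \<phi> b x \<odot>\<^bsub>M\<^esub> e b)"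
      using \<phi> e by (intro f.hom_finsum[symmetric]) auto
    also have "(\<Oplus>\<^bsub>M\<^esub>b\<in>{b \<in> X. \<phi> b x \<noteq> \<zero>\<^bsub>R\<^esub>}. \<phi> b x \<odot>\<^bsub>M\<^esub> e b) = x"
      using db x unfolding dual_basis_def by metis
    finally show ?thesis .
  qed
  ultimately show ?thesis by blast
qed

section \<open>Group rings, homotopies and the centre\<close>

text \<open>The linear extension of \<open>f\<close> to formal sums, with values in a ring. For
  constant \<open>f = 1\<close> it is the augmentation, for an indicator function it counts
  coefficients in a subset, and for \<open>f\<close> in \<open>l\<^sup>p(G)\<close> it evaluates a
  group ring element against a function.\<close>

definition frag_sum :: "('a \<Rightarrow> 'b::comm_ring_1) \<Rightarrow> ('a \<Rightarrow>\<^sub>0 int) \<Rightarrow> 'b" where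
  "frag_sum f c = (\<Sum>x \<in> Poly_Mapping.keys c. of_int (Poly_Mapping.lookup c x) * f x)"

lemma frag_sum_superset:
  assumes "finite S" "Poly_Mapping.keys c \<subseteq> S"
  shows "frag_sum f c = (\<Sum>x\<in>S. of_int (Poly_Mapping.lookup c x) * f x)"
  unfolding frag_sum_def using assms by (intro sum.mono_neutral_left) (auto simp: in_keys_iff)

lemma frag_sum_0 [simp]: "frag_sum f 0 = 0"
  by (simp add: frag_sum_def)

lemma frag_sum_of [simp]: "frag_sum f (frag_of x) = f x"
  by (simp add: frag_sum_def)

lemma frag_sum_add: "frag_sum f (a + b) = frag_sum f a + frag_sum f b"
proof -
  let ?S = "Poly_Mapping.keys a \<union> Poly_Mapping.keys b"
  have "Poly_Mapping.keys (a + b) \<subseteq> ?S" by (rule keys_add)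
  then show ?thesis
    by (simp add: frag_sum_superset[of ?S] lookup_add distrib_right sum.distrib)
qed

lemma frag_sum_cmul: "frag_sum f (frag_cmul k a) = of_int k * frag_sum f a"
proof -
  have "Poly_Mapping.keys (frag_cmul k a) \<subseteq> Poly_Mapping.keys a" by (rule keys_cmul)
  then show ?thesis
    by (simp add: frag_sum_superset[of "Poly_Mapping.keys a"] sum_distrib_left mult.assoc)
qed

lemma frag_sum_uminus: "frag_sum f (- a) = - frag_sum f a"
  using frag_sum_cmul[of f "-1" a] by simp

lemma frag_sum_diff: "frag_sum f (a - b) = frag_sum f a - frag_sum f b"
  using frag_sum_add[of f a "- b"] by (simp add: frag_sum_uminus)

lemma frag_sum_sum: "frag_sum f (\<Sum>k\<in>K. c k) = (\<Sum>k\<in>K. frag_sum f (c k))"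
  by (induction K rule: infinite_finite_induct) (auto simp: frag_sum_add)

lemma frag_sum_extend: "frag_sum f (frag_extend u c) = frag_sum (\<lambda>x. frag_sum f (u x)) c"
  by (simp add: frag_extend_def frag_sum_sum frag_sum_cmul frag_sum_def[of _ c])

lemma frag_sum_cong:
  "(\<And>x. x \<in> Poly_Mapping.keys c \<Longrightarrow> f x = g x) \<Longrightarrow> frag_sum f c = frag_sum g c"
  by (simp add: frag_sum_def)

lemma frag_sum_zero_fun [simp]: "frag_sum (\<lambda>x. 0) c = 0"
  by (simp add: frag_sum_def)

lemma frag_sum_add_fun: "frag_sum (\<lambda>x. f x + g x) c = frag_sum f c + frag_sum g c"
  by (simp add: frag_sum_def distrib_left sum.distrib)

lemma frag_sum_cmult: "frag_sum (\<lambda>x. k * f x) c = k * frag_sum f c"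
  by (simp add: frag_sum_def sum_distrib_left mult.left_commute)

lemma frag_sum_diff_fun: "frag_sum (\<lambda>x. f x - g x) c = frag_sum f c - frag_sum g c"
  by (simp add: frag_sum_def right_diff_distrib sum_subtractf)

lemma frag_sum_sum_fun: "frag_sum (\<lambda>x. \<Sum>k\<in>K. f k x) c = (\<Sum>k\<in>K. frag_sum (f k) c)"
  by (induction K rule: infinite_finite_induct) (auto simp: frag_sum_add_fun)

lemma frag_sum_swap:
  "frag_sum (\<lambda>x. frag_sum (f x) b) a = frag_sum (\<lambda>y. frag_sum (\<lambda>x. f x y) a) b"
  unfolding frag_sum_def
  by (simp add: sum_distrib_left, subst sum.swap) (simp add: mult.left_commute)

lemma group_ring_simps:
  "a \<in> carrier (group_ring G) \<longleftrightarrow> Poly_Mapping.keys a \<subseteq> carrier G"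
  "\<zero>\<^bsub>group_ring G\<^esub> = 0" "\<one>\<^bsub>group_ring G\<^esub> = frag_of \<one>\<^bsub>G\<^esub>"
  "a \<oplus>\<^bsub>group_ring G\<^esub> b = a + b"
  by (simp_all add: group_ring_def)

lemma frag_sum_group_ring_mult:
  "frag_sum f (a \<otimes>\<^bsub>group_ring G\<^esub> b) = frag_sum (\<lambda>g. frag_sum (\<lambda>h. f (g \<otimes>\<^bsub>G\<^esub> h)) b) a"
  by (simp add: group_ring_def frag_sum_extend)

lemma frag_sum_involution:
  "frag_sum f (group_ring_involution G a) = frag_sum (\<lambda>g. f (inv\<^bsub>G\<^esub> g)) a"
  by (simp add: group_ring_involution_def frag_sum_extend)

lemma (in group) group_ring_involution_closed:
  assumes "a \<in> carrier (group_ring G)"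
  shows "group_ring_involution G a \<in> carrier (group_ring G)"
proof -
  have "Poly_Mapping.keys (group_ring_involution G a) \<subseteq> (\<Union>g\<in>Poly_Mapping.keys a. {inv g})"
    unfolding group_ring_involution_def by (rule order.trans[OF keys_frag_extend]) auto
  also have "\<dots> \<subseteq> carrier G"
    using assms by (auto simp: group_ring_simps)
  finally show ?thesis
    by (simp add: group_ring_simps)
qed

lemma group_ring_central:
  assumes "\<And>g. g \<in> carrier G \<Longrightarrow> z \<otimes>\<^bsub>G\<^esub> g = g \<otimes>\<^bsub>G\<^esub> z" and "a \<in> carrier (group_ring G)"
  shows "frag_of z \<otimes>\<^bsub>group_ring G\<^esub> a = a \<otimes>\<^bsub>group_ring G\<^esub> frag_of z"
  using assms by (auto simp: group_ring_def subset_iff intro: frag_extend_eq)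

lemma trivial_module_simps [simp]:
  "carrier (trivial_module G) = UNIV" "\<zero>\<^bsub>trivial_module G\<^esub> = 0"
  "k \<oplus>\<^bsub>trivial_module G\<^esub> l = k + l"
  "a \<odot>\<^bsub>trivial_module G\<^esub> k = frag_sum (\<lambda>_. 1) a * k"
  by (simp_all add: trivial_module_def frag_sum_def)

lemma abelian_group_trivial_module: "abelian_group (trivial_module G)"
  by (rule abelian_groupI) (auto intro: exI[of _ "- _"])

lemma augmentation_hom: "frag_sum (\<lambda>_. 1) \<in> lmodule_hom (group_ring G) (regular_module (group_ring G)) (trivial_module G)"
proof (rule lmodule_homI)
  fix a x
  show "frag_sum (\<lambda>_. 1) (a \<odot>\<^bsub>regular_module (group_ring G)\<^esub> x)
      = a \<odot>\<^bsub>trivial_module G\<^esub> frag_sum (\<lambda>_. 1) x"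
    using frag_sum_cmult[of "frag_sum (\<lambda>_. 1) x" "\<lambda>_. 1" a]
    by (simp add: frag_sum_group_ring_mult mult.commute)
qed (simp_all add: group_ring_simps frag_sum_add)

lemma lmodule_hom_diff:
  assumes M: "left_module R M" and N: "left_module R N"
    and h: "h \<in> lmodule_hom R M N" and k: "k \<in> lmodule_hom R M N"
  shows "(\<lambda>x. h x \<ominus>\<^bsub>N\<^esub> k x) \<in> lmodule_hom R M N"
proof (rule lmodule_homI)
  interpret M: left_module R M by (rule M)
  interpret N: left_module R N by (rule N)
  note hk = lmodule_homD[OF h] lmodule_homD[OF k]
  show "h x \<ominus>\<^bsub>N\<^esub> k x \<in> carrier N" if "x \<in> carrier M" for x
    using that hk by simp
  show "h (x \<oplus>\<^bsub>M\<^esub> y) \<ominus>\<^bsub>N\<^esub> k (x \<oplus>\<^bsub>M\<^esub> y) = (h x \<ominus>\<^bsub>N\<^esub> k x) \<oplus>\<^bsub>N\<^esub> (h y \<ominus>\<^bsub>N\<^esub> k y)"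
    if "x \<in> carrier M" "y \<in> carrier M" for x y
    using that hk by (simp add: a_minus_def N.M.minus_add N.M.a_ac)
  show "h (a \<odot>\<^bsub>M\<^esub> x) \<ominus>\<^bsub>N\<^esub> k (a \<odot>\<^bsub>M\<^esub> x) = a \<odot>\<^bsub>N\<^esub> (h x \<ominus>\<^bsub>N\<^esub> k x)"
    if "a \<in> carrier R" "x \<in> carrier M" for a x
    using that hk by (simp add: a_minus_def N.smult_r_distr N.smult_a_inv)
qed

lemma (in left_module) central_smult_hom:
  assumes "z \<in> carrier R" "\<And>a. a \<in> carrier R \<Longrightarrow> z \<otimes> a = a \<otimes> z"
  shows "(\<lambda>x. z \<odot>\<^bsub>M\<^esub> x) \<in> lmodule_hom R M M"
proof (rule lmodule_homI)
  show "z \<odot>\<^bsub>M\<^esub> (a \<odot>\<^bsub>M\<^esub> x) = a \<odot>\<^bsub>M\<^esub> (z \<odot>\<^bsub>M\<^esub> x)" if "a \<in> carrier R" "x \<in> carrier M" for a x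
    using that assms smult_assoc1[of z a x] smult_assoc1[of a z x] by simp
qed (use assms smult_r_distr in auto)

lemma lmodule_hom_id: "(\<lambda>x. x) \<in> lmodule_hom R M M"
  by (simp add: lmodule_hom_def)

abbreviation (in group) ZG :: "('a \<Rightarrow>\<^sub>0 int) ring" where "ZG \<equiv> group_ring G"

section \<open>Homotopy between multiplication by a central element and the identity\<close>

locale group_resolution = group G for G :: "('g, 'x) monoid_scheme" (structure) +
  fixes F :: "nat \<Rightarrow> ('g \<Rightarrow>\<^sub>0 int, 'm) module" and d :: "nat \<Rightarrow> 'm \<Rightarrow> 'm" and \<epsilon> :: "'m \<Rightarrow> int"
  assumes resolution: "projective_resolution G F d \<epsilon>"
begin

lemma partial_resolution: "partial_projective_resolution G n F d \<epsilon>"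
  using resolution by (simp add: projective_resolution_def)

lemma projective: "projective_module ZG (F i)"
  using partial_resolution[of i] by (simp add: partial_projective_resolution_def)

lemma F_left_module: "left_module ZG (F i)"
  by (rule projective_module_imp_left_module) (rule projective)

interpretation F: left_module ZG "F i" for i
  by (rule F_left_module)

lemma d_hom: "d (Suc i) \<in> lmodule_hom ZG (F (Suc i)) (F i)"
  using partial_resolution[of "Suc i"] by (simp add: partial_projective_resolution_def)

lemma d_closed: "x \<in> carrier (F (Suc i)) \<Longrightarrow> d (Suc i) x \<in> carrier (F i)"
  by (rule lmodule_homD(1)[OF d_hom])

lemma d_group_hom: "abelian_group_hom (F (Suc i)) (F i) (d (Suc i))"
  by (rule lmodule_hom_imp_abelian_group_hom[OF F.M.abelian_group_axioms F.M.abelian_group_axioms d_hom])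

interpretation d: abelian_group_hom "F (Suc i)" "F i" "d (Suc i)" for i
  by (rule d_group_hom)

lemma augmentation: "\<epsilon> \<in> lmodule_hom ZG (F 0) (trivial_module G)"
  using partial_resolution[of 0] by (simp add: partial_projective_resolution_def)

lemma augmentation_onto: "\<epsilon> ` carrier (F 0) = UNIV"
  using partial_resolution[of 0] by (simp add: partial_projective_resolution_def)

lemma augmentation_group_hom: "abelian_group_hom (F 0) (trivial_module G) \<epsilon>"
  by (rule lmodule_hom_imp_abelian_group_hom[OF F.M.abelian_group_axioms abelian_group_trivial_module augmentation])

interpretation \<epsilon>: abelian_group_hom "F 0" "trivial_module G" \<epsilon>
  by (rule augmentation_group_hom)

lemma exact_0:
  assumes "x \<in> carrier (F 0)"
  shows "x \<in> d (Suc 0) ` carrier (F (Suc 0)) \<longleftrightarrow> \<epsilon> x = 0"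
proof -
  have "d (Suc 0) ` carrier (F (Suc 0)) = a_kernel (F 0) (trivial_module G) \<epsilon>"
    using partial_resolution[of "Suc 0"] by (simp add: partial_projective_resolution_def)
  then show ?thesis using assms by (simp add: a_kernel_def')
qed

lemma exact_Suc:
  assumes "x \<in> carrier (F (Suc i))"
  shows "x \<in> d (Suc (Suc i)) ` carrier (F (Suc (Suc i))) \<longleftrightarrow> d (Suc i) x = \<zero>\<^bsub>F i\<^esub>"
proof -
  have "d (Suc (Suc i)) ` carrier (F (Suc (Suc i))) = a_kernel (F (Suc i)) (F i) (d (Suc i))"
    using partial_resolution[of "Suc (Suc i)"] by (simp add: partial_projective_resolution_def)
  then show ?thesis using assms by (simp add: a_kernel_def')
qed

lemma d_d: "x \<in> carrier (F (Suc (Suc i))) \<Longrightarrow> d (Suc i) (d (Suc (Suc i)) x) = \<zero>\<^bsub>F i\<^esub>"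
  using exact_Suc[OF d_closed] by blast

definition center :: "'g set" where
  "center = {z \<in> carrier G. \<forall>g \<in> carrier G. z \<otimes> g = g \<otimes> z}"

context
  fixes z assumes z: "z \<in> center"
begin

text \<open>The difference of the two chain maps to be compared, the identity and multiplication by
  \<open>z\<close>. A homotopy from it to 0 is constructed degree by degree.\<close>

abbreviation shift :: "nat \<Rightarrow> 'm \<Rightarrow> 'm" where
  "shift i x \<equiv> x \<ominus>\<^bsub>F i\<^esub> frag_of z \<odot>\<^bsub>F i\<^esub> x"

lemma frag_of_z: "frag_of z \<in> carrier ZG"
  using z by (simp add: center_def group_ring_simps)

lemma shift_hom: "shift i \<in> lmodule_hom ZG (F i) (F i)"
  using z by (intro lmodule_hom_diff F_left_module lmodule_hom_id F.central_smult_hom frag_of_z group_ring_central)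
    (auto simp: center_def)

lemma shift_closed: "x \<in> carrier (F i) \<Longrightarrow> shift i x \<in> carrier (F i)"
  by (rule lmodule_homD(1)[OF shift_hom])

lemma d_shift:
  assumes "x \<in> carrier (F (Suc i))"
  shows "d (Suc i) (shift (Suc i) x) = shift i (d (Suc i) x)"
  using assms frag_of_z lmodule_homD(3)[OF d_hom frag_of_z assms] by (simp add: d.hom_minus)

text \<open>Group elements act trivially on the integers, so \<open>shift 0\<close> lands in the
  kernel of \<open>\<epsilon>\<close>, which is the image of the first boundary map; projectivity
  gives the lift.\<close>

lemma homotopy_0:
  "\<exists>h\<in>lmodule_hom ZG (F 0) (F (Suc 0)). \<forall>x\<in>carrier (F 0). d (Suc 0) (h x) = shift 0 x"
proof (rule projective_module_lift[OF projective F_left_module F.M.abelian_group_axioms shift_hom d_hom])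
  have "\<epsilon> (shift 0 x) = 0" if "x \<in> carrier (F 0)" for x
  proof -
    have "\<epsilon> (frag_of z \<odot>\<^bsub>F 0\<^esub> x) = \<epsilon> x"
      using lmodule_homD(3)[OF augmentation frag_of_z that] by simp
    then have "\<epsilon> (shift 0 x) = \<epsilon> x \<ominus>\<^bsub>trivial_module G\<^esub> \<epsilon> x"
      using that frag_of_z by (simp add: \<epsilon>.hom_minus)
    then show ?thesis
      using \<epsilon>.H.r_neg[of "\<epsilon> x"] by (simp add: a_minus_def)
  qed
  then show "shift 0 ` carrier (F 0) \<subseteq> d (Suc 0) ` carrier (F (Suc 0))"
    using exact_0 shift_closed by blast
qed

text \<open>The hypothesis on \<open>h\<close> is precisely what makes
  \<open>shift (Suc i) x \<ominus> h (d (Suc i) x)\<close> a cycle, hence by exactness a boundary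
  that can be lifted.\<close>

lemma homotopy_step:
  assumes h: "h \<in> lmodule_hom ZG (F i) (F (Suc i))"
    and dh: "\<forall>x\<in>carrier (F (Suc i)). d (Suc i) (h (d (Suc i) x)) = shift i (d (Suc i) x)"
  shows "\<exists>h'\<in>lmodule_hom ZG (F (Suc i)) (F (Suc (Suc i))). \<forall>x\<in>carrier (F (Suc i)).
    d (Suc (Suc i)) (h' x) = shift (Suc i) x \<ominus>\<^bsub>F (Suc i)\<^esub> h (d (Suc i) x)"
proof (rule projective_module_lift[OF projective F_left_module F.M.abelian_group_axioms _ d_hom])
  let ?f = "\<lambda>x. shift (Suc i) x \<ominus>\<^bsub>F (Suc i)\<^esub> h (d (Suc i) x)"
  show f: "?f \<in> lmodule_hom ZG (F (Suc i)) (F (Suc i))"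
    by (intro lmodule_hom_diff F_left_module shift_hom lmodule_hom_compose[OF d_hom h])
  have "d (Suc i) (?f x) = \<zero>\<^bsub>F i\<^esub>" if "x \<in> carrier (F (Suc i))" for x
    using that bspec[OF dh that] lmodule_homD(1)[OF h d_closed[OF that]] shift_closed[OF that] shift_closed[OF d_closed[OF that]]
    by (simp add: d.hom_minus d_shift d_closed F.M.r_neg a_minus_def[of _ "shift i _"])
  then show "?f ` carrier (F (Suc i)) \<subseteq> d (Suc (Suc i)) ` carrier (F (Suc (Suc i)))"
    using exact_Suc lmodule_homD(1)[OF f] by blast
qed

text \<open>Restricting the homotopy identity to boundaries removes the term coming from the
  previous degree, since \<open>d\<close> composed with \<open>d\<close> is zero. The induction
  therefore carries a single map instead of a compatible pair.\<close>

lemma homotopy_boundary: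
  "\<exists>h\<in>lmodule_hom ZG (F i) (F (Suc i)).
     \<forall>x\<in>carrier (F (Suc i)). d (Suc i) (h (d (Suc i) x)) = shift i (d (Suc i) x)"
proof (induction i)
  case 0
  then show ?case
    using homotopy_0 d_closed by blast
next
  case (Suc i)
  then obtain h where h: "h \<in> lmodule_hom ZG (F i) (F (Suc i))"
    and dh: "\<forall>x\<in>carrier (F (Suc i)). d (Suc i) (h (d (Suc i) x)) = shift i (d (Suc i) x)"
    by blast
  interpret h: abelian_group_hom "F i" "F (Suc i)" h
    by (rule lmodule_hom_imp_abelian_group_hom[OF F.M.abelian_group_axioms F.M.abelian_group_axioms h])
  obtain h' where h': "h' \<in> lmodule_hom ZG (F (Suc i)) (F (Suc (Suc i)))"
    and dh': "\<forall>x\<in>carrier (F (Suc i)). d (Suc (Suc i)) (h' x) = shift (Suc i) x \<ominus>\<^bsub>F (Suc i)\<^esub> h (d (Suc i) x)"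
    using homotopy_step[OF h dh] by (elim bexE)
  have "d (Suc (Suc i)) (h' (d (Suc (Suc i)) x)) = shift (Suc i) (d (Suc (Suc i)) x)"
    if "x \<in> carrier (F (Suc (Suc i)))" for x
    using bspec[OF dh' d_closed[OF that]] shift_closed[OF d_closed[OF that]]
    by (simp add: d_d[OF that] a_minus_def[of _ _ "\<zero>\<^bsub>F (Suc i)\<^esub>"])
  with h' show ?case by blast
qed

theorem homotopy_Suc:
  "\<exists>h\<in>lmodule_hom ZG (F i) (F (Suc i)). \<exists>h'\<in>lmodule_hom ZG (F (Suc i)) (F (Suc (Suc i))).
     \<forall>x\<in>carrier (F (Suc i)). d (Suc (Suc i)) (h' x) = shift (Suc i) x \<ominus>\<^bsub>F (Suc i)\<^esub> h (d (Suc i) x)"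
  using homotopy_boundary homotopy_step by blast

end

end

text \<open>Conjugation moves the finite family \<open>S\<close> through only finitely many
  families, so infinitely many \<open>g\<close> conjugate it exactly as some fixed \<open>a\<close>
  does. For these, \<open>inv a \<otimes> g\<close> centralizes \<open>S\<close>.\<close>

lemma (in group) infinite_centralizer:
  assumes "FCC_group G" "infinite (carrier G)" "finite S" "S \<subseteq> carrier G"
  shows "infinite {z \<in> carrier G. \<forall>s\<in>S. z \<otimes> s = s \<otimes> z}"
proof -
  define f where "f g = restrict (\<lambda>s. g \<otimes> s \<otimes> inv g) S" for g
  have "f ` carrier G \<subseteq> PiE S (\<lambda>s. {g \<otimes> s \<otimes> inv g | g. g \<in> carrier G})"
    by (auto simp: f_def)
  moreover have "finite (PiE S (\<lambda>s. {g \<otimes> s \<otimes> inv g | g. g \<in> carrier G}))"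
    using assms by (intro finite_PiE) (auto simp: FCC_group_def)
  ultimately have "finite (f ` carrier G)"
    by (rule finite_subset)
  then obtain a where a: "a \<in> carrier G" and inf: "infinite {g \<in> carrier G. f g = f a}"
    using pigeonhole_infinite[OF assms(2)] by blast
  have "(\<lambda>g. inv a \<otimes> g) ` {g \<in> carrier G. f g = f a} \<subseteq> {z \<in> carrier G. \<forall>s\<in>S. z \<otimes> s = s \<otimes> z}"
  proof clarsimp
    fix g assume g: "g \<in> carrier G" "f g = f a"
    show "inv a \<otimes> g \<in> carrier G \<and> (\<forall>s\<in>S. inv a \<otimes> g \<otimes> s = s \<otimes> (inv a \<otimes> g))"
    proof (intro conjI ballI)
      fix s assume "s \<in> S"
      then have s: "s \<in> carrier G" using assms by blast
      have "g \<otimes> s \<otimes> inv g = a \<otimes> s \<otimes> inv a"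
        using fun_cong[OF g(2), of s] \<open>s \<in> S\<close> by (simp add: f_def)
      then have "inv a \<otimes> (g \<otimes> s \<otimes> inv g) \<otimes> g = inv a \<otimes> (a \<otimes> s \<otimes> inv a) \<otimes> g"
        by simp
      moreover have "inv a \<otimes> (a \<otimes> (s \<otimes> (inv a \<otimes> g))) = s \<otimes> (inv a \<otimes> g)"
        using a g s by (simp add: m_assoc[symmetric])
      ultimately show "inv a \<otimes> g \<otimes> s = s \<otimes> (inv a \<otimes> g)"
        using a g s by (simp add: m_assoc)
    qed (use a g in simp)
  qed
  moreover have "inj_on (\<lambda>g. inv a \<otimes> g) {g \<in> carrier G. f g = f a}"
    using a by (auto simp: inj_on_def)
  ultimately show ?thesis
    using inf by (meson finite_imageD finite_subset)
qed

context group_resolution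
begin

interpretation F: left_module ZG "F i" for i
  by (rule F_left_module)

interpretation d: abelian_group_hom "F (Suc i)" "F i" "d (Suc i)" for i
  by (rule d_group_hom)

interpretation \<epsilon>: abelian_group_hom "F 0" "trivial_module G" \<epsilon>
  by (rule augmentation_group_hom)

text \<open>A group of type \<open>FP\<^sub>1\<close> is finitely generated, and a finitely generated FCC group has a
  centre of finite index. Instead of a generating set, the proof uses the finite set \<open>S\<close> of group
  elements occurring in the images in \<open>\<int>[G]\<close> of generators of the kernel of \<open>\<epsilon>\<close>, and shows that
  the bicommutant \<open>H\<close> of \<open>S\<close> is the whole group.\<close>

theorem infinite_center:
  assumes "FCC_group G" "infinite (carrier G)" "finitely_generated_module ZG (F (Suc 0))"
  shows "infinite center"
proof -
  obtain X where X: "finite X" "X \<subseteq> carrier (F (Suc 0))"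
    and gen: "\<And>K. submodule K ZG (F (Suc 0)) \<Longrightarrow> X \<subseteq> K \<Longrightarrow> K = carrier (F (Suc 0))"
    using assms(3) unfolding finitely_generated_module_def by blast
  have surj: "k \<in> frag_sum (\<lambda>_. 1) ` carrier ZG" for k :: int
    using keys_cmul[of k "frag_of \<one>"]
    by (intro image_eqI[of _ _ "frag_cmul k (frag_of \<one>)"]) (auto simp: frag_sum_cmul group_ring_simps)
  \<comment> \<open>Lifting \<open>\<epsilon>\<close> through the augmentation of the group ring
    turns elements of \<open>F 0\<close> into formal sums, whose supports in the group can be
    inspected.\<close>
  obtain \<theta> where \<theta>: "\<theta> \<in> lmodule_hom ZG (F 0) (regular_module ZG)"
    and aug: "\<forall>x\<in>carrier (F 0). frag_sum (\<lambda>_. 1) (\<theta> x) = \<epsilon> x"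
    using projective_module_lift[OF projective F.R.left_module_regular abelian_group_trivial_module augmentation augmentation_hom]
      surj by (auto simp: image_subset_iff)
  have \<theta>_closed: "\<theta> x \<in> carrier ZG" if "x \<in> carrier (F 0)" for x
    using lmodule_homD(1)[OF \<theta> that] by simp
  have \<theta>_add: "\<theta> (x \<oplus>\<^bsub>F 0\<^esub> y) = \<theta> x + \<theta> y" if "x \<in> carrier (F 0)" "y \<in> carrier (F 0)" for x y
    using lmodule_homD(2)[OF \<theta> that] by (simp add: group_ring_simps)
  have \<theta>_smult: "\<theta> (a \<odot>\<^bsub>F 0\<^esub> x) = a \<otimes>\<^bsub>ZG\<^esub> \<theta> x" if "a \<in> carrier ZG" "x \<in> carrier (F 0)" for a x
    using lmodule_homD(3)[OF \<theta> that] by simp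
  obtain x0 where x0: "x0 \<in> carrier (F 0)" "\<epsilon> x0 = 1"
    using augmentation_onto by (metis UNIV_I imageE)
  \<comment> \<open>The support of \<open>\<theta> x0\<close> is included because this element is
    only known to have augmentation 1; it stands in for the unit of the group ring in the final
    comparison.\<close>
  define S where "S = Poly_Mapping.keys (\<theta> x0) \<union> (\<Union>x\<in>X. Poly_Mapping.keys (\<theta> (d (Suc 0) x)))"
  have S: "finite S" "S \<subseteq> carrier G"
    using X \<theta>_closed[OF x0(1)] \<theta>_closed[OF d_closed] unfolding S_def group_ring_simps by auto
  define C where "C = {z \<in> carrier G. \<forall>s\<in>S. z \<otimes> s = s \<otimes> z}"
  define H where "H = {g \<in> carrier G. \<forall>z\<in>C. z \<otimes> g = g \<otimes> z}"
  have C: "infinite C"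
    unfolding C_def by (rule infinite_centralizer[OF assms(1,2) S])
  have SH: "S \<subseteq> H"
    using S by (auto simp: H_def C_def)
  have H_mult: "g \<otimes> s \<in> H \<longleftrightarrow> g \<in> H" if g: "g \<in> carrier G" and s: "s \<in> H" for g s
  proof -
    have "z \<otimes> (g \<otimes> s) = (g \<otimes> s) \<otimes> z \<longleftrightarrow> z \<otimes> g = g \<otimes> z" if "z \<in> C" for z
    proof -
      have c: "z \<in> carrier G" "s \<in> carrier G" "z \<otimes> s = s \<otimes> z"
        using that s by (auto simp: C_def H_def)
      then have "(g \<otimes> s) \<otimes> z = (g \<otimes> z) \<otimes> s"
        using g by (simp add: m_assoc)
      then show ?thesis
        using c g by (simp add: m_assoc[symmetric])
    qed
    then show ?thesis
      using g s by (auto simp: H_def)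
  qed
  \<comment> \<open>\<open>\<psi>\<close> adds up the coefficients on \<open>H\<close>. Right
    multiplication by an element of \<open>H\<close> preserves membership in \<open>H\<close> and in
    its complement, so a right factor supported in \<open>H\<close> contributes just its
    augmentation.\<close>
  define \<psi> where "\<psi> = frag_sum (\<lambda>g. if g \<in> H then 1 else 0 :: int)"
  have \<psi>_mult: "\<psi> (a \<otimes>\<^bsub>ZG\<^esub> b) = \<psi> a * frag_sum (\<lambda>_. 1) b"
    if a: "a \<in> carrier ZG" and b: "Poly_Mapping.keys b \<subseteq> H" for a b
  proof -
    have "\<psi> (a \<otimes>\<^bsub>ZG\<^esub> b) = frag_sum (\<lambda>g. frag_sum (\<lambda>h. if g \<otimes> h \<in> H then 1 else 0) b) a"
      by (simp add: \<psi>_def frag_sum_group_ring_mult)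
    also have "\<dots> = frag_sum (\<lambda>g. frag_sum (\<lambda>_. 1) b * (if g \<in> H then 1 else 0)) a"
    proof (rule frag_sum_cong)
      fix g assume "g \<in> Poly_Mapping.keys a"
      then have g: "g \<in> carrier G" using a by (auto simp: group_ring_simps)
      have "frag_sum (\<lambda>h. if g \<otimes> h \<in> H then 1 else 0) b = frag_sum (\<lambda>h. if g \<in> H then 1 else 0 :: int) b"
        using b H_mult[OF g] by (intro frag_sum_cong) auto
      then show "frag_sum (\<lambda>h. if g \<otimes> h \<in> H then 1 else 0) b = frag_sum (\<lambda>_. 1) b * (if g \<in> H then 1 else 0 :: int)"
        by (cases "g \<in> H") simp_all
    qed
    finally show ?thesis
      by (simp add: frag_sum_cmult \<psi>_def mult.commute)
  qed
  have \<psi>_add: "\<psi> (a + b) = \<psi> a + \<psi> b" for a b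
    by (simp add: \<psi>_def frag_sum_add)
  \<comment> \<open>\<open>\<psi>\<close> is additive but need not respect left multiplication;
    demanding that it vanish on all left multiples makes \<open>K\<close> a submodule. The
    generators lie in it because their images are supported in \<open>H\<close> and have
    augmentation 0.\<close>
  define K where "K = {y \<in> carrier (F (Suc 0)). \<forall>a\<in>carrier ZG. \<psi> (a \<otimes>\<^bsub>ZG\<^esub> \<theta> (d (Suc 0) y)) = 0}"
  have \<theta>d: "\<theta> (d (Suc 0) y) \<in> carrier ZG" if "y \<in> carrier (F (Suc 0))" for y
    using that by (intro \<theta>_closed d_closed)
  have K_add: "x \<oplus>\<^bsub>F (Suc 0)\<^esub> y \<in> K" if "x \<in> K" "y \<in> K" for x y
  proof -
    have xy: "x \<in> carrier (F (Suc 0))" "y \<in> carrier (F (Suc 0))"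
      using that by (auto simp: K_def)
    have "\<psi> (a \<otimes>\<^bsub>ZG\<^esub> \<theta> (d (Suc 0) (x \<oplus>\<^bsub>F (Suc 0)\<^esub> y))) = 0" if a: "a \<in> carrier ZG" for a
    proof -
      have "a \<otimes>\<^bsub>ZG\<^esub> \<theta> (d (Suc 0) (x \<oplus>\<^bsub>F (Suc 0)\<^esub> y)) = a \<otimes>\<^bsub>ZG\<^esub> \<theta> (d (Suc 0) x) + a \<otimes>\<^bsub>ZG\<^esub> \<theta> (d (Suc 0) y)"
        using F.R.r_distr[OF \<theta>d[OF xy(1)] \<theta>d[OF xy(2)] a] xy
        by (simp add: \<theta>_add d_closed group_ring_simps)
      then show ?thesis
        using \<open>x \<in> K\<close> \<open>y \<in> K\<close> a by (simp add: \<psi>_add K_def)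
    qed
    then show ?thesis using xy by (simp add: K_def)
  qed
  have K_smult: "b \<odot>\<^bsub>F (Suc 0)\<^esub> x \<in> K" if b: "b \<in> carrier ZG" and "x \<in> K" for b x
  proof -
    have x: "x \<in> carrier (F (Suc 0))" using that by (simp add: K_def)
    have "\<psi> (a \<otimes>\<^bsub>ZG\<^esub> \<theta> (d (Suc 0) (b \<odot>\<^bsub>F (Suc 0)\<^esub> x))) = 0" if a: "a \<in> carrier ZG" for a
    proof -
      have "a \<otimes>\<^bsub>ZG\<^esub> \<theta> (d (Suc 0) (b \<odot>\<^bsub>F (Suc 0)\<^esub> x)) = (a \<otimes>\<^bsub>ZG\<^esub> b) \<otimes>\<^bsub>ZG\<^esub> \<theta> (d (Suc 0) x)"
        using F.R.m_assoc[OF a b \<theta>d[OF x]] b x lmodule_homD(3)[OF d_hom b x] by (simp add: \<theta>_smult d_closed)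
      then show ?thesis
        using \<open>x \<in> K\<close> F.R.m_closed[OF a b] by (simp add: K_def)
    qed
    then show ?thesis using x b by (simp add: K_def)
  qed
  have K_sub: "K \<subseteq> carrier (F (Suc 0))" by (auto simp: K_def)
  have K_zero: "\<zero>\<^bsub>F (Suc 0)\<^esub> \<in> K"
  proof -
    have "\<theta> \<zero>\<^bsub>F 0\<^esub> = \<theta> \<zero>\<^bsub>F 0\<^esub> + \<theta> \<zero>\<^bsub>F 0\<^esub>"
      using \<theta>_add[of "\<zero>\<^bsub>F 0\<^esub>" "\<zero>\<^bsub>F 0\<^esub>"] by simp
    then have "\<theta> \<zero>\<^bsub>F 0\<^esub> = 0" by simp
    moreover have "a \<otimes>\<^bsub>ZG\<^esub> 0 = 0" if "a \<in> carrier ZG" for a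
      using F.R.r_null[OF that] by (simp add: group_ring_simps)
    ultimately show ?thesis by (simp add: K_def \<psi>_def)
  qed
  have K_inv: "\<ominus>\<^bsub>F (Suc 0)\<^esub> x \<in> K" if "x \<in> K" for x
  proof -
    have x: "x \<in> carrier (F (Suc 0))" using that K_sub by blast
    have "\<ominus>\<^bsub>F (Suc 0)\<^esub> x = (\<ominus>\<^bsub>ZG\<^esub> \<one>\<^bsub>ZG\<^esub>) \<odot>\<^bsub>F (Suc 0)\<^esub> x"
      using x F.smult_l_distr[of "\<ominus>\<^bsub>ZG\<^esub> \<one>\<^bsub>ZG\<^esub>" "\<one>\<^bsub>ZG\<^esub>" x "Suc 0"]
      by (intro F.M.minus_equality) (simp_all add: F.smult_one F.R.l_neg)
    then show ?thesis using K_smult[OF _ that, of "\<ominus>\<^bsub>ZG\<^esub> \<one>\<^bsub>ZG\<^esub>"] by simp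
  qed
  have "submodule K ZG (F (Suc 0))"
    using K_add K_smult K_sub K_zero K_inv
    by (auto simp: submodule_def submodule_axioms_def subgroup_def a_inv_def)
  moreover have "X \<subseteq> K"
  proof
    fix x assume "x \<in> X"
    then have x: "x \<in> carrier (F (Suc 0))" using X by blast
    have "Poly_Mapping.keys (\<theta> (d (Suc 0) x)) \<subseteq> H"
      using \<open>x \<in> X\<close> SH by (auto simp: S_def)
    moreover have "\<epsilon> (d (Suc 0) x) = 0"
      using exact_0[OF d_closed[OF x]] x by blast
    ultimately show "x \<in> K"
      using x by (simp add: K_def \<psi>_mult aug d_closed)
  qed
  ultimately have K: "K = carrier (F (Suc 0))" by (rule gen)
  have keys_x0: "Poly_Mapping.keys (\<theta> x0) \<subseteq> H" using SH by (auto simp: S_def)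
  have "g \<in> H" if g: "g \<in> carrier G" for g
  proof -
    have fg: "frag_of g \<in> carrier ZG" using g by (simp add: group_ring_simps)
    \<comment> \<open>This element has augmentation 0, so it is a boundary and
      \<open>\<psi> (\<theta> u) = 0\<close>. As \<open>\<theta> x0\<close> is supported in
      \<open>H\<close> with augmentation 1, this says that \<open>\<psi>\<close> takes the same
      value on \<open>g\<close> as on the unit, namely 1, so \<open>g\<close> lies in
      \<open>H\<close>.\<close>
    define u where "u = frag_of g \<odot>\<^bsub>F 0\<^esub> x0 \<ominus>\<^bsub>F 0\<^esub> x0"
    have gx: "frag_of g \<odot>\<^bsub>F 0\<^esub> x0 \<in> carrier (F 0)"
      using fg x0 by simp
    then have u: "u \<in> carrier (F 0)" using x0 by (simp add: u_def)
    have ux: "u \<oplus>\<^bsub>F 0\<^esub> x0 = frag_of g \<odot>\<^bsub>F 0\<^esub> x0"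
      using gx x0 by (simp add: u_def a_minus_def F.M.a_assoc F.M.l_neg)
    have "\<epsilon> u + \<epsilon> x0 = \<epsilon> x0"
      using \<epsilon>.hom_add[OF u x0(1)] lmodule_homD(3)[OF augmentation fg x0(1)] by (simp add: ux)
    then have "u \<in> d (Suc 0) ` carrier (F (Suc 0))"
      using exact_0[OF u] by simp
    then obtain y where y: "y \<in> K" "u = d (Suc 0) y" unfolding K by blast
    have "\<psi> (\<one>\<^bsub>ZG\<^esub> \<otimes>\<^bsub>ZG\<^esub> \<theta> u) = 0"
      using y F.R.one_closed unfolding K_def by blast
    then have "\<psi> (\<theta> u) = 0"
      using \<theta>_closed[OF u] by simp
    then have "\<psi> (\<theta> (frag_of g \<odot>\<^bsub>F 0\<^esub> x0)) = \<psi> (\<theta> x0)"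
      using \<theta>_add[OF u x0(1)] by (simp add: ux \<psi>_add)
    moreover have "\<psi> (\<theta> (frag_of g \<odot>\<^bsub>F 0\<^esub> x0)) = \<psi> (frag_of g)"
      using \<psi>_mult[OF fg keys_x0] x0 by (simp add: \<theta>_smult[OF fg] aug)
    moreover have "\<psi> (\<theta> x0) = \<psi> (frag_of \<one>)"
      using \<psi>_mult[OF F.R.one_closed keys_x0] x0 \<theta>_closed[OF x0(1)] by (simp add: aug) (simp add: group_ring_simps)
    moreover have "\<one> \<in> H" by (auto simp: H_def C_def)
    ultimately show ?thesis by (simp add: \<psi>_def split: if_splits)
  qed
  \<comment> \<open>Elements of \<open>C\<close> commute with \<open>H\<close> by definition of
    \<open>H\<close>, which is now the whole group.\<close>
  then have "C \<subseteq> center"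
    by (auto simp: center_def H_def C_def)
  then show ?thesis
    using C finite_subset by blast
qed

end

section \<open>Tensor products with \<open>l\<^sup>p(G)\<close>\<close>

lemma lp_module_smult:
  "a \<odot>\<^bsub>lp_module p G\<^esub> f =
     (\<lambda>h. if h \<in> carrier G then frag_sum (\<lambda>g. f (inv\<^bsub>G\<^esub> g \<otimes>\<^bsub>G\<^esub> h)) a else 0)"
  unfolding lp_module_def frag_sum_def by simp

context group
begin

lemma lp_module_smult_closed:
  assumes "p \<ge> 1" "a \<in> carrier ZG" "f \<in> carrier (lp_module p G)"
  shows "a \<odot>\<^bsub>lp_module p G\<^esub> f \<in> carrier (lp_module p G)"
proof -
  have "a \<odot>\<^bsub>lp_module p G\<^esub> f =
      (\<lambda>h. \<Sum>g\<in>Poly_Mapping.keys a. of_int (Poly_Mapping.lookup a g) * lp_translate G (inv g) f h)"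
    by (auto simp: lp_module_smult frag_sum_def lp_translate_def fun_eq_iff)
  also have "\<dots> \<in> carrier (lp_module p G)"
    using assms by (intro lp_module_sum_closed lp_module_scale_closed lp_translate_closed)
      (auto simp: group_ring_simps)
  finally show ?thesis .
qed

text \<open>Evaluation of formal sums against functions is a pairing for which multiplication by the
  involution of \<open>a\<close> on one side is adjoint to the action of \<open>a\<close> on the
  other. This is the balancing condition that a tensor product imposes.\<close>

lemma frag_sum_involution_mult:
  assumes "a \<in> carrier ZG" "b \<in> carrier ZG"
  shows "frag_sum l (group_ring_involution G a \<otimes>\<^bsub>ZG\<^esub> b) = frag_sum (a \<odot>\<^bsub>lp_module p G\<^esub> l) b"
proof -
  have "frag_sum l (group_ring_involution G a \<otimes>\<^bsub>ZG\<^esub> b)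
      = frag_sum (\<lambda>h. frag_sum (\<lambda>g. l (inv g \<otimes> h)) a) b"
    by (simp add: frag_sum_group_ring_mult frag_sum_involution frag_sum_swap[of _ b])
  also have "\<dots> = frag_sum (a \<odot>\<^bsub>lp_module p G\<^esub> l) b"
    using assms by (intro frag_sum_cong) (auto simp: lp_module_smult group_ring_simps)
  finally show ?thesis .
qed

lemma involution_smult:
  assumes "a \<in> carrier ZG" 
  shows "group_ring_involution G a \<odot>\<^bsub>lp_module p G\<^esub> l =
    (\<lambda>h. if h \<in> carrier G then frag_sum (\<lambda>g. l (g \<otimes> h)) a else 0)"
proof
  fix h
  have "frag_sum (\<lambda>g. l (inv (inv g) \<otimes> h)) a = frag_sum (\<lambda>g. l (g \<otimes> h)) a"
    using assms by (intro frag_sum_cong) (auto simp: group_ring_simps subset_iff)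
  then show "(group_ring_involution G a \<odot>\<^bsub>lp_module p G\<^esub> l) h =
      (if h \<in> carrier G then frag_sum (\<lambda>g. l (g \<otimes> h)) a else 0)"
    by (simp add: lp_module_smult frag_sum_involution)
qed

lemma group_ring_involution_involution:
  assumes "a \<in> carrier ZG"
  shows "group_ring_involution G (group_ring_involution G a) = a"
proof -
  have "group_ring_involution G (group_ring_involution G a)
      = frag_extend ((\<lambda>g. frag_of (inv g)) \<circ> (\<lambda>g. inv g)) a"
    unfolding group_ring_involution_def
    using frag_extend_compose[of "\<lambda>g. frag_of (inv g)" "\<lambda>g. inv g" a] by (simp add: comp_def)
  also have "\<dots> = frag_extend frag_of a"
    using assms by (intro frag_extend_eq) (auto simp: group_ring_simps subset_iff)
  also have "\<dots> = a" by (rule frag_expansion[symmetric])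
  finally show ?thesis .
qed

end

text \<open>For a functional \<open>\<phi>\<close>, tensoring with \<open>l\<^sup>p(G)\<close> gives
  a map from the tensor product over \<open>M\<close> to that over the group ring, which is
  \<open>l\<^sup>p(G)\<close> itself. The pairing is the value of the resulting function at the unit
  of the group.\<close>

definition tensor_pairing :: "('m \<Rightarrow> 'g \<Rightarrow>\<^sub>0 int) \<Rightarrow> ('m \<times> ('g \<Rightarrow> complex) \<Rightarrow>\<^sub>0 int) \<Rightarrow> complex" where
  "tensor_pairing \<phi> = frag_sum (\<lambda>(x, l). frag_sum l (\<phi> x))"

lemma tensor_pairing_of [simp]: "tensor_pairing \<phi> (frag_of (x, l)) = frag_sum l (\<phi> x)"
  by (simp add: tensor_pairing_def)

lemma tensor_pairing_simps [simp]:
  "tensor_pairing \<phi> 0 = 0"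
  "tensor_pairing \<phi> (c + c') = tensor_pairing \<phi> c + tensor_pairing \<phi> c'"
  "tensor_pairing \<phi> (c - c') = tensor_pairing \<phi> c - tensor_pairing \<phi> c'"
  "tensor_pairing \<phi> (- c) = - tensor_pairing \<phi> c"
  "tensor_pairing \<phi> (sum f K) = (\<Sum>k\<in>K. tensor_pairing \<phi> (f k))"
  by (simp_all add: tensor_pairing_def frag_sum_add frag_sum_diff frag_sum_uminus frag_sum_sum)

lemma tensor_pairing_extend:
  "tensor_pairing \<phi> (frag_extend (\<lambda>(x, y). frag_of (h x, y)) c) = tensor_pairing (\<lambda>x. \<phi> (h x)) c"
  by (simp add: tensor_pairing_def frag_sum_extend split_def)

lemma tensor_pairing_cong:
  assumes "Poly_Mapping.keys c \<subseteq> A \<times> B" "\<And>x. x \<in> A \<Longrightarrow> \<phi> x = \<psi> x"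
  shows "tensor_pairing \<phi> c = tensor_pairing \<psi> c"
  unfolding tensor_pairing_def using assms by (intro frag_sum_cong) auto

locale lp_tensor = group G + M: left_module "group_ring G" M
  for G :: "('g, 'x) monoid_scheme" (structure) and M :: "('g \<Rightarrow>\<^sub>0 int, 'm) module" +
  fixes p :: real
  assumes p: "p \<ge> 1"
begin

abbreviation L :: "('g \<Rightarrow>\<^sub>0 int, 'g \<Rightarrow> complex) module" where "L \<equiv> lp_module p G"

abbreviation Fr :: "('m \<times> ('g \<Rightarrow> complex) \<Rightarrow>\<^sub>0 int) monoid" where
  "Fr \<equiv> free_Abelian_group (carrier M \<times> carrier L)"

abbreviation Rel :: "('m \<times> ('g \<Rightarrow> complex) \<Rightarrow>\<^sub>0 int) set" where
  "Rel \<equiv> tensor_relations G M L"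

abbreviation functionals :: "('m \<Rightarrow> 'g \<Rightarrow>\<^sub>0 int) set" where
  "functionals \<equiv> lmodule_hom ZG M (regular_module ZG)"

interpretation Fr: comm_group Fr
  by (rule abelian_free_Abelian_group)

lemma frag_of_minus_closed:
  "a \<in> S \<Longrightarrow> b \<in> S \<Longrightarrow> c \<in> S \<Longrightarrow> Poly_Mapping.keys (frag_of a - frag_of b - frag_of c) \<subseteq> S"
  "a \<in> S \<Longrightarrow> b \<in> S \<Longrightarrow> Poly_Mapping.keys (frag_of a - frag_of b) \<subseteq> S"
  using keys_diff[of "frag_of a - frag_of b" "frag_of c"] keys_diff[of "frag_of a" "frag_of b"]
  by auto

lemma lp_add: "f \<in> carrier L \<Longrightarrow> f' \<in> carrier L \<Longrightarrow> (\<lambda>g. f g + f' g) \<in> carrier L"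
  by (rule lp_module_add_closed[OF p])

lemma lp_smult: "a \<in> carrier ZG \<Longrightarrow> f \<in> carrier L \<Longrightarrow> a \<odot>\<^bsub>L\<^esub> f \<in> carrier L"
  by (rule lp_module_smult_closed[OF p])

lemma relators_closed:
  "x \<in> carrier M \<Longrightarrow> x' \<in> carrier M \<Longrightarrow> y \<in> carrier L \<Longrightarrow>
     frag_of (x \<oplus>\<^bsub>M\<^esub> x', y) - frag_of (x, y) - frag_of (x', y) \<in> carrier Fr"
  "x \<in> carrier M \<Longrightarrow> y \<in> carrier L \<Longrightarrow> y' \<in> carrier L \<Longrightarrow>
     frag_of (x, y \<oplus>\<^bsub>L\<^esub> y') - frag_of (x, y) - frag_of (x, y') \<in> carrier Fr"
  "a \<in> carrier ZG \<Longrightarrow> x \<in> carrier M \<Longrightarrow> y \<in> carrier L \<Longrightarrow>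
     frag_of (group_ring_involution G a \<odot>\<^bsub>M\<^esub> x, y) - frag_of (x, a \<odot>\<^bsub>L\<^esub> y) \<in> carrier Fr"
  unfolding carrier_free_Abelian_group_iff
  by (rule frag_of_minus_closed; simp add: lp_add lp_smult group_ring_involution_closed)+

lemma relators_subset:
  assumes "\<And>x x' y. x \<in> carrier M \<Longrightarrow> x' \<in> carrier M \<Longrightarrow> y \<in> carrier L \<Longrightarrow>
      frag_of (x \<oplus>\<^bsub>M\<^esub> x', y) - frag_of (x, y) - frag_of (x', y) \<in> K"
    and "\<And>x y y'. x \<in> carrier M \<Longrightarrow> y \<in> carrier L \<Longrightarrow> y' \<in> carrier L \<Longrightarrow>
      frag_of (x, y \<oplus>\<^bsub>L\<^esub> y') - frag_of (x, y) - frag_of (x, y') \<in> K"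
    and "\<And>a x y. a \<in> carrier ZG \<Longrightarrow> x \<in> carrier M \<Longrightarrow> y \<in> carrier L \<Longrightarrow>
      frag_of (group_ring_involution G a \<odot>\<^bsub>M\<^esub> x, y) - frag_of (x, a \<odot>\<^bsub>L\<^esub> y) \<in> K"
    and "subgroup K Fr"
  shows "Rel \<subseteq> K"
  unfolding tensor_relations_def
  by (rule Fr.generate_subgroup_incl[OF _ assms(4)], intro Un_least subsetI; elim CollectE exE conjE)
    (simp_all only: assms(1-3))

lemma Rel_subgroup: "subgroup Rel Fr"
  unfolding tensor_relations_def
  by (rule Fr.generate_is_subgroup, intro Un_least subsetI; elim CollectE exE conjE)
    (simp_all only: relators_closed)

lemma Rel_carrier: "c \<in> Rel \<Longrightarrow> Poly_Mapping.keys c \<subseteq> carrier M \<times> carrier L"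
  using subgroup.mem_carrier[OF Rel_subgroup] by simp

lemma Rel_zero [simp]: "0 \<in> Rel"
  using subgroup.one_closed[OF Rel_subgroup] by simp

lemma Rel_add: "c \<in> Rel \<Longrightarrow> c' \<in> Rel \<Longrightarrow> c + c' \<in> Rel"
  using subgroup.m_closed[OF Rel_subgroup] by simp

lemma Rel_uminus: "c \<in> Rel \<Longrightarrow> - c \<in> Rel"
  using subgroup.m_inv_closed[OF Rel_subgroup] Rel_carrier by fastforce

lemma Rel_diff: "c \<in> Rel \<Longrightarrow> c' \<in> Rel \<Longrightarrow> c - c' \<in> Rel"
  using Rel_add[OF _ Rel_uminus] by fastforce

lemma Rel_sum: "(\<And>k. k \<in> K \<Longrightarrow> f k \<in> Rel) \<Longrightarrow> sum f K \<in> Rel"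
  by (induction K rule: infinite_finite_induct) (auto intro: Rel_add)

lemma Rel_add_left:
  assumes "x \<in> carrier M" "x' \<in> carrier M" "y \<in> carrier L"
  shows "frag_of (x \<oplus>\<^bsub>M\<^esub> x', y) - frag_of (x, y) - frag_of (x', y) \<in> Rel"
  unfolding tensor_relations_def by (rule generate.incl) (use assms in blast)

lemma Rel_add_right:
  assumes "x \<in> carrier M" "y \<in> carrier L" "y' \<in> carrier L"
  shows "frag_of (x, \<lambda>g. y g + y' g) - frag_of (x, y) - frag_of (x, y') \<in> Rel"
proof -
  have "frag_of (x, y \<oplus>\<^bsub>L\<^esub> y') - frag_of (x, y) - frag_of (x, y') \<in> Rel"
    unfolding tensor_relations_def by (rule generate.incl) (use assms in blast)
  then show ?thesis by simp
qed

lemma Rel_smult: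
  assumes "x \<in> carrier M" "a \<in> carrier ZG" "y \<in> carrier L"
  shows "frag_of (a \<odot>\<^bsub>M\<^esub> x, y) - frag_of (x, group_ring_involution G a \<odot>\<^bsub>L\<^esub> y) \<in> Rel"
proof -
  have "frag_of (group_ring_involution G (group_ring_involution G a) \<odot>\<^bsub>M\<^esub> x, y)
      - frag_of (x, group_ring_involution G a \<odot>\<^bsub>L\<^esub> y) \<in> Rel"
    unfolding tensor_relations_def
    by (rule generate.incl) (use assms group_ring_involution_closed in blast)
  then show ?thesis
    using assms by (simp add: group_ring_involution_involution)
qed

lemma functional_closed: "\<phi> \<in> functionals \<Longrightarrow> x \<in> carrier M \<Longrightarrow> \<phi> x \<in> carrier ZG"
  using lmodule_homD(1)[of \<phi> ZG M "regular_module ZG" x] by simp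

text \<open>The pairing is additive in both entries, and it is balanced by the adjunction
  \<open>frag_sum_involution_mult\<close>, so its kernel is a subgroup containing all generators of
  the relations.\<close>

lemma tensor_pairing_Rel:
  assumes "\<phi> \<in> functionals" "c \<in> Rel"
  shows "tensor_pairing \<phi> c = 0"
proof -
  let ?K = "{c \<in> carrier Fr. tensor_pairing \<phi> c = 0}"
  have "subgroup ?K Fr"
  proof (rule Fr.subgroupI)
    show "c \<otimes>\<^bsub>Fr\<^esub> c' \<in> ?K" if "c \<in> ?K" "c' \<in> ?K" for c c'
      using that keys_add[of c c'] by auto
    show "inv\<^bsub>Fr\<^esub> c \<in> ?K" if "c \<in> ?K" for c
      using that by simp
    show "?K \<noteq> {}" by (auto intro!: exI[of _ 0])
  qed auto
  moreover have "\<phi> (x \<oplus>\<^bsub>M\<^esub> x') = \<phi> x + \<phi> x'" if "x \<in> carrier M" "x' \<in> carrier M" for x x'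
    using lmodule_homD(2)[OF assms(1) that] by (simp add: group_ring_simps)
  moreover have "frag_sum y (\<phi> (group_ring_involution G a \<odot>\<^bsub>M\<^esub> x)) = frag_sum (a \<odot>\<^bsub>L\<^esub> y) (\<phi> x)"
    if "a \<in> carrier ZG" "x \<in> carrier M" for a x y
    using lmodule_homD(3)[OF assms(1) group_ring_involution_closed[OF that(1)] that(2)]
      frag_sum_involution_mult[OF that(1) functional_closed[OF assms(1) that(2)]] by simp
  ultimately have "Rel \<subseteq> ?K"
    by (intro relators_subset CollectI conjI relators_closed) (simp_all add: frag_sum_add frag_sum_add_fun)
  then show ?thesis using assms(2) by blast
qed

lemma frag_of_zero_left: "y \<in> carrier L \<Longrightarrow> frag_of (\<zero>\<^bsub>M\<^esub>, y) \<in> Rel"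
  using Rel_uminus[OF Rel_add_left[of "\<zero>\<^bsub>M\<^esub>" "\<zero>\<^bsub>M\<^esub>" y]] by simp

lemma frag_of_zero_right: "x \<in> carrier M \<Longrightarrow> frag_of (x, \<lambda>g. 0) \<in> Rel"
  using Rel_uminus[OF Rel_add_right[of x "\<lambda>g. 0" "\<lambda>g. 0"]] by simp

lemma frag_of_finsum_left:
  assumes "f \<in> B \<rightarrow> carrier M" "y \<in> carrier L"
  shows "frag_of (finsum M f B, y) - (\<Sum>b\<in>B. frag_of (f b, y)) \<in> Rel"
  using assms(1)
proof (induction B rule: infinite_finite_induct)
  case (insert b B)
  have "frag_of (f b \<oplus>\<^bsub>M\<^esub> finsum M f B, y) - frag_of (f b, y) - frag_of (finsum M f B, y)
      + (frag_of (finsum M f B, y) - (\<Sum>b\<in>B. frag_of (f b, y))) \<in> Rel"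
    using insert assms(2) by (intro Rel_add Rel_add_left) auto
  then show ?case
    using insert by (simp add: algebra_simps)
qed (use assms(2) frag_of_zero_left in simp_all)

lemma frag_of_diff_right:
  assumes "x \<in> carrier M" "y \<in> carrier L" "y' \<in> carrier L"
  shows "frag_of (x, \<lambda>g. y g - y' g) - (frag_of (x, y) - frag_of (x, y')) \<in> Rel"
  using Rel_uminus[OF Rel_add_right[OF assms(1) lp_module_diff_closed[OF p assms(2,3)] assms(3)]]
  by (simp add: algebra_simps)

end

text \<open>Over a projective module the relations are exactly what all functionals \<open>M \<rightarrow> \<int>[G]\<close>
  annihilate: modulo relations, an element is the sum of the tensors of the vectors \<open>e b\<close> of a dual
  basis with functions whose values are given by the pairings with functionals.\<close>

theorem (in lp_tensor) tensor_relations_iff: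
  assumes "projective_module ZG M"
  shows "c \<in> Rel \<longleftrightarrow> Poly_Mapping.keys c \<subseteq> carrier M \<times> carrier L \<and> (\<forall>\<phi>\<in>functionals. tensor_pairing \<phi> c = 0)"
proof (intro iffI conjI ballI)
  assume c: "Poly_Mapping.keys c \<subseteq> carrier M \<times> carrier L \<and> (\<forall>\<phi>\<in>functionals. tensor_pairing \<phi> c = 0)"
  obtain X :: "'m set" and \<phi> e where db: "dual_basis ZG M X \<phi> e"
    using projective_module_dual_basis[OF assms] by blast
  note R = M.R.ring_axioms
  have \<phi>: "\<phi> b \<in> functionals" "e b \<in> carrier M" if "b \<in> X" for b
    using dual_basis_functional[OF R db that] dual_basis_vector[OF R db that] .
  have fin: "finite {b \<in> X. \<phi> b x \<noteq> \<zero>\<^bsub>ZG\<^esub>}" if "x \<in> carrier M" for x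
    using dual_basis_finite[OF R db that] .
  \<comment> \<open>All dual basis indices occurring anywhere in \<open>c\<close>, fixed in advance
    so that every formal sum met in the induction is expanded over the same finite set.\<close>
  define B where "B = (\<Union>q\<in>Poly_Mapping.keys c. {b \<in> X. \<phi> b (fst q) \<noteq> \<zero>\<^bsub>ZG\<^esub>})"
  have B: "finite B" "B \<subseteq> X"
    using fin c by (auto simp: B_def)
  \<comment> \<open>The coefficient function that belongs to \<open>e b\<close>: after expanding
    \<open>x\<close>, the coordinate \<open>\<phi> b x\<close> crosses the tensor sign as its
    involution and acts on \<open>l\<close>.\<close>
  define \<Lambda> where "\<Lambda> b c' h = (if h \<in> carrier G then frag_sum (\<lambda>(x, l). frag_sum (\<lambda>g. l (g \<otimes> h)) (\<phi> b x)) c' else 0 :: complex)"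
    for b c' h
  have \<Lambda>_of: "\<Lambda> b (frag_of (x, l)) = group_ring_involution G (\<phi> b x) \<odot>\<^bsub>L\<^esub> l" if "b \<in> X" "x \<in> carrier M" for b x l
    using functional_closed[OF \<phi>(1)[OF that(1)] that(2)] by (simp add: \<Lambda>_def involution_smult fun_eq_iff)
  have main: "(\<forall>b\<in>B. \<Lambda> b c' \<in> carrier L) \<and> c' - (\<Sum>b\<in>B. frag_of (e b, \<Lambda> b c')) \<in> Rel"
    if "Poly_Mapping.keys c' \<subseteq> Poly_Mapping.keys c" for c'
    using that
  proof (induction c' rule: frag_induction)
    case zero
    have "\<Lambda> b 0 = (\<lambda>h. 0)" for b by (simp add: \<Lambda>_def fun_eq_iff)
    moreover have "(\<Sum>b\<in>B. frag_of (e b, \<lambda>h. 0)) \<in> Rel"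
      using B \<phi>(2) by (intro Rel_sum frag_of_zero_right) blast
    ultimately show ?case
      using Rel_uminus by simp
  next
    case (one q)
    obtain x l where q: "q = (x, l)" by (cases q)
    have x: "x \<in> carrier M" and l: "l \<in> carrier L"
      using one c unfolding q by blast+
    have \<phi>x: "\<phi> b x \<in> carrier ZG" if "b \<in> B" for b
      using functional_closed[OF \<phi>(1) x] that B by blast
    have eB: "e b \<in> carrier M" if "b \<in> B" for b
      using \<phi>(2) that B by blast
    have \<Lambda>B: "\<Lambda> b (frag_of (x, l)) = group_ring_involution G (\<phi> b x) \<odot>\<^bsub>L\<^esub> l" if "b \<in> B" for b
      using \<Lambda>_of x that B by blast
    have cl: "\<Lambda> b (frag_of (x, l)) \<in> carrier L" if "b \<in> B" for b
      using that l by (simp add: \<Lambda>B lp_smult group_ring_involution_closed \<phi>x)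
    have "{b \<in> X. \<phi> b x \<noteq> \<zero>\<^bsub>ZG\<^esub>} \<subseteq> B"
      using one q unfolding B_def by force
    then have "x = (\<Oplus>\<^bsub>M\<^esub>b\<in>B. \<phi> b x \<odot>\<^bsub>M\<^esub> e b)"
      by (rule dual_basis_expansion[OF R db M.left_module_axioms x B])
    then have 1: "frag_of (x, l) - (\<Sum>b\<in>B. frag_of (\<phi> b x \<odot>\<^bsub>M\<^esub> e b, l)) \<in> Rel"
      using frag_of_finsum_left[of "\<lambda>b. \<phi> b x \<odot>\<^bsub>M\<^esub> e b" B l] \<phi>x eB l by (auto simp: Pi_iff)
    have 2: "(\<Sum>b\<in>B. frag_of (\<phi> b x \<odot>\<^bsub>M\<^esub> e b, l) - frag_of (e b, \<Lambda> b (frag_of (x, l)))) \<in> Rel"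
    proof (rule Rel_sum)
      fix b assume "b \<in> B"
      then show "frag_of (\<phi> b x \<odot>\<^bsub>M\<^esub> e b, l) - frag_of (e b, \<Lambda> b (frag_of (x, l))) \<in> Rel"
        using Rel_smult[OF eB \<phi>x l] by (simp add: \<Lambda>B)
    qed
    show ?case
      using Rel_add[OF 1 2] cl q by (simp add: sum_subtractf)
  next
    case (diff a b)
    have \<Lambda>_diff: "\<Lambda> b' (a - b) = (\<lambda>h. \<Lambda> b' a h - \<Lambda> b' b h)" for b'
      by (simp add: \<Lambda>_def fun_eq_iff frag_sum_diff)
    have "(\<Sum>b'\<in>B. frag_of (e b', \<lambda>h. \<Lambda> b' a h - \<Lambda> b' b h) - (frag_of (e b', \<Lambda> b' a) - frag_of (e b', \<Lambda> b' b))) \<in> Rel"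
      using diff B \<phi> by (intro Rel_sum frag_of_diff_right) blast+
    from Rel_diff[OF Rel_diff[OF conjunct2[OF diff(1)] conjunct2[OF diff(2)]] this]
    have "a - b - (\<Sum>b'\<in>B. frag_of (e b', \<lambda>h. \<Lambda> b' a h - \<Lambda> b' b h)) \<in> Rel"
      by (simp add: sum_subtractf sum.distrib algebra_simps)
    then show ?case
      using diff by (auto simp: \<Lambda>_diff intro: lp_module_diff_closed[OF p])
  qed
  have "\<Lambda> b c = (\<lambda>h. 0)" if "b \<in> B" for b
  proof
    fix h
    have b: "b \<in> X" using that B by blast
    show "\<Lambda> b c h = 0"
    proof (cases "h \<in> carrier G")
      case True
      then have h: "frag_of h \<in> carrier ZG" by (simp add: group_ring_simps)
      \<comment> \<open>Right multiplication commutes with the left module structure, so it produces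
        a new functional. Its pairing with \<open>c\<close> is the value of
        \<open>\<Lambda> b c\<close> at \<open>h\<close>, whereas \<open>\<phi> b\<close> alone
        gives only the value at the unit.\<close>
      have "(\<lambda>x. \<phi> b x \<otimes>\<^bsub>ZG\<^esub> frag_of h) \<in> functionals"
        using h lmodule_homD[OF \<phi>(1)[OF b]] functional_closed[OF \<phi>(1)[OF b]]
        by (intro lmodule_homI) (simp_all add: M.R.l_distr M.R.m_assoc)
      then have "tensor_pairing (\<lambda>x. \<phi> b x \<otimes>\<^bsub>ZG\<^esub> frag_of h) c = 0"
        using c by blast
      then show ?thesis
        using True by (simp add: tensor_pairing_def \<Lambda>_def frag_sum_group_ring_mult)
    qed (simp add: \<Lambda>_def)
  qed
  then have "(\<Sum>b\<in>B. frag_of (e b, \<Lambda> b c)) \<in> Rel"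
    using B \<phi>(2) frag_of_zero_right by (intro Rel_sum) (simp, blast)
  then show "c \<in> Rel"
    using Rel_add main[of c] by fastforce
qed (use Rel_carrier tensor_pairing_Rel in auto)

section \<open>Classes of tensors and closedness of their vanishing\<close>

context lp_tensor
begin

interpretation Fr: comm_group Fr
  by (rule abelian_free_Abelian_group)

abbreviation T :: "('m \<times> ('g \<Rightarrow> complex) \<Rightarrow>\<^sub>0 int) set monoid" where
  "T \<equiv> tensor_product G M L"

definition cls :: "('m \<times> ('g \<Rightarrow> complex) \<Rightarrow>\<^sub>0 int) \<Rightarrow> ('m \<times> ('g \<Rightarrow> complex) \<Rightarrow>\<^sub>0 int) set" where
  "cls c = Rel #>\<^bsub>Fr\<^esub> c"

lemma Rel_normal: "Rel \<lhd> Fr"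
  using Fr.normal_iff_subgroup Rel_subgroup by blast

lemma comm_group_T: "comm_group T"
  unfolding tensor_product_def by (rule Fr.abelian_FactGroup[OF Rel_subgroup])

lemma T_carrier: "carrier T = cls ` carrier Fr"
  unfolding tensor_product_def cls_def by (rule carrier_FactGroup)

lemma cls_closed: "c \<in> carrier Fr \<Longrightarrow> cls c \<in> carrier T"
  unfolding T_carrier by (rule imageI)

lemma cls_hom: "cls \<in> hom Fr T"
  using normal.r_coset_hom_Mod[OF Rel_normal] unfolding tensor_product_def cls_def[abs_def] .

lemma cls_eq_iff: "cls c = cls c' \<longleftrightarrow> c - c' \<in> Rel"
proof -
  have cls: "cls c = (\<lambda>t. t + c) ` Rel" for c
    by (auto simp: cls_def r_coset_def)
  show ?thesis
  proof
    assume "cls c = cls c'"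
    then have "0 + c \<in> (\<lambda>t. t + c') ` Rel"
      unfolding cls by (metis Rel_zero imageI)
    then show "c - c' \<in> Rel" by auto
  next
    assume c: "c - c' \<in> Rel"
    have "t + c \<in> (\<lambda>t. t + c') ` Rel" if "t \<in> Rel" for t
      using Rel_add[OF that c] by (intro image_eqI[of _ _ "t + (c - c')"]) auto
    moreover have "t + c' \<in> (\<lambda>t. t + c) ` Rel" if "t \<in> Rel" for t
      using Rel_diff[OF that c] by (intro image_eqI[of _ _ "t - (c - c')"]) auto
    ultimately show "cls c = cls c'"
      unfolding cls by blast
  qed
qed

lemma T_one: "\<one>\<^bsub>T\<^esub> = cls 0"
  by (auto simp: tensor_product_def cls_def r_coset_def)

lemma cls_eq_one_iff: "cls c = \<one>\<^bsub>T\<^esub> \<longleftrightarrow> c \<in> Rel"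
  by (simp add: T_one cls_eq_iff)

lemma sum_frag_of_closed:
  assumes "\<And>j. j \<in> J \<Longrightarrow> x j \<in> carrier M" "\<And>j. j \<in> J \<Longrightarrow> l j \<in> carrier L"
  shows "(\<Sum>j\<in>J. frag_of (x j, l j)) \<in> carrier Fr"
  using assms by (intro sum_closed_free_Abelian_group) simp

lemma finprod_pure_tensor:
  assumes "finite J" "\<And>j. j \<in> J \<Longrightarrow> x j \<in> carrier M" "\<And>j. j \<in> J \<Longrightarrow> l j \<in> carrier L"
  shows "finprod T (\<lambda>j. pure_tensor G M L (x j) (l j)) J = cls (\<Sum>j\<in>J. frag_of (x j, l j))"
proof -
  interpret T: comm_group T by (rule comm_group_T)
  have pure: "pure_tensor G M L x l = cls (frag_of (x, l))" for x l
    by (simp add: pure_tensor_def cls_def)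
  show ?thesis
    using assms
  proof (induction J rule: finite_induct)
    case empty
    then show ?case by (simp add: T_one)
  next
    case (insert j J)
    have "pure_tensor G M L (x i) (l i) \<in> carrier T" if "i \<in> insert j J" for i
      unfolding pure using insert.prems[OF that] by (intro cls_closed) simp
    then have "finprod T (\<lambda>j. pure_tensor G M L (x j) (l j)) (insert j J)
        = pure_tensor G M L (x j) (l j) \<otimes>\<^bsub>T\<^esub> finprod T (\<lambda>j. pure_tensor G M L (x j) (l j)) J"
      by (intro T.finprod_insert[OF insert.hyps]) auto
    also have "\<dots> = cls (frag_of (x j, l j)) \<otimes>\<^bsub>T\<^esub> cls (\<Sum>j\<in>J. frag_of (x j, l j))"
      using insert by (simp add: pure)
    also have "\<dots> = cls (frag_of (x j, l j) \<otimes>\<^bsub>Fr\<^esub> (\<Sum>j\<in>J. frag_of (x j, l j)))"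
      using insert by (intro hom_mult[OF cls_hom, symmetric] sum_frag_of_closed) auto
    finally show ?case using insert by simp
  qed
qed

text \<open>Integer coefficients are absorbed into the functions, which gives the form of a sum used
  to define the topology on the tensor product. Beyond \<open>m\<close> both sequences are padded
  with zeros, so that membership holds for all indices.\<close>

lemma cls_expansion:
  assumes "projective_module ZG M" "c \<in> carrier Fr"
  shows "\<exists>(m :: nat) x l. (\<forall>j. x j \<in> carrier M) \<and> (\<forall>j. l j \<in> carrier L) \<and>
    c - (\<Sum>j<m. frag_of (x j, l j)) \<in> Rel"
proof -
  obtain f where f: "bij_betw f {..<card (Poly_Mapping.keys c)} (Poly_Mapping.keys c)"
    using ex_bij_betw_nat_finite[of "Poly_Mapping.keys c"] by (auto simp: atLeast0LessThan)
  let ?m = "card (Poly_Mapping.keys c)"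
  define x where "x j = (if j < ?m then fst (f j) else \<zero>\<^bsub>M\<^esub>)" for j
  define l where "l j = (if j < ?m then (\<lambda>g. of_int (Poly_Mapping.lookup c (f j)) * snd (f j) g) else (\<lambda>g. 0))" for j
  have fj: "f j \<in> carrier M \<times> carrier L" if "j < ?m" for j
    using bij_betwE[OF f] that assms(2) by auto
  have x: "x j \<in> carrier M" for j
    using fj[of j] by (auto simp: x_def mem_Times_iff)
  have l: "l j \<in> carrier L" for j
    using fj[of j] by (auto simp: l_def mem_Times_iff intro: lp_module_scale_closed)
  have "tensor_pairing \<phi> (c - (\<Sum>j<?m. frag_of (x j, l j))) = 0" for \<phi>
  proof -
    have "tensor_pairing \<phi> c = (\<Sum>q\<in>Poly_Mapping.keys c. of_int (Poly_Mapping.lookup c q) * frag_sum (snd q) (\<phi> (fst q)))"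
      by (simp add: tensor_pairing_def frag_sum_def[of _ c] case_prod_beta)
    also have "\<dots> = (\<Sum>j<?m. of_int (Poly_Mapping.lookup c (f j)) * frag_sum (snd (f j)) (\<phi> (fst (f j))))"
      by (rule sum.reindex_bij_betw[OF f, symmetric])
    also have "\<dots> = (\<Sum>j<?m. frag_sum (l j) (\<phi> (x j)))"
      by (intro sum.cong) (auto simp: l_def x_def frag_sum_cmult)
    finally show ?thesis by simp
  qed
  moreover have "Poly_Mapping.keys (c - (\<Sum>j<?m. frag_of (x j, l j))) \<subseteq> carrier M \<times> carrier L"
    using sum_frag_of_closed[of "{..<?m}" x l, OF x l] assms(2)
    by (intro order.trans[OF keys_diff Un_least]) simp_all
  ultimately have "c - (\<Sum>j<?m. frag_of (x j, l j)) \<in> Rel"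
    using tensor_relations_iff[OF assms(1)] by blast
  with x l show ?thesis by blast
qed

text \<open>By \<open>tensor_relations_iff\<close> the set is an intersection of zero sets, one for
  each functional, and for fixed \<open>x\<close> each pairing is a finite combination of
  coordinates of the \<open>l j\<close>, hence continuous.\<close>

lemma closedin_vanishing_tensors:
  assumes "projective_module ZG M" "x \<in> {..<m} \<rightarrow> carrier M"
  defines "X \<equiv> product_topology (\<lambda>_. lp_topology p G) {..<m :: nat}"
  shows "closedin X {l \<in> topspace X. (\<Sum>j<m. frag_of (x j, l j)) \<in> Rel}"
proof -
  have X: "topspace X = PiE {..<m} (\<lambda>_. carrier L)"
    by (simp add: X_def p)
  have eq: "{l \<in> topspace X. (\<Sum>j<m. frag_of (x j, l j)) \<in> Rel}
      = \<Inter> (insert (topspace X) ((\<lambda>\<phi>. {l \<in> topspace X. (\<Sum>j<m. frag_sum (l j) (\<phi> (x j))) \<in> {0}}) ` functionals))"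
    (is "?lhs = ?rhs")
  proof -
    have "(\<Sum>j<m. frag_of (x j, l j)) \<in> Rel \<longleftrightarrow> (\<forall>\<phi>\<in>functionals. (\<Sum>j<m. frag_sum (l j) (\<phi> (x j))) = 0)"
      if "l \<in> topspace X" for l
    proof -
      have "(\<Sum>j<m. frag_of (x j, l j)) \<in> carrier Fr"
        using that assms(2) unfolding X by (intro sum_frag_of_closed) auto
      then show ?thesis
        using tensor_relations_iff[OF assms(1), of "\<Sum>j<m. frag_of (x j, l j)"] by simp
    qed
    then show ?thesis by auto
  qed
  have "continuous_map X euclidean (\<lambda>l. \<Sum>j<m. frag_sum (l j) (\<phi> (x j)))" for \<phi>
  proof (intro continuous_map_sum)
    fix j assume j: "j \<in> {..<m}"
    have ev: "continuous_map X euclidean (\<lambda>l. l j g)" for g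
      using continuous_map_compose[OF continuous_map_product_projection[OF j, of "\<lambda>_. lp_topology p G"] continuous_map_lp_eval[OF p, of G g]]
      by (simp add: comp_def X_def)
    have mult: "continuous_map X euclidean (\<lambda>l. k * l j g)" for k g
    proof -
      have "continuous_map euclidean euclidean (\<lambda>w :: complex. k * w)"
        by (simp add: continuous_intros)
      from continuous_map_compose[OF ev this, of g] show ?thesis by (simp add: comp_def)
    qed
    show "continuous_map X euclidean (\<lambda>l. frag_sum (l j) (\<phi> (x j)))"
      unfolding frag_sum_def by (intro continuous_map_sum mult) simp
  qed simp
  then have "closedin X {l \<in> topspace X. (\<Sum>j<m. frag_sum (l j) (\<phi> (x j))) \<in> {0}}" for \<phi>
    by (rule closedin_continuous_map_preimage) simp
  then show ?thesis
    unfolding eq by (intro closedin_Inter) auto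
qed

end

section \<open>Vanishing of reduced homology and cohomology\<close>

lemma trivial_group_Mod_self:
  assumes "group A" "subgroup K A"
  shows "trivial_group ((A\<lparr>carrier := K\<rparr>) Mod K)"
proof -
  interpret B: group "A\<lparr>carrier := K\<rparr>"
    by (rule subgroup.subgroup_is_group[OF assms(2,1)])
  have normal: "K \<lhd> A\<lparr>carrier := K\<rparr>"
    using B.subgroup_self B.coset_join2 B.coset_join3 by (auto simp: normal_def normal_axioms_def B.group_axioms)
  have "K #>\<^bsub>A\<lparr>carrier := K\<rparr>\<^esub> x = K" if "x \<in> K" for x
    using that B.subgroup_self by (intro B.coset_join2) auto
  then have "carrier ((A\<lparr>carrier := K\<rparr>) Mod K) \<subseteq> {\<one>\<^bsub>(A\<lparr>carrier := K\<rparr>) Mod K\<^esub>}"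
    by (auto simp: carrier_FactGroup)
  then show ?thesis
    using group.trivial_group_subset[OF normal.factorgroup_is_group[OF normal]] by blast
qed

lemma (in group) left_module_lp:
  assumes "p \<ge> 1" "ring ZG"
  shows "left_module ZG (lp_module p G)"
proof -
  interpret R: ring ZG by (rule assms)
  interpret L: abelian_group "lp_module p G"
  proof (rule abelian_groupI)
    fix f assume "f \<in> carrier (lp_module p G)"
    then show "\<exists>f'\<in>carrier (lp_module p G). f' \<oplus>\<^bsub>lp_module p G\<^esub> f = \<zero>\<^bsub>lp_module p G\<^esub>"
      by (intro bexI[of _ "\<lambda>g. - f g"]) (auto intro: lp_module_uminus_closed)
  qed (auto simp: add_ac intro: lp_module_add_closed assms)
  show ?thesis
  proof
    fix a b f assume a: "a \<in> carrier ZG" and b: "b \<in> carrier ZG" and f: "f \<in> carrier (lp_module p G)"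
    show "(a \<otimes>\<^bsub>ZG\<^esub> b) \<odot>\<^bsub>lp_module p G\<^esub> f = a \<odot>\<^bsub>lp_module p G\<^esub> (b \<odot>\<^bsub>lp_module p G\<^esub> f)"
    proof
      fix h
      have "frag_sum (\<lambda>g. frag_sum (\<lambda>k. f (inv (g \<otimes> k) \<otimes> h)) b) a
          = frag_sum (\<lambda>g. (b \<odot>\<^bsub>lp_module p G\<^esub> f) (inv g \<otimes> h)) a" if "h \<in> carrier G"
      proof (rule frag_sum_cong)
        fix g assume "g \<in> Poly_Mapping.keys a"
        then have g: "g \<in> carrier G" using a by (auto simp: group_ring_simps)
        have "f (inv (g \<otimes> k) \<otimes> h) = f (inv k \<otimes> (inv g \<otimes> h))" if "k \<in> Poly_Mapping.keys b" for k
          using that b g \<open>h \<in> carrier G\<close> by (auto simp: group_ring_simps inv_mult_group m_assoc subset_iff)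
        then show "frag_sum (\<lambda>k. f (inv (g \<otimes> k) \<otimes> h)) b = (b \<odot>\<^bsub>lp_module p G\<^esub> f) (inv g \<otimes> h)"
          using g that by (auto simp: lp_module_smult intro: frag_sum_cong)
      qed
      then show "((a \<otimes>\<^bsub>ZG\<^esub> b) \<odot>\<^bsub>lp_module p G\<^esub> f) h = (a \<odot>\<^bsub>lp_module p G\<^esub> (b \<odot>\<^bsub>lp_module p G\<^esub> f)) h"
        by (simp add: lp_module_smult[of p G "a \<otimes>\<^bsub>ZG\<^esub> b"] lp_module_smult[of p G a] frag_sum_group_ring_mult)
    qed
  next
    fix f assume f: "f \<in> carrier (lp_module p G)"
    then show "\<one>\<^bsub>ZG\<^esub> \<odot>\<^bsub>lp_module p G\<^esub> f = f"
      by (auto simp: lp_module_smult group_ring_simps lp_module_outside)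
  next
    fix a f assume "a \<in> carrier ZG" "f \<in> carrier (lp_module p G)"
    then show "a \<odot>\<^bsub>lp_module p G\<^esub> f \<in> carrier (lp_module p G)"
      by (rule lp_module_smult_closed[OF assms(1)])
  qed (auto simp: lp_module_smult group_ring_simps frag_sum_add frag_sum_add_fun)
qed

lemma frag_of_inv_smult:
  assumes "group G" "z \<in> carrier G"
  shows "frag_of (inv\<^bsub>G\<^esub> z) \<odot>\<^bsub>lp_module p G\<^esub> f = lp_translate G z f"
  using assms by (auto simp: lp_module_smult lp_translate_def group.inv_inv)

text \<open>Averaging is moved from the function to the group ring element, where multiplication by
  \<open>z k\<close> can be compared with the homotopy.\<close>

lemma (in group) frag_sum_average:
  assumes "a \<in> carrier ZG"
  shows "frag_sum (lp_average G z N f) a = of_real (1 / real N) * (\<Sum>k<N. frag_sum f (frag_of (z k) \<otimes>\<^bsub>ZG\<^esub> a))"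
proof -
  have "frag_sum (lp_translate G (z k) f) a = frag_sum f (frag_of (z k) \<otimes>\<^bsub>ZG\<^esub> a)" for k
    unfolding frag_sum_group_ring_mult frag_sum_of
    by (rule frag_sum_cong) (use assms in \<open>auto simp: lp_translate_def group_ring_simps\<close>)
  then show ?thesis
    by (simp add: lp_average_def[abs_def] frag_sum_cmult frag_sum_sum_fun del: of_real_divide)
qed

context group_resolution
begin

interpretation F: left_module ZG "F i" for i
  by (rule F_left_module)

text \<open>This describes the term of the homotopy formula that first applies the boundary map. In
  degree 0 there is no such term, so the map has to vanish.\<close>

definition factors_through_d :: "nat \<Rightarrow> ('g \<Rightarrow>\<^sub>0 int, 'n) module \<Rightarrow> ('m \<Rightarrow> 'n) \<Rightarrow> bool" where
  "factors_through_d i N \<kappa> \<longleftrightarrow> (case i of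
     0 \<Rightarrow> \<forall>x\<in>carrier (F 0). \<kappa> x = \<zero>\<^bsub>N\<^esub>
   | Suc j \<Rightarrow> \<exists>\<phi>\<in>lmodule_hom ZG (F j) N. \<forall>x\<in>carrier (F i). \<kappa> x = \<phi> (d i x))"

text \<open>The homotopy formula followed by \<open>\<phi>\<close>, in a form that serves homology
  (\<open>N\<close> the group ring) and cohomology (\<open>N\<close> the module
  \<open>l\<^sup>p(G)\<close>). The map \<open>h\<close> is chosen before \<open>\<phi>\<close>,
  because in homology one chain made from \<open>h\<close> must pass the test of all functionals;
  \<open>\<kappa>\<close> may depend on \<open>\<phi>\<close>.\<close>

lemma homotopy_hom:
  assumes z: "z \<in> center" and N: "left_module ZG N"
  shows "\<exists>h\<in>lmodule_hom ZG (F i) (F (Suc i)). \<forall>\<phi>\<in>lmodule_hom ZG (F i) N. \<exists>\<kappa>. factors_through_d i N \<kappa> \<and>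
    (\<forall>x\<in>carrier (F i). \<phi> x = \<phi> (frag_of z \<odot>\<^bsub>F i\<^esub> x) \<oplus>\<^bsub>N\<^esub> (\<phi> (d (Suc i) (h x)) \<oplus>\<^bsub>N\<^esub> \<kappa> x))"
proof -
  interpret N: left_module ZG N by (rule N)
  have zc: "frag_of z \<odot>\<^bsub>F i\<^esub> x \<in> carrier (F i)" if "x \<in> carrier (F i)" for x
    using frag_of_z[OF z] that by simp
  show ?thesis
  proof (cases i)
    case 0
    obtain h where h: "h \<in> lmodule_hom ZG (F 0) (F (Suc 0))"
      and dh: "\<forall>x\<in>carrier (F 0). d (Suc 0) (h x) = x \<ominus>\<^bsub>F 0\<^esub> frag_of z \<odot>\<^bsub>F 0\<^esub> x"
      using homotopy_0[OF z] by (elim bexE)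
    show ?thesis
      unfolding 0
    proof (rule bexI[OF _ h], intro ballI exI[of _ "\<lambda>x. \<zero>\<^bsub>N\<^esub>"] conjI)
      fix \<phi> x assume \<phi>: "\<phi> \<in> lmodule_hom ZG (F 0) N" and x: "x \<in> carrier (F 0)"
      interpret \<phi>: abelian_group_hom "F 0" N \<phi>
        by (rule lmodule_hom_imp_abelian_group_hom[OF F.M.abelian_group_axioms N.M.abelian_group_axioms \<phi>])
      show "\<phi> x = \<phi> (frag_of z \<odot>\<^bsub>F 0\<^esub> x) \<oplus>\<^bsub>N\<^esub> (\<phi> (d (Suc 0) (h x)) \<oplus>\<^bsub>N\<^esub> \<zero>\<^bsub>N\<^esub>)"
        using x zc[unfolded 0, OF x] by (simp add: dh \<phi>.hom_minus a_minus_def N.M.a_ac N.M.r_neg2 N.M.r_neg)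
    qed (simp add: factors_through_d_def)
  next
    case (Suc k)
    obtain h h' where h: "h \<in> lmodule_hom ZG (F k) (F (Suc k))" and h': "h' \<in> lmodule_hom ZG (F (Suc k)) (F (Suc (Suc k)))"
      and dh: "\<forall>x\<in>carrier (F (Suc k)). d (Suc (Suc k)) (h' x)
        = x \<ominus>\<^bsub>F (Suc k)\<^esub> frag_of z \<odot>\<^bsub>F (Suc k)\<^esub> x \<ominus>\<^bsub>F (Suc k)\<^esub> h (d (Suc k) x)"
      using homotopy_Suc[OF z, of k] by (elim bexE)
    show ?thesis
      unfolding Suc
    proof (rule bexI[OF _ h'], intro ballI)
      fix \<phi> assume \<phi>: "\<phi> \<in> lmodule_hom ZG (F (Suc k)) N"
      interpret \<phi>: abelian_group_hom "F (Suc k)" N \<phi>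
        by (rule lmodule_hom_imp_abelian_group_hom[OF F.M.abelian_group_axioms N.M.abelian_group_axioms \<phi>])
      have "\<phi> x = \<phi> (frag_of z \<odot>\<^bsub>F (Suc k)\<^esub> x) \<oplus>\<^bsub>N\<^esub> (\<phi> (d (Suc (Suc k)) (h' x)) \<oplus>\<^bsub>N\<^esub> \<phi> (h (d (Suc k) x)))"
        if x: "x \<in> carrier (F (Suc k))" for x
      proof -
        have c: "\<phi> x \<in> carrier N" "\<phi> (frag_of z \<odot>\<^bsub>F (Suc k)\<^esub> x) \<in> carrier N" "\<phi> (h (d (Suc k) x)) \<in> carrier N"
          using x zc[unfolded Suc, OF x] lmodule_homD(1)[OF h d_closed[OF x]] by auto
        have "\<phi> (d (Suc (Suc k)) (h' x)) = \<phi> x \<ominus>\<^bsub>N\<^esub> \<phi> (frag_of z \<odot>\<^bsub>F (Suc k)\<^esub> x) \<ominus>\<^bsub>N\<^esub> \<phi> (h (d (Suc k) x))"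
          using x zc[unfolded Suc, OF x] lmodule_homD(1)[OF h d_closed[OF x]] by (simp add: dh \<phi>.hom_minus)
        then have "\<phi> (d (Suc (Suc k)) (h' x)) \<oplus>\<^bsub>N\<^esub> \<phi> (h (d (Suc k) x)) = \<phi> x \<ominus>\<^bsub>N\<^esub> \<phi> (frag_of z \<odot>\<^bsub>F (Suc k)\<^esub> x)"
          using c by (simp add: a_minus_def N.M.a_assoc N.M.l_neg)
        then show ?thesis
          using c by (simp add: a_minus_def N.M.a_comm[of "\<phi> x"] N.M.r_neg2)
      qed
      moreover have "factors_through_d (Suc k) N (\<lambda>x. \<phi> (h (d (Suc k) x)))"
        using lmodule_hom_compose[OF h \<phi>] by (auto simp: factors_through_d_def intro: bexI[of _ "\<lambda>y. \<phi> (h y)"])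
      ultimately show "\<exists>\<kappa>. factors_through_d (Suc k) N \<kappa> \<and> (\<forall>x\<in>carrier (F (Suc k)).
          \<phi> x = \<phi> (frag_of z \<odot>\<^bsub>F (Suc k)\<^esub> x) \<oplus>\<^bsub>N\<^esub> (\<phi> (d (Suc (Suc k)) (h' x)) \<oplus>\<^bsub>N\<^esub> \<kappa> x))"
        by blast
    qed
  qed
qed


section \<open>Cycles, boundaries and reduced homology\<close>

context
  fixes p :: real assumes p: "p \<ge> 1"
begin

lemma lp_tensor_F: "lp_tensor G (F i) p"
  using p by (intro lp_tensor.intro lp_tensor_axioms.intro group_axioms F_left_module)

interpretation T: lp_tensor G "F i" p for i
  by (rule lp_tensor_F)

abbreviation d_frag :: "nat \<Rightarrow> ('m \<times> ('g \<Rightarrow> complex) \<Rightarrow>\<^sub>0 int) \<Rightarrow> ('m \<times> ('g \<Rightarrow> complex) \<Rightarrow>\<^sub>0 int)" where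
  "d_frag i \<equiv> frag_extend (\<lambda>(x, y). frag_of (d i x, y))"

abbreviation cl :: "nat \<Rightarrow> ('m \<times> ('g \<Rightarrow> complex) \<Rightarrow>\<^sub>0 int) \<Rightarrow> ('m \<times> ('g \<Rightarrow> complex) \<Rightarrow>\<^sub>0 int) set" where
  "cl i \<equiv> lp_tensor.cls G (F i) p"

abbreviation Rl :: "nat \<Rightarrow> ('m \<times> ('g \<Rightarrow> complex) \<Rightarrow>\<^sub>0 int) set" where
  "Rl i \<equiv> tensor_relations G (F i) (lp_module p G)"

abbreviation Fg :: "nat \<Rightarrow> ('m \<times> ('g \<Rightarrow> complex) \<Rightarrow>\<^sub>0 int) monoid" where
  "Fg i \<equiv> free_Abelian_group (carrier (F i) \<times> carrier (lp_module p G))"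

abbreviation TP :: "nat \<Rightarrow> ('m \<times> ('g \<Rightarrow> complex) \<Rightarrow>\<^sub>0 int) set monoid" where
  "TP i \<equiv> tensor_product G (F i) (lp_module p G)"

lemma relations_iff:
  assumes "c \<in> carrier (Fg i)"
  shows "c \<in> Rl i \<longleftrightarrow> (\<forall>\<phi>\<in>lmodule_hom ZG (F i) (regular_module ZG). tensor_pairing \<phi> c = 0)"
  using T.tensor_relations_iff[OF projective, of c i] assms by simp

lemma d_frag_closed:
  assumes "c \<in> carrier (Fg (Suc i))"
  shows "d_frag (Suc i) c \<in> carrier (Fg i)"
proof -
  have "Poly_Mapping.keys (d_frag (Suc i) c) \<subseteq> (\<Union>q\<in>Poly_Mapping.keys c. {(d (Suc i) (fst q), snd q)})"
    by (rule order.trans[OF keys_frag_extend]) (auto simp: split_def)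
  also have "\<dots> \<subseteq> carrier (F i) \<times> carrier (lp_module p G)"
  proof (rule UN_least)
    fix q assume "q \<in> Poly_Mapping.keys c"
    then have "fst q \<in> carrier (F (Suc i))" "snd q \<in> carrier (lp_module p G)"
      using assms by auto
    then show "{(d (Suc i) (fst q), snd q)} \<subseteq> carrier (F i) \<times> carrier (lp_module p G)"
      using d_closed by simp
  qed
  finally show ?thesis by simp
qed

lemma d_functional:
  "\<phi> \<in> lmodule_hom ZG (F i) N \<Longrightarrow> (\<lambda>x. \<phi> (d (Suc i) x)) \<in> lmodule_hom ZG (F (Suc i)) N"
  by (rule lmodule_hom_compose[OF d_hom])

text \<open>A functional on \<open>F i\<close> composed with the boundary map is a functional on
  \<open>F (Suc i)\<close>, so detection by functionals gives the claim without inspecting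
  generators of the relations.\<close>

lemma d_frag_relations:
  assumes "c \<in> Rl (Suc i)"
  shows "d_frag (Suc i) c \<in> Rl i"
proof -
  have c: "c \<in> carrier (Fg (Suc i))"
    using T.Rel_carrier[OF assms] by simp
  show ?thesis
    unfolding relations_iff[OF d_frag_closed[OF c]] tensor_pairing_extend
    using T.tensor_pairing_Rel[OF d_functional assms] by blast
qed

lemma tensor_map_d:
  assumes "c \<in> carrier (Fg (Suc i))"
  shows "tensor_map G (F i) (lp_module p G) (d (Suc i)) (cl (Suc i) c) = cl i (d_frag (Suc i) c)"
proof -
  have "cl i (d_frag (Suc i) c') = cl i (d_frag (Suc i) c)" if "c' \<in> cl (Suc i) c" for c'
  proof -
    obtain t where "t \<in> Rl (Suc i)" "c' = t + c"
      using \<open>c' \<in> cl (Suc i) c\<close> unfolding T.cls_def r_coset_def by auto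
    then show ?thesis
      using d_frag_relations by (simp add: T.cls_eq_iff frag_extend_add)
  qed
  moreover have "c \<in> cl (Suc i) c"
    unfolding T.cls_def r_coset_def using T.Rel_zero[of "Suc i"] by force
  ultimately show ?thesis
    unfolding tensor_map_def T.cls_def[of i, symmetric] by blast
qed

lemma tensor_map_d_hom: "tensor_map G (F i) (lp_module p G) (d (Suc i)) \<in> hom (TP (Suc i)) (TP i)"
proof (rule homI)
  fix X Y assume "X \<in> carrier (TP (Suc i))" "Y \<in> carrier (TP (Suc i))"
  then obtain c c' where c: "c \<in> carrier (Fg (Suc i))" "c' \<in> carrier (Fg (Suc i))"
    and XY: "X = cl (Suc i) c" "Y = cl (Suc i) c'"
    unfolding T.T_carrier by blast
  show "tensor_map G (F i) (lp_module p G) (d (Suc i)) X \<in> carrier (TP i)"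
    using c XY by (simp only: tensor_map_d T.cls_closed d_frag_closed)
  have "X \<otimes>\<^bsub>TP (Suc i)\<^esub> Y = cl (Suc i) (c + c')"
    using hom_mult[OF T.cls_hom c] XY by simp
  moreover have "c + c' \<in> carrier (Fg (Suc i))"
    using monoid.m_closed[OF group.is_monoid[OF group_free_Abelian_group] c] by simp
  moreover have "cl i (d_frag (Suc i) (c + c')) = cl i (d_frag (Suc i) c) \<otimes>\<^bsub>TP i\<^esub> cl i (d_frag (Suc i) c')"
    using hom_mult[OF T.cls_hom d_frag_closed[OF c(1)] d_frag_closed[OF c(2)]] by (simp add: frag_extend_add)
  ultimately show "tensor_map G (F i) (lp_module p G) (d (Suc i)) (X \<otimes>\<^bsub>TP (Suc i)\<^esub> Y)
      = tensor_map G (F i) (lp_module p G) (d (Suc i)) X \<otimes>\<^bsub>TP i\<^esub> tensor_map G (F i) (lp_module p G) (d (Suc i)) Y"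
    using c XY by (simp only: tensor_map_d)
qed

lemma cycles_Suc_iff:
  assumes "c \<in> carrier (Fg (Suc i))"
  shows "cl (Suc i) c \<in> lp_cycles p G F d (Suc i) \<longleftrightarrow> d_frag (Suc i) c \<in> Rl i"
  using assms T.cls_closed[OF assms] by (simp add: lp_cycles_def kernel_def tensor_map_d T.cls_eq_one_iff)

lemma cycles_subgroup: "subgroup (lp_cycles p G F d i) (TP i)"
proof (cases i)
  case 0
  then show ?thesis
    using group.subgroup_self[OF comm_group.axioms(2)[OF T.comm_group_T[of 0]]] by (simp add: lp_cycles_def)
next
  case (Suc k)
  have "group_hom (TP (Suc k)) (TP k) (tensor_map G (F k) (lp_module p G) (d (Suc k)))"
    using comm_group.axioms(2)[OF T.comm_group_T] tensor_map_d_hom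
    by (simp add: group_hom_def group_hom_axioms_def)
  from group_hom.subgroup_kernel[OF this] show ?thesis
    by (simp add: Suc lp_cycles_def)
qed

lemma topspace_tensor: "topspace (tensor_lp_topology p G (F i)) = carrier (TP i)"
proof
  show "topspace (tensor_lp_topology p G (F i)) \<subseteq> carrier (TP i)"
    using openin_topspace[of "tensor_lp_topology p G (F i)"] unfolding openin_tensor_lp_topology by blast
  have "openin (tensor_lp_topology p G (F i)) (carrier (TP i))"
    unfolding openin_tensor_lp_topology
  proof (intro conjI allI ballI)
    fix m :: nat and x assume x: "x \<in> {..<m} \<rightarrow> carrier (F i)"
    let ?X = "product_topology (\<lambda>_. lp_topology p G) {..<m}"
    have "finprod (TP i) (\<lambda>j. pure_tensor G (F i) (lp_module p G) (x j) (l j)) {..<m} \<in> carrier (TP i)"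
      if "l \<in> topspace ?X" for l
    proof -
      have l: "l j \<in> carrier (lp_module p G)" if "j < m" for j
        using \<open>l \<in> topspace ?X\<close> that p by auto
      have "(\<Sum>j<m. frag_of (x j, l j)) \<in> carrier (Fg i)"
        using x l by (intro T.sum_frag_of_closed) auto
      moreover have "finprod (TP i) (\<lambda>j. pure_tensor G (F i) (lp_module p G) (x j) (l j)) {..<m}
          = cl i (\<Sum>j<m. frag_of (x j, l j))"
        using x l by (intro T.finprod_pure_tensor) auto
      ultimately show ?thesis
        using T.cls_closed by presburger
    qed
    then have "{l \<in> topspace ?X. finprod (TP i) (\<lambda>j. pure_tensor G (F i) (lp_module p G) (x j) (l j)) {..<m} \<in> carrier (TP i)}
        = topspace ?X"
      by blast
    then show "openin ?X {l \<in> topspace ?X. finprod (TP i) (\<lambda>j. pure_tensor G (F i) (lp_module p G) (x j) (l j)) {..<m} \<in> carrier (TP i)}"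
      using openin_topspace[of ?X] by (simp only:)
  qed (rule subset_refl)
  then show "carrier (TP i) \<subseteq> topspace (tensor_lp_topology p G (F i))"
    by (rule openin_subset)
qed

text \<open>Pulled back along the map of a tuple \<open>x\<close>, the cycles become those
  \<open>l\<close> for which the tensors of \<open>d (Suc k) (x j)\<close> with \<open>l j\<close>
  add up to 0, a closed set by \<open>closedin_vanishing_tensors\<close>.\<close>

lemma closedin_cycles: "closedin (tensor_lp_topology p G (F i)) (lp_cycles p G F d i)"
proof (cases i)
  case 0
  then show ?thesis
    using closedin_topspace[of "tensor_lp_topology p G (F 0)"] by (simp add: lp_cycles_def topspace_tensor)
next
  case (Suc k)
  have sub: "lp_cycles p G F d (Suc k) \<subseteq> carrier (TP (Suc k))"
    using subgroup.subset[OF cycles_subgroup] .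
  have "openin (tensor_lp_topology p G (F (Suc k))) (carrier (TP (Suc k)) - lp_cycles p G F d (Suc k))"
    unfolding openin_tensor_lp_topology
  proof (intro conjI allI ballI)
    fix m :: nat and x assume x: "x \<in> {..<m} \<rightarrow> carrier (F (Suc k))"
    let ?X = "product_topology (\<lambda>_. lp_topology p G) {..<m}"
    have dx: "(\<lambda>j. d (Suc k) (x j)) \<in> {..<m} \<rightarrow> carrier (F k)"
      using x d_closed by auto
    have "finprod (TP (Suc k)) (\<lambda>j. pure_tensor G (F (Suc k)) (lp_module p G) (x j) (l j)) {..<m}
          \<in> carrier (TP (Suc k)) - lp_cycles p G F d (Suc k)
        \<longleftrightarrow> (\<Sum>j<m. frag_of (d (Suc k) (x j), l j)) \<notin> Rl k"
      if "l \<in> topspace ?X" for l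
    proof -
      have l: "l j \<in> carrier (lp_module p G)" if "j < m" for j
        using \<open>l \<in> topspace ?X\<close> that p by auto
      have c: "(\<Sum>j<m. frag_of (x j, l j)) \<in> carrier (Fg (Suc k))"
        using x l by (intro T.sum_frag_of_closed) auto
      have "finprod (TP (Suc k)) (\<lambda>j. pure_tensor G (F (Suc k)) (lp_module p G) (x j) (l j)) {..<m}
          = cl (Suc k) (\<Sum>j<m. frag_of (x j, l j))"
        using x l by (intro T.finprod_pure_tensor) auto
      moreover have "d_frag (Suc k) (\<Sum>j<m. frag_of (x j, l j)) = (\<Sum>j<m. frag_of (d (Suc k) (x j), l j))"
        by (simp add: frag_extend_sum comp_def)
      ultimately show ?thesis
        using T.cls_closed[OF c] cycles_Suc_iff[OF c] by simp
    qed
    then have "{l \<in> topspace ?X. finprod (TP (Suc k)) (\<lambda>j. pure_tensor G (F (Suc k)) (lp_module p G) (x j) (l j)) {..<m}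
          \<in> carrier (TP (Suc k)) - lp_cycles p G F d (Suc k)}
        = topspace ?X - {l \<in> topspace ?X. (\<Sum>j<m. frag_of (d (Suc k) (x j), l j)) \<in> Rl k}"
      by blast
    moreover have "openin ?X (topspace ?X - {l \<in> topspace ?X. (\<Sum>j<m. frag_of (d (Suc k) (x j), l j)) \<in> Rl k})"
      by (intro openin_diff openin_topspace T.closedin_vanishing_tensors[OF projective dx])
    ultimately show "openin ?X {l \<in> topspace ?X. finprod (TP (Suc k)) (\<lambda>j. pure_tensor G (F (Suc k)) (lp_module p G) (x j) (l j)) {..<m}
          \<in> carrier (TP (Suc k)) - lp_cycles p G F d (Suc k)}"
      by simp
  qed blast
  then show ?thesis
    using sub by (simp add: Suc closedin_def topspace_tensor)
qed

lemma boundaries_eq: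
  "lp_boundaries p G F d i = (\<lambda>c. cl i (d_frag (Suc i) c)) ` carrier (Fg (Suc i))"
  unfolding lp_boundaries_def T.T_carrier image_image by (intro image_cong refl tensor_map_d)

lemma boundaries_subset_cycles: "lp_boundaries p G F d i \<subseteq> lp_cycles p G F d i"
proof (cases i)
  case 0
  have "(\<lambda>c. cl 0 (d_frag (Suc 0) c)) ` carrier (Fg (Suc 0)) \<subseteq> carrier (TP 0)"
    by (rule image_subsetI) (rule T.cls_closed[OF d_frag_closed])
  then show ?thesis
    by (simp only: 0 boundaries_eq lp_cycles_def if_True refl)
next
  case (Suc k)
  have "cl (Suc k) (d_frag (Suc (Suc k)) c) \<in> lp_cycles p G F d (Suc k)"
    if c: "c \<in> carrier (Fg (Suc (Suc k)))" for c
    unfolding cycles_Suc_iff[OF d_frag_closed[OF c]] relations_iff[OF d_frag_closed[OF d_frag_closed[OF c]]]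
  proof
    fix \<phi> assume \<phi>: "\<phi> \<in> lmodule_hom ZG (F k) (regular_module ZG)"
    interpret \<phi>: abelian_group_hom "F k" "regular_module ZG" \<phi>
      by (rule lmodule_hom_imp_abelian_group_hom[OF F.M.abelian_group_axioms left_module.axioms(2)[OF F.left_module_regular] \<phi>])
    have "tensor_pairing \<phi> (d_frag (Suc k) (d_frag (Suc (Suc k)) c)) = tensor_pairing (\<lambda>x. \<phi> (d (Suc k) (d (Suc (Suc k)) x))) c"
      by (simp only: tensor_pairing_extend)
    also have "\<dots> = tensor_pairing (\<lambda>x. 0) c"
    proof (rule tensor_pairing_cong)
      show "Poly_Mapping.keys c \<subseteq> carrier (F (Suc (Suc k))) \<times> carrier (lp_module p G)" using c by simp
      show "\<phi> (d (Suc k) (d (Suc (Suc k)) x)) = 0" if "x \<in> carrier (F (Suc (Suc k)))" for x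
        using \<phi>.hom_zero by (simp add: d_d[OF that] group_ring_simps)
    qed
    also have "\<dots> = 0" by (simp add: tensor_pairing_def split_def)
    finally show "tensor_pairing \<phi> (d_frag (Suc k) (d_frag (Suc (Suc k)) c)) = 0" .
  qed
  then show ?thesis
    unfolding Suc boundaries_eq by blast
qed

text \<open>Tested by a functional, each translation by \<open>z k\<close> changes the cycle by a
  term with \<open>d (Suc i) (h k x)\<close> and a term factoring through \<open>d i\<close>. The
  cycle condition kills the latter, and the former is the pairing with a boundary.\<close>

lemma tensor_sum_minus_average_boundary:
  assumes z: "\<And>k. z k \<in> center" and N: "N > 0"
    and x: "\<And>j. x j \<in> carrier (F i)" and l: "\<And>j. l j \<in> carrier (lp_module p G)"
    and cycle: "cl i (\<Sum>j<m. frag_of (x j, l j)) \<in> lp_cycles p G F d i"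
  shows "cl i (\<Sum>j<m. frag_of (x j, \<lambda>g. l j g - lp_average G z N (l j) g)) \<in> lp_boundaries p G F d i"
proof -
  define P where "P k h \<longleftrightarrow> h \<in> lmodule_hom ZG (F i) (F (Suc i)) \<and>
      (\<forall>\<phi>\<in>lmodule_hom ZG (F i) (regular_module ZG). \<exists>\<kappa>. factors_through_d i (regular_module ZG) \<kappa> \<and>
        (\<forall>x\<in>carrier (F i). \<phi> x = \<phi> (frag_of (z k) \<odot>\<^bsub>F i\<^esub> x) + (\<phi> (d (Suc i) (h x)) + \<kappa> x)))" for k h
  have "\<exists>h. P k h" for k
    using homotopy_hom[OF z[of k] F.left_module_regular, of i]
    by (simp only: P_def regular_module_simps group_ring_simps Bex_def)
  then obtain h where P: "\<And>k. P k (h k)"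
    by metis
  then have h: "\<And>k. h k \<in> lmodule_hom ZG (F i) (F (Suc i))"
    unfolding P_def by blast
  define r :: complex where "r = of_real (1 / real N)"
  have r: "of_nat N * r = 1" using N by (simp add: r_def)
  let ?b = "\<Sum>j<m. frag_of (x j, l j)"
  let ?c = "\<Sum>j<m. frag_of (x j, \<lambda>g. l j g - lp_average G z N (l j) g)"
  \<comment> \<open>The mean of the homotopies applied to the cycle. The factor \<open>1 / N\<close>
    has to sit on the function, because formal sums have integer coefficients.\<close>
  let ?c' = "\<Sum>k<N. \<Sum>j<m. frag_of (h k (x j), \<lambda>g. r * l j g)"
  have zG: "z k \<in> carrier G" for k using z[of k] by (simp add: center_def)
  have hx: "h k (x j) \<in> carrier (F (Suc i))" for k j by (rule lmodule_homD(1)[OF h x])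
  have c0: "?b \<in> carrier (Fg i)" by (intro T.sum_frag_of_closed x l)
  have dl: "(\<lambda>g. l j g - lp_average G z N (l j) g) \<in> carrier (lp_module p G)" for j
    by (rule lp_module_diff_closed[OF p l lp_average_closed[OF p zG l]])
  have c: "?c \<in> carrier (Fg i)" by (intro T.sum_frag_of_closed x dl)
  have c': "?c' \<in> carrier (Fg (Suc i))"
    by (intro sum_closed_free_Abelian_group T.sum_frag_of_closed hx lp_module_scale_closed l)
  have "?c - d_frag (Suc i) ?c' \<in> Rl i"
  proof -
    have diff: "?c - d_frag (Suc i) ?c' \<in> carrier (Fg i)"
      using c d_frag_closed[OF c'] unfolding carrier_free_Abelian_group_iff
      by (intro order.trans[OF keys_diff Un_least])
    show ?thesis
      unfolding relations_iff[OF diff]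
    proof
      fix \<phi> assume \<phi>: "\<phi> \<in> lmodule_hom ZG (F i) (regular_module ZG)"
      define Q where "Q k \<kappa> \<longleftrightarrow> factors_through_d i (regular_module ZG) \<kappa> \<and>
        (\<forall>x\<in>carrier (F i). \<phi> x = \<phi> (frag_of (z k) \<odot>\<^bsub>F i\<^esub> x) + (\<phi> (d (Suc i) (h k x)) + \<kappa> x))" for k \<kappa>
      have "\<exists>\<kappa>. Q k \<kappa>" for k
        using P[of k] \<phi> unfolding P_def Q_def by blast
      then obtain \<kappa> where Q: "\<And>k. Q k (\<kappa> k)"
        by metis
      then have \<kappa>: "\<phi> x = \<phi> (frag_of (z k) \<odot>\<^bsub>F i\<^esub> x) + (\<phi> (d (Suc i) (h k x)) + \<kappa> k x)"
        if "x \<in> carrier (F i)" for k x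
        using that unfolding Q_def by blast
      have fact: "factors_through_d i (regular_module ZG) (\<kappa> k)" for k
        using Q unfolding Q_def by blast
      \<comment> \<open>In positive degree \<open>\<kappa> k\<close> is a functional
        \<open>\<phi>'\<close> composed with \<open>d i\<close>, so this sum is the pairing of
        \<open>\<phi>'\<close> with the boundary of a cycle.\<close>
      have \<kappa>c: "(\<Sum>j<m. frag_sum (l j) (\<kappa> k (x j))) = 0" for k
      proof (cases i)
        case 0
        then show ?thesis
          using fact[of k] x by (simp add: factors_through_d_def group_ring_simps)
      next
        case (Suc n)
        obtain \<phi>' where \<phi>': "\<phi>' \<in> lmodule_hom ZG (F n) (regular_module ZG)" "\<forall>x\<in>carrier (F i). \<kappa> k x = \<phi>' (d i x)"
          using fact[of k] by (auto simp: factors_through_d_def Suc)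
        have "d_frag (Suc n) ?b \<in> Rl n"
          using cycle c0 unfolding Suc by (simp only: cycles_Suc_iff)
        then have "tensor_pairing \<phi>' (d_frag (Suc n) ?b) = 0"
          by (rule T.tensor_pairing_Rel[OF \<phi>'(1)])
        then show ?thesis
          using \<phi>'(2) x by (simp add: Suc tensor_pairing_extend)
      qed
      have "frag_sum (\<lambda>g. l j g - lp_average G z N (l j) g) (\<phi> (x j))
          = (\<Sum>k<N. r * (frag_sum (l j) (\<phi> (d (Suc i) (h k (x j)))) + frag_sum (l j) (\<kappa> k (x j))))" for j
      proof -
        have \<phi>x: "\<phi> (x j) \<in> carrier ZG" using lmodule_homD(1)[OF \<phi> x] by simp
        have *: "frag_sum (l j) (\<phi> (x j)) - frag_sum (l j) (frag_of (z k) \<otimes>\<^bsub>ZG\<^esub> \<phi> (x j))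
            = frag_sum (l j) (\<phi> (d (Suc i) (h k (x j)))) + frag_sum (l j) (\<kappa> k (x j))" for k
        proof -
          have "\<phi> (frag_of (z k) \<odot>\<^bsub>F i\<^esub> x j) = frag_of (z k) \<otimes>\<^bsub>ZG\<^esub> \<phi> (x j)"
            using lmodule_homD(3)[OF \<phi> frag_of_z[OF z] x] by simp
          then have "\<phi> (x j) = frag_of (z k) \<otimes>\<^bsub>ZG\<^esub> \<phi> (x j) + (\<phi> (d (Suc i) (h k (x j))) + \<kappa> k (x j))"
            using \<kappa>[OF x, of j k] by simp
          from arg_cong[OF this, of "frag_sum (l j)"] show ?thesis
            by (simp add: frag_sum_add)
        qed
        have "frag_sum (\<lambda>g. l j g - lp_average G z N (l j) g) (\<phi> (x j))
            = of_nat N * r * frag_sum (l j) (\<phi> (x j)) - r * (\<Sum>k<N. frag_sum (l j) (frag_of (z k) \<otimes>\<^bsub>ZG\<^esub> \<phi> (x j)))"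
          by (simp only: frag_sum_diff_fun frag_sum_average[OF \<phi>x] r mult_1 flip: r_def)
        also have "\<dots> = (\<Sum>k<N. r * (frag_sum (l j) (\<phi> (x j)) - frag_sum (l j) (frag_of (z k) \<otimes>\<^bsub>ZG\<^esub> \<phi> (x j))))"
          by (simp add: right_diff_distrib sum_subtractf sum_distrib_left)
        finally show ?thesis by (simp only: *)
      qed
      then have "tensor_pairing \<phi> ?c = (\<Sum>j<m. \<Sum>k<N. r * frag_sum (l j) (\<phi> (d (Suc i) (h k (x j))))) + (\<Sum>j<m. \<Sum>k<N. r * frag_sum (l j) (\<kappa> k (x j)))"
        by (simp add: distrib_left sum.distrib)
      also have "(\<Sum>j<m. \<Sum>k<N. r * frag_sum (l j) (\<kappa> k (x j))) = (\<Sum>k<N. r * (\<Sum>j<m. frag_sum (l j) (\<kappa> k (x j))))"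
        by (subst sum.swap) (simp only: sum_distrib_left)
      also have "(\<Sum>j<m. \<Sum>k<N. r * frag_sum (l j) (\<phi> (d (Suc i) (h k (x j))))) = tensor_pairing \<phi> (d_frag (Suc i) ?c')"
        by (subst sum.swap) (simp add: tensor_pairing_extend frag_sum_cmult)
      finally show "tensor_pairing \<phi> (?c - d_frag (Suc i) ?c') = 0"
        by (simp add: \<kappa>c)
    qed
  qed
  then have "cl i ?c = cl i (d_frag (Suc i) ?c')"
    by (simp add: T.cls_eq_iff)
  then show ?thesis
    unfolding boundaries_eq using c' by blast
qed

lemma limitin_minus_average:
  assumes "p > 1" "\<And>k. z k \<in> center" "inj z" "l \<in> carrier (lp_module p G)"
  shows "limitin (lp_topology p G) (\<lambda>N g. l g - lp_average G z N l g) l sequentially"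
proof -
  have zG: "z k \<in> carrier G" for k using assms(2)[of k] by (simp add: center_def)
  show ?thesis
    using p by (rule limitin_lp_topology_null[OF _ assms(4) lp_average_closed[OF p zG assms(4)]
      lp_average_tendsto_0[OF assms(1) zG assms(3,4)]])
qed

text \<open>An open set in the tensor product is tested through maps from powers of
  \<open>l\<^sup>p(G)\<close>. The tuple \<open>x\<close> of one representation of the cycle is
  therefore kept fixed, and only the functions \<open>l j\<close> are approximated.\<close>

lemma cycles_subset_closure:
  fixes z :: "nat \<Rightarrow> 'g"
  assumes "p > 1" and z: "\<And>k. z k \<in> center" "inj z"
  shows "lp_cycles p G F d i \<subseteq> tensor_lp_topology p G (F i) closure_of lp_boundaries p G F d i"
proof
  fix C assume C: "C \<in> lp_cycles p G F d i"
  then have CT: "C \<in> carrier (TP i)"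
    using subgroup.subset[OF cycles_subgroup] by blast
  then obtain c where c: "c \<in> carrier (Fg i)" and Cc: "C = cl i c"
    unfolding T.T_carrier by blast
  from T.cls_expansion[OF projective c] obtain m :: nat and x l
    where xl: "\<forall>j. x j \<in> carrier (F i)" "\<forall>j. l j \<in> carrier (lp_module p G)"
      and rel: "c - (\<Sum>j<m. frag_of (x j, l j)) \<in> Rl i"
    by (elim exE conjE)
  have x: "x j \<in> carrier (F i)" and l: "l j \<in> carrier (lp_module p G)" for j
    using xl by simp_all
  have Cxl: "C = cl i (\<Sum>j<m. frag_of (x j, l j))"
    using rel unfolding Cc by (simp only: T.cls_eq_iff)
  have zG: "z k \<in> carrier G" for k using z(1)[of k] by (simp add: center_def)
  let ?X = "product_topology (\<lambda>_. lp_topology p G) {..<m}"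
  define w where "w N = (\<lambda>j\<in>{..<m}. \<lambda>g. l j g - lp_average G z N (l j) g)" for N
  have w: "(\<lambda>g. l j g - lp_average G z N (l j) g) \<in> carrier (lp_module p G)" for j N
    by (rule lp_module_diff_closed[OF p l lp_average_closed[OF p zG l]])
  have finprod_w: "finprod (TP i) (\<lambda>j. pure_tensor G (F i) (lp_module p G) (x j) (v j)) {..<m}
      = cl i (\<Sum>j<m. frag_of (x j, u j))"
    if "\<And>j. u j \<in> carrier (lp_module p G)" "\<And>j. j < m \<Longrightarrow> v j = u j" for u v
  proof -
    have "finprod (TP i) (\<lambda>j. pure_tensor G (F i) (lp_module p G) (x j) (v j)) {..<m}
        = cl i (\<Sum>j<m. frag_of (x j, v j))"
      using that x by (intro T.finprod_pure_tensor) auto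
    also have "(\<Sum>j<m. frag_of (x j, v j)) = (\<Sum>j<m. frag_of (x j, u j))"
      using that by (intro sum.cong) auto
    finally show ?thesis .
  qed
  have lim: "limitin ?X w (restrict l {..<m}) sequentially"
    unfolding limitin_componentwise
  proof (intro conjI ballI always_eventually allI)
    show "w N \<in> topspace ?X" for N
      by (simp add: p w w_def restrict_PiE_iff)
    show "limitin (lp_topology p G) (\<lambda>N. w N j) (restrict l {..<m} j) sequentially" if "j \<in> {..<m}" for j
      using limitin_minus_average[OF assms(1) z l[of j]] that by (simp add: w_def)
  qed simp
  have "\<exists>y. y \<in> lp_boundaries p G F d i \<and> y \<in> U" if "C \<in> U" "openin (tensor_lp_topology p G (F i)) U" for U
  proof -
    let ?V = "{v \<in> topspace ?X. finprod (TP i) (\<lambda>j. pure_tensor G (F i) (lp_module p G) (x j) (v j)) {..<m} \<in> U}"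
    have "openin ?X ?V"
      using bspec[OF spec[OF conjunct2[OF that(2)[unfolded openin_tensor_lp_topology]], of m], of x] x by simp
    moreover have "restrict l {..<m} \<in> ?V"
      using that(1) finprod_w[OF l, of "restrict l {..<m}"] limitin_topspace[OF lim] by (simp add: Cxl)
    ultimately have "eventually (\<lambda>N. w N \<in> ?V) sequentially"
      by (rule limitinD[OF lim])
    \<comment> \<open>For \<open>N = 0\<close> the average is 0 by the convention for division by
      zero, so \<open>w 0\<close> represents the cycle itself; only \<open>N > 0\<close> yields a
      boundary.\<close>
    then have "eventually (\<lambda>N. N > 0 \<and> w N \<in> ?V) sequentially"
      using eventually_gt_at_top[of "0 :: nat"] by (rule eventually_conj[rotated])
    from eventually_happens'[OF sequentially_bot this] obtain N :: nat where N: "N > 0" "w N \<in> ?V"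
      by (elim exE conjE)
    have "finprod (TP i) (\<lambda>j. pure_tensor G (F i) (lp_module p G) (x j) (w N j)) {..<m}
        = cl i (\<Sum>j<m. frag_of (x j, \<lambda>g. l j g - lp_average G z N (l j) g))"
      by (rule finprod_w[OF w]) (simp add: w_def)
    then have "cl i (\<Sum>j<m. frag_of (x j, \<lambda>g. l j g - lp_average G z N (l j) g)) \<in> U"
      using N(2) by simp
    then show ?thesis
      using tensor_sum_minus_average_boundary[OF z(1) N(1) x l C[unfolded Cxl]] by (intro exI conjI)
  qed
  then show "C \<in> tensor_lp_topology p G (F i) closure_of lp_boundaries p G F d i"
    unfolding in_closure_of using CT by (simp add: topspace_tensor)
qed

theorem reduced_lp_homology_trivial:
  fixes z :: "nat \<Rightarrow> 'g"
  assumes "p > 1" "\<And>k. z k \<in> center" "inj z"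
  shows "trivial_group (reduced_lp_homology p G F d i)"
proof -
  have "tensor_lp_topology p G (F i) closure_of lp_boundaries p G F d i = lp_cycles p G F d i"
    using cycles_subset_closure[OF assms] closure_of_minimal[OF boundaries_subset_cycles closedin_cycles]
    by (rule subset_antisym[rotated])
  then show ?thesis
    unfolding reduced_lp_homology_def
    by (simp only: trivial_group_Mod_self[OF comm_group.axioms(2)[OF T.comm_group_T] cycles_subgroup])
qed

section \<open>Cocycles, coboundaries and reduced cohomology\<close>

abbreviation HG :: "nat \<Rightarrow> ('m \<Rightarrow> 'g \<Rightarrow> complex) monoid" where
  "HG i \<equiv> hom_group ZG (F i) (lp_module p G)"

interpretation L: left_module ZG "lp_module p G"
  by (rule left_module_lp[OF p F.R.ring_axioms])

lemma hom_group_simps: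
  "\<phi> \<in> carrier (HG i) \<longleftrightarrow> \<phi> \<in> lmodule_hom ZG (F i) (lp_module p G) \<and> \<phi> \<in> extensional (carrier (F i))"
  "\<phi> \<otimes>\<^bsub>HG i\<^esub> \<psi> = (\<lambda>x\<in>carrier (F i). \<lambda>g. \<phi> x g + \<psi> x g)"
  "\<one>\<^bsub>HG i\<^esub> = (\<lambda>x\<in>carrier (F i). \<lambda>g. 0)"
  by (simp_all add: hom_group_def)

lemma hom_lp_zero:
  assumes "\<phi> \<in> lmodule_hom ZG (F i) (lp_module p G)"
  shows "\<phi> \<zero>\<^bsub>F i\<^esub> = (\<lambda>g. 0)"
  using abelian_group_hom.hom_zero[OF lmodule_hom_imp_abelian_group_hom[OF F.M.abelian_group_axioms L.M.abelian_group_axioms assms]]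
  by simp

text \<open>The group ring acts by integer combinations of translations, which commute with complex
  scalars. The one statement yields the zero map, sums, negatives and compositions with
  \<open>d\<close>, and later the mean of the cochains witnessing a coboundary.\<close>

lemma lp_linear_combination_hom:
  assumes "\<And>k. k \<in> K \<Longrightarrow> \<phi> k \<in> lmodule_hom ZG (F i) (lp_module p G)"
  shows "(\<lambda>x\<in>carrier (F i). \<lambda>g. \<Sum>k\<in>K. r * \<phi> k x g) \<in> carrier (HG i)"
proof -
  note \<phi> = lmodule_homD[OF assms]
  have "(\<lambda>x\<in>carrier (F i). \<lambda>g. \<Sum>k\<in>K. r * \<phi> k x g) \<in> lmodule_hom ZG (F i) (lp_module p G)"
  proof (rule lmodule_homI)
    fix x assume x: "x \<in> carrier (F i)"
    then show "(\<lambda>x\<in>carrier (F i). \<lambda>g. \<Sum>k\<in>K. r * \<phi> k x g) x \<in> carrier (lp_module p G)"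
      using lp_module_sum_closed[OF p lp_module_scale_closed[OF \<phi>(1)[OF _ x]], of K "\<lambda>k. k" "\<lambda>_. r"] by simp
    fix a assume a: "a \<in> carrier ZG"
    have "(\<Sum>k\<in>K. r * \<phi> k (a \<odot>\<^bsub>F i\<^esub> x) h) = (\<Sum>k\<in>K. r * (a \<odot>\<^bsub>lp_module p G\<^esub> \<phi> k x) h)" for h
      using \<phi>(3)[OF _ a x] by (intro sum.cong) simp_all
    then show "(\<lambda>x\<in>carrier (F i). \<lambda>g. \<Sum>k\<in>K. r * \<phi> k x g) (a \<odot>\<^bsub>F i\<^esub> x)
        = a \<odot>\<^bsub>lp_module p G\<^esub> (\<lambda>x\<in>carrier (F i). \<lambda>g. \<Sum>k\<in>K. r * \<phi> k x g) x"
      using a x by (auto simp: lp_module_smult frag_sum_sum_fun frag_sum_cmult fun_eq_iff)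
  next
    fix x y assume x: "x \<in> carrier (F i)" and y: "y \<in> carrier (F i)"
    have "(\<Sum>k\<in>K. r * \<phi> k (x \<oplus>\<^bsub>F i\<^esub> y) h) = (\<Sum>k\<in>K. r * (\<phi> k x h + \<phi> k y h))" for h
      using \<phi>(2)[OF _ x y] by (intro sum.cong) simp_all
    then show "(\<lambda>x\<in>carrier (F i). \<lambda>g. \<Sum>k\<in>K. r * \<phi> k x g) (x \<oplus>\<^bsub>F i\<^esub> y)
        = (\<lambda>x\<in>carrier (F i). \<lambda>g. \<Sum>k\<in>K. r * \<phi> k x g) x \<oplus>\<^bsub>lp_module p G\<^esub>
          (\<lambda>x\<in>carrier (F i). \<lambda>g. \<Sum>k\<in>K. r * \<phi> k x g) y"
      using x y by (simp add: distrib_left sum.distrib)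
  qed
  then show ?thesis by (simp add: hom_group_simps)
qed

lemma hom_group_group: "group (HG i)"
proof (rule groupI)
  fix \<phi> \<psi> assume \<phi>: "\<phi> \<in> carrier (HG i)" and \<psi>: "\<psi> \<in> carrier (HG i)"
  \<comment> \<open>The sum of two maps is obtained as a linear combination indexed by the two truth
    values.\<close>
  then have "(if k then \<phi> else \<psi>) \<in> lmodule_hom ZG (F i) (lp_module p G)" for k
    by (simp add: hom_group_simps)
  from lp_linear_combination_hom[of UNIV "\<lambda>k. if k then \<phi> else \<psi>" i 1, OF this] show "\<phi> \<otimes>\<^bsub>HG i\<^esub> \<psi> \<in> carrier (HG i)"
    by (simp add: hom_group_simps(2) UNIV_bool add.commute)
next
  show "\<one>\<^bsub>HG i\<^esub> \<in> carrier (HG i)"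
    using lp_linear_combination_hom[of "{}"] by (simp add: hom_group_simps(3))
next
  fix \<phi> assume \<phi>: "\<phi> \<in> carrier (HG i)"
  then have \<phi>ext: "\<phi> \<in> extensional (carrier (F i))" by (simp add: hom_group_simps)
  then show "\<one>\<^bsub>HG i\<^esub> \<otimes>\<^bsub>HG i\<^esub> \<phi> = \<phi>"
    by (auto simp: hom_group_simps(2,3) fun_eq_iff extensional_def)
  have "(\<lambda>x\<in>carrier (F i). \<lambda>g. - \<phi> x g) \<in> carrier (HG i)"
    using lp_linear_combination_hom[of "{()}" "\<lambda>_. \<phi>" i "-1"] \<phi> by (simp add: hom_group_simps)
  moreover have "(\<lambda>x\<in>carrier (F i). \<lambda>g. - \<phi> x g) \<otimes>\<^bsub>HG i\<^esub> \<phi> = \<one>\<^bsub>HG i\<^esub>"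
    by (auto simp: hom_group_simps(2,3) fun_eq_iff)
  ultimately show "\<exists>\<psi>\<in>carrier (HG i). \<psi> \<otimes>\<^bsub>HG i\<^esub> \<phi> = \<one>\<^bsub>HG i\<^esub>"
    by blast
qed (auto simp: hom_group_simps(2) fun_eq_iff add.assoc)

lemma coboundary_closed:
  assumes "\<phi> \<in> carrier (HG i)"
  shows "lp_coboundary F d (Suc i) \<phi> \<in> carrier (HG (Suc i))"
proof -
  have "(\<lambda>x. \<phi> (d (Suc i) x)) \<in> lmodule_hom ZG (F (Suc i)) (lp_module p G)"
    using d_functional[of \<phi> i "lp_module p G"] assms by (simp add: hom_group_simps)
  from lp_linear_combination_hom[of "{()}" "\<lambda>_ x. \<phi> (d (Suc i) x)" "Suc i" 1, OF this] show ?thesis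
    by (simp add: lp_coboundary_def comp_def)
qed

lemma coboundary_hom: "lp_coboundary F d (Suc i) \<in> hom (HG i) (HG (Suc i))"
proof (rule homI)
  fix \<phi> \<psi>
  show "lp_coboundary F d (Suc i) (\<phi> \<otimes>\<^bsub>HG i\<^esub> \<psi>)
      = lp_coboundary F d (Suc i) \<phi> \<otimes>\<^bsub>HG (Suc i)\<^esub> lp_coboundary F d (Suc i) \<psi>"
    using d_closed by (auto simp: lp_coboundary_def hom_group_simps(2) fun_eq_iff)
qed (rule coboundary_closed)

lemma cocycles_iff:
  "\<phi> \<in> lp_cocycles p G F d i \<longleftrightarrow> \<phi> \<in> carrier (HG i) \<and> (\<forall>x\<in>carrier (F (Suc i)). \<phi> (d (Suc i) x) = (\<lambda>g. 0))"
proof -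
  have "restrict (\<phi> \<circ> d (Suc i)) (carrier (F (Suc i))) = (\<lambda>x\<in>carrier (F (Suc i)). \<lambda>g. 0)
      \<longleftrightarrow> (\<forall>x\<in>carrier (F (Suc i)). \<phi> (d (Suc i) x) = (\<lambda>g. 0))"
  proof (intro iffI ballI)
    fix x assume eq: "restrict (\<phi> \<circ> d (Suc i)) (carrier (F (Suc i))) = (\<lambda>x\<in>carrier (F (Suc i)). \<lambda>g. 0)"
      and x: "x \<in> carrier (F (Suc i))"
    show "\<phi> (d (Suc i) x) = (\<lambda>g. 0)"
      using fun_cong[OF eq, of x] x by simp
  next
    assume "\<forall>x\<in>carrier (F (Suc i)). \<phi> (d (Suc i) x) = (\<lambda>g. 0)"
    then show "restrict (\<phi> \<circ> d (Suc i)) (carrier (F (Suc i))) = (\<lambda>x\<in>carrier (F (Suc i)). \<lambda>g. 0)"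
      by (intro restrict_ext) simp
  qed
  then show ?thesis
    by (simp only: lp_cocycles_def kernel_def lp_coboundary_def hom_group_simps(3) mem_Collect_eq)
qed

lemma cocycles_subgroup: "subgroup (lp_cocycles p G F d i) (HG i)"
  unfolding lp_cocycles_def
  by (rule group_hom.subgroup_kernel)
    (simp add: group_hom_def group_hom_axioms_def hom_group_group coboundary_hom)

lemma topspace_hom: "topspace (hom_lp_topology p G (F i)) = carrier (HG i)"
proof -
  have "carrier (HG i) \<subseteq> PiE (carrier (F i)) (\<lambda>_. carrier (lp_module p G))"
  proof
    fix \<phi> assume \<phi>: "\<phi> \<in> carrier (HG i)"
    then have "\<phi> x \<in> carrier (lp_module p G)" if "x \<in> carrier (F i)" for x
      using lmodule_homD(1)[of \<phi> ZG "F i" "lp_module p G" x] that by (simp add: hom_group_simps)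
    then show "\<phi> \<in> PiE (carrier (F i)) (\<lambda>_. carrier (lp_module p G))"
      using \<phi> by (simp add: hom_group_simps PiE_iff)
  qed
  then show ?thesis
    by (simp add: hom_lp_topology_def p Int_absorb1)
qed

lemma continuous_map_hom_eval:
  assumes "x \<in> carrier (F i)"
  shows "continuous_map (hom_lp_topology p G (F i)) euclidean (\<lambda>\<phi>. \<phi> x g)"
  unfolding hom_lp_topology_def
  using continuous_map_compose[OF continuous_map_product_projection[OF assms, of "\<lambda>_. lp_topology p G"] continuous_map_lp_eval[OF p, of G g]]
  by (simp add: comp_def continuous_map_from_subtopology)

text \<open>The cocycle condition is a family of equations on single coordinates
  \<open>\<phi> (d (Suc i) x) g\<close>, each continuous for pointwise convergence.\<close>

lemma closedin_cocycles: "closedin (hom_lp_topology p G (F i)) (lp_cocycles p G F d i)"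
proof -
  let ?X = "hom_lp_topology p G (F i)"
  have eq: "lp_cocycles p G F d i = \<Inter> (insert (topspace ?X)
      ((\<lambda>(x, g). {\<phi> \<in> topspace ?X. \<phi> (d (Suc i) x) g \<in> {0}}) ` (carrier (F (Suc i)) \<times> UNIV)))"
    unfolding set_eq_iff cocycles_iff topspace_hom by (auto simp: fun_eq_iff)
  have "closedin ?X {\<phi> \<in> topspace ?X. \<phi> (d (Suc i) x) g \<in> {0}}" if "x \<in> carrier (F (Suc i))" for x g
    using continuous_map_hom_eval[OF d_closed[OF that]] by (rule closedin_continuous_map_preimage) simp
  then show ?thesis
    unfolding eq by (intro closedin_Inter) auto
qed

lemma coboundaries_subset_cocycles: "lp_coboundaries p G F d i \<subseteq> lp_cocycles p G F d i"
proof (cases i)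
  case 0
  have "\<one>\<^bsub>HG 0\<^esub> \<in> lp_cocycles p G F d 0"
    by (rule subgroup.one_closed[OF cocycles_subgroup])
  then show ?thesis by (simp add: 0 lp_coboundaries_def)
next
  case (Suc k)
  have "lp_coboundary F d (Suc k) \<phi> \<in> lp_cocycles p G F d (Suc k)" if "\<phi> \<in> carrier (HG k)" for \<phi>
    unfolding cocycles_iff
  proof (intro conjI ballI coboundary_closed that)
    fix x assume "x \<in> carrier (F (Suc (Suc k)))"
    then show "lp_coboundary F d (Suc k) \<phi> (d (Suc (Suc k)) x) = (\<lambda>g. 0)"
      using hom_lp_zero[of \<phi> k] that d_closed by (simp add: lp_coboundary_def d_d hom_group_simps(1))
  qed
  then show ?thesis by (auto simp: Suc lp_coboundaries_def)
qed

text \<open>The roles of the two homotopy terms are exchanged compared with homology: the term with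
  \<open>d (Suc i) (h x)\<close> vanishes on a cocycle, and the term factoring through
  \<open>d i\<close> supplies the coboundary.\<close>

lemma cocycle_minus_average_coboundary:
  assumes z: "\<And>k. z k \<in> center" and N: "N > 0" and \<phi>: "\<phi> \<in> lp_cocycles p G F d i"
  shows "(\<lambda>x\<in>carrier (F i). \<lambda>g. \<phi> x g - lp_average G z N (\<phi> x) g) \<in> lp_coboundaries p G F d i"
proof -
  have \<phi>H: "\<phi> \<in> lmodule_hom ZG (F i) (lp_module p G)"
    and cocycle: "\<And>x. x \<in> carrier (F (Suc i)) \<Longrightarrow> \<phi> (d (Suc i) x) = (\<lambda>g. 0)"
    using \<phi> by (auto simp: cocycles_iff hom_group_simps(1))
  have zG: "z k \<in> carrier G" for k using z[of k] by (simp add: center_def)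
  \<comment> \<open>The homotopy is applied to the inverse of \<open>z k\<close>, since
    \<open>lp_translate G (z k)\<close> is the action of that inverse.\<close>
  have inv_z: "inv (z k) \<in> center" for k
    unfolding center_def
  proof (intro CollectI conjI ballI)
    fix g assume g: "g \<in> carrier G"
    have "z k \<otimes> g = g \<otimes> z k" using z[of k] g by (simp add: center_def)
    then have "inv (z k) \<otimes> (z k \<otimes> g) \<otimes> inv (z k) = inv (z k) \<otimes> (g \<otimes> z k) \<otimes> inv (z k)"
      by simp
    then show "inv (z k) \<otimes> g = g \<otimes> inv (z k)"
      using g zG[of k] by (simp add: m_assoc inv_solve_left')
  qed (simp add: zG)
  define P where "P k \<kappa> \<longleftrightarrow> factors_through_d i (lp_module p G) \<kappa> \<and>
      (\<forall>x\<in>carrier (F i). \<phi> x = (\<lambda>g. lp_translate G (z k) (\<phi> x) g + \<kappa> x g))" for k \<kappa>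
  have "\<exists>\<kappa>. P k \<kappa>" for k
  proof -
    obtain h where h: "h \<in> lmodule_hom ZG (F i) (F (Suc i))"
      and "\<forall>\<phi>\<in>lmodule_hom ZG (F i) (lp_module p G). \<exists>\<kappa>. factors_through_d i (lp_module p G) \<kappa> \<and>
        (\<forall>x\<in>carrier (F i). \<phi> x = \<phi> (frag_of (inv (z k)) \<odot>\<^bsub>F i\<^esub> x) \<oplus>\<^bsub>lp_module p G\<^esub> (\<phi> (d (Suc i) (h x)) \<oplus>\<^bsub>lp_module p G\<^esub> \<kappa> x))"
      using homotopy_hom[OF inv_z[of k] L.left_module_axioms, of i] by (elim bexE)
    then obtain \<kappa> where \<kappa>: "factors_through_d i (lp_module p G) \<kappa>"
      and eq: "\<forall>x\<in>carrier (F i). \<phi> x = \<phi> (frag_of (inv (z k)) \<odot>\<^bsub>F i\<^esub> x) \<oplus>\<^bsub>lp_module p G\<^esub> (\<phi> (d (Suc i) (h x)) \<oplus>\<^bsub>lp_module p G\<^esub> \<kappa> x)"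
      using \<phi>H by blast
    have "\<phi> x = (\<lambda>g. lp_translate G (z k) (\<phi> x) g + \<kappa> x g)" if x: "x \<in> carrier (F i)" for x
    proof -
      have "\<phi> (frag_of (inv (z k)) \<odot>\<^bsub>F i\<^esub> x) = lp_translate G (z k) (\<phi> x)"
        using lmodule_homD(3)[OF \<phi>H frag_of_z[OF inv_z] x] frag_of_inv_smult[OF group_axioms zG] by simp
      moreover have "\<phi> (d (Suc i) (h x)) = (\<lambda>g. 0)"
        by (rule cocycle[OF lmodule_homD(1)[OF h x]])
      ultimately show ?thesis
        using bspec[OF eq x] by simp
    qed
    with \<kappa> show ?thesis unfolding P_def by blast
  qed
  then obtain \<kappa> where P: "\<And>k. P k (\<kappa> k)" by metis
  define r :: complex where "r = of_real (1 / real N)"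
  have r: "of_nat N * r = 1" using N by (simp add: r_def)
  have avg: "\<phi> x g - lp_average G z N (\<phi> x) g = (\<Sum>k<N. r * \<kappa> k x g)" if x: "x \<in> carrier (F i)" for x g
  proof -
    have *: "\<kappa> k x g = \<phi> x g - lp_translate G (z k) (\<phi> x) g" for k
      using P[of k] x fun_cong[of "\<phi> x" _ g] unfolding P_def by (metis add_diff_cancel_left')
    have "(\<Sum>k<N. r * \<kappa> k x g) = of_nat N * r * \<phi> x g - r * (\<Sum>k<N. lp_translate G (z k) (\<phi> x) g)"
      by (simp add: * right_diff_distrib sum_subtractf sum_distrib_left)
    moreover have "lp_average G z N (\<phi> x) g = r * (\<Sum>k<N. lp_translate G (z k) (\<phi> x) g)"
      by (simp only: lp_average_def r_def)
    ultimately show ?thesis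
      by (simp add: r)
  qed
  show ?thesis
  proof (cases i)
    case 0
    \<comment> \<open>In degree 0 the values of a cocycle are invariant under the translations by
      the \<open>z k\<close>, so for \<open>N > 0\<close> they equal their averages and the
      difference is the zero map, the only coboundary there.\<close>
    have "\<kappa> k x = (\<lambda>g. 0)" if "x \<in> carrier (F 0)" for k x
      using P[of k] that by (simp add: P_def 0 factors_through_d_def)
    then have "(\<lambda>x\<in>carrier (F 0). \<lambda>g. \<phi> x g - lp_average G z N (\<phi> x) g) = \<one>\<^bsub>HG 0\<^esub>"
      unfolding hom_group_simps(3) by (intro restrict_ext) (simp add: avg[unfolded 0])
    then show ?thesis by (simp add: 0 lp_coboundaries_def)
  next
    case (Suc j)
    have "\<exists>\<psi>. \<psi> \<in> lmodule_hom ZG (F j) (lp_module p G) \<and> (\<forall>x\<in>carrier (F (Suc j)). \<kappa> k x = \<psi> (d (Suc j) x))" for k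
      using P[of k] by (auto simp: P_def Suc factors_through_d_def)
    then obtain \<psi> where \<psi>: "\<And>k. \<psi> k \<in> lmodule_hom ZG (F j) (lp_module p G)"
      and \<kappa>: "\<And>k x. x \<in> carrier (F (Suc j)) \<Longrightarrow> \<kappa> k x = \<psi> k (d (Suc j) x)"
      by metis
    let ?\<psi> = "\<lambda>y\<in>carrier (F j). \<lambda>g. \<Sum>k<N. r * \<psi> k y g"
    have "?\<psi> \<in> carrier (HG j)"
      by (rule lp_linear_combination_hom[OF \<psi>])
    moreover have "(\<lambda>x\<in>carrier (F (Suc j)). \<lambda>g. \<phi> x g - lp_average G z N (\<phi> x) g) = lp_coboundary F d (Suc j) ?\<psi>"
      unfolding lp_coboundary_def by (intro restrict_ext) (simp add: avg[unfolded Suc] \<kappa> d_closed)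
    ultimately show ?thesis by (simp add: Suc lp_coboundaries_def)
  qed
qed

text \<open>The topology is that of pointwise convergence, so it is enough that the averages of
  \<open>\<phi> x\<close> tend to 0 for each \<open>x\<close> separately, without uniformity in
  \<open>x\<close>.\<close>

lemma cocycles_subset_closure:
  fixes z :: "nat \<Rightarrow> 'g"
  assumes "p > 1" and z: "\<And>k. z k \<in> center" "inj z"
  shows "lp_cocycles p G F d i \<subseteq> hom_lp_topology p G (F i) closure_of lp_coboundaries p G F d i"
proof
  fix \<phi> assume \<phi>: "\<phi> \<in> lp_cocycles p G F d i"
  then have \<phi>H: "\<phi> \<in> carrier (HG i)" by (simp add: cocycles_iff)
  define w where "w N = (\<lambda>x\<in>carrier (F i). \<lambda>g. \<phi> x g - lp_average G z N (\<phi> x) g)" for N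
  have w: "w N \<in> lp_coboundaries p G F d i" if "N > 0" for N
    unfolding w_def by (rule cocycle_minus_average_coboundary[OF z(1) that \<phi>])
  have ev: "eventually (\<lambda>N. w N \<in> lp_coboundaries p G F d i) sequentially"
    using eventually_gt_at_top[of "0 :: nat"] by eventually_elim (rule w)
  have evH: "eventually (\<lambda>N. w N \<in> carrier (HG i)) sequentially"
    using ev by eventually_elim (use coboundaries_subset_cocycles[of i] in \<open>auto simp: cocycles_iff\<close>)
  have "limitin (hom_lp_topology p G (F i)) w \<phi> sequentially"
    unfolding hom_lp_topology_def limitin_subtopology limitin_componentwise
  proof (intro conjI ballI)
    show "\<phi> \<in> carrier (HG i)" "eventually (\<lambda>N. w N \<in> carrier (HG i)) sequentially"
      by (rule \<phi>H, rule evH)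
    show "\<phi> \<in> extensional (carrier (F i))" using \<phi>H by (simp add: hom_group_simps)
    have "carrier (HG i) \<subseteq> topspace (product_topology (\<lambda>_. lp_topology p G) (carrier (F i)))"
      using topspace_hom[of i] unfolding hom_lp_topology_def topspace_subtopology by blast
    then show "eventually (\<lambda>N. w N \<in> topspace (product_topology (\<lambda>_. lp_topology p G) (carrier (F i)))) sequentially"
      by (rule eventually_mono[OF evH subsetD])
    show "limitin (lp_topology p G) (\<lambda>N. w N x) (\<phi> x) sequentially" if x: "x \<in> carrier (F i)" for x
    proof -
      have "\<phi> x \<in> carrier (lp_module p G)"
        using \<phi>H lmodule_homD(1)[of \<phi> ZG "F i" "lp_module p G" x] x by (simp add: hom_group_simps)
      from limitin_minus_average[OF assms(1) z this] x show ?thesis by (simp add: w_def)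
    qed
  qed
  then show "\<phi> \<in> hom_lp_topology p G (F i) closure_of lp_coboundaries p G F d i"
  proof (rule limitin_closedin)
    show "eventually (\<lambda>N. w N \<in> hom_lp_topology p G (F i) closure_of lp_coboundaries p G F d i) sequentially"
      using ev closure_of_subset[of "lp_coboundaries p G F d i" "hom_lp_topology p G (F i)"]
        coboundaries_subset_cocycles[of i] subgroup.subset[OF cocycles_subgroup[of i]]
      by (auto simp: topspace_hom elim!: eventually_mono)
  qed simp_all
qed

theorem reduced_lp_cohomology_trivial:
  fixes z :: "nat \<Rightarrow> 'g"
  assumes "p > 1" "\<And>k. z k \<in> center" "inj z"
  shows "trivial_group (reduced_lp_cohomology p G F d i)"
proof -
  have "hom_lp_topology p G (F i) closure_of lp_coboundaries p G F d i = lp_cocycles p G F d i"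
    using cocycles_subset_closure[OF assms] closure_of_minimal[OF coboundaries_subset_cocycles closedin_cocycles]
    by (rule subset_antisym[rotated])
  then show ?thesis
    unfolding reduced_lp_cohomology_def
    by (simp only: trivial_group_Mod_self[OF hom_group_group cocycles_subgroup])
qed

end

end

theorem corollary6p1:
  fixes p :: real and n :: nat
    and G :: "('g, 'x) monoid_scheme"
    and F :: "nat \<Rightarrow> ('g \<Rightarrow>\<^sub>0 int, 'm) module"
    and d :: "nat \<Rightarrow> 'm \<Rightarrow> 'm"
    and \<epsilon> :: "'m \<Rightarrow> int"
  assumes "p > 1" and "n \<ge> 1"
    and "group G" and "infinite (carrier G)"
    and "type_FP n G"
    and "FCC_group G"
    and "projective_resolution G F d \<epsilon>"
    and "\<forall>i \<le> n. finitely_generated_module (group_ring G) (F i)"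
  shows "\<forall>i \<le> n. trivial_group (reduced_lp_homology p G F d i) \<and>
                 trivial_group (reduced_lp_cohomology p G F d i)"
proof -
  interpret group_resolution G F d \<epsilon>
    using assms(3,7) by (simp add: group_resolution_def group_resolution_axioms_def)
  \<comment> \<open>This is where \<open>n \<ge> 1\<close> enters: degree 1 is among the degrees
    with a finitely generated module, as the infinitude of the centre demands.\<close>
  have "finitely_generated_module (group_ring G) (F (Suc 0))"
    using assms(2,8) by auto
  then have "infinite center"
    by (rule infinite_center[OF assms(6,4)])
  then obtain z :: "nat \<Rightarrow> 'g" where z: "inj z" "range z \<subseteq> center"
    using infinite_countable_subset by blast
  have zc: "z k \<in> center" for k using z(2) by blast
  have p: "p \<ge> 1" using assms(1) by simp
  show ?thesis
  proof (intro allI impI conjI)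
    fix i
    show "trivial_group (reduced_lp_homology p G F d i)"
      by (rule reduced_lp_homology_trivial[OF p assms(1) zc z(1)])
    show "trivial_group (reduced_lp_cohomology p G F d i)"
      by (rule reduced_lp_cohomology_trivial[OF p assms(1) zc z(1)])
  qed
qed

end
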